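(* Let $n\ge 2$ be an integer and let $k,j\ge 0$ be integers. A monomial basis $B^{(k,j)}_{\mathfrak{I}_{2}(n)}$ for the dihedral coinvariant ring $R^{(k,j)}_{\mathfrak{I}_{2}(n)}$ (that is, a set of monomials whose images form a $\mathbb{C}$-vector space basis of this quotient ring) is given by $$\begin{aligned} &\{(x_{1}^{(1)})^{\alpha_1} \cdots (x_{1}^{(k)})^{\alpha_k}(\theta_{1}^{(1)})^{\beta_1} \cdots (\theta_{1}^{(j)})^{\beta_j} \mid 0 \leq \alpha_1 + \cdots + \alpha_k + \beta_1 + \cdots + \beta_j \leq n-1\}\\ &\cup \bigcup_{i=1}^k \{(x_{1}^{(i)})^{\alpha_i} \cdots (x_{1}^{(k)})^{\alpha_k} (\theta_{1}^{(1)})^{\beta_1} \cdots (\theta_{1}^{(j)})^{\beta_j} x_{2}^{(i)} \mid 0\leq \alpha_i + \cdots + \alpha_k + \beta_1 + \cdots + \beta_j \leq n-1\}\\ &\cup \bigcup_{i=1}^j \{(\theta_{1}^{(i+1)})^{\beta_{i+1}} \cdots (\theta_{1}^{(j)})^{\beta_j} \theta_{2}^{(i)} \mid 0\leq \beta_{i+1} + \cdots + \beta_j \leq n-1\}\\ &\cup \{x_{1}^{(h)}x_{2}^{(i)}\mid 1 \leq h < i \leq k\} \cup \{x_{1}^{(h)}\theta_{2}^{(i)}\mid 1 \leq h \leq k,\ 1 \leq i \leq j\} \cup \{\theta_{1}^{(h)}\theta_{2}^{(i)}\mid 1 \leq h \leq i \leq j\}, \end{aligned}$$ where the $\alpha_i$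 range over nonnegative integers and the $\beta_i$ range over $\{0,1\}$.
   Context: **The group.** $\mathfrak{I}_2(n)$ is the dihedral group of order $2n$, realized inside $\mathrm{GL}_2(\mathbb{C})$ as generated by $$\rho=\begin{bmatrix}\cos\frac{2\pi}{n}&-\sin\frac{2\pi}{n}\\ \sin\frac{2\pi}{n}&\cos\frac{2\pi}{n}\end{bmatrix},\qquad \phi=\begin{bmatrix}1&0\\0&-1\end{bmatrix}.$$ **The ring.** Let $S=\mathbb{C}[\boldsymbol{x}^{(1)},\ldots,\boldsymbol{x}^{(k)},\boldsymbol{\theta}^{(1)},\ldots,\boldsymbol{\theta}^{(j)}]$ be the $\mathbb{C}$-algebra generated by commuting (bosonic) variables $x_1^{(a)},x_2^{(a)}$ ($1\le a\le k$) and anticommuting (fermionic) variables $\theta_1^{(b)},\theta_2^{(b)}$ ($1\le b\le j$). The bosonic variables commute with all variables; the fermionic variables anticommute with each other, and in particular square to zero. The group $\mathfrak{I}_2(n)$ acts diagonally on $S$ by algebra automorphisms: each $g$ acts on each pair $(x_1^{(a)},x_2^{(a)})$ and each pair $(\theta_1^{(b)},\theta_2^{(b)})$ as a basis of $\mathbb{C}^2$ through the $2\times2$ matrix of $g$, i.e. $g\cdot v_s=\sum_r g_{rs}v_r$. Let $I^{(k,j)}_{\mathfrak{I}_2(n)}$ be the ideal of $S$ generated by all $\mathfrak{I}_2(n)$-invariant elements with zero constant term, and let $R^{(k,j)}_{\mathfrak{I}_2(n)}=S/I^{(k,j)}_{\mathfrak{I}_2(n)}$. *)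

theory Defs
  imports
    "HOL-Analysis.Analysis"
    "HOL-Library.Poly_Mapping"
    "HOL-Library.FSet"
    "HOL-Algebra.Algebra"
    "HOL-Algebra.Algebraic_Closure_Type"
begin

section \<open>Grassmann algebras\<close>

text \<open>
  The Grassmann algebra over a commutative ring on anticommuting generators indexed by a linearly
  ordered type.  An element is given by its coefficients on the standard basis
  \<open>\<theta>\<^sub>A = \<theta>\<^bsub>a\<^sub>1\<^esub> \<cdots> \<theta>\<^bsub>a\<^sub>m\<^esub>\<close> with \<open>A = {a\<^sub>1 < \<cdots> < a\<^sub>m}\<close>.
\<close>

typedef (overloaded) ('v, 'a) grassmann = "UNIV :: ('v fset \<Rightarrow>\<^sub>0 'a::zero) set"
  morphisms coeffs Grassmann
  by simp

setup_lifting type_definition_grassmann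

abbreviation gcoeff :: "('v, 'a::zero) grassmann \<Rightarrow> 'v fset \<Rightarrow> 'a" where
  "gcoeff f \<equiv> Poly_Mapping.lookup (coeffs f)"

lemma grassmann_eqI: "(\<And>A. gcoeff f A = gcoeff g A) \<Longrightarrow> f = g"
  by (metis coeffs_inject poly_mapping_eqI)

text \<open>The sign with \<open>\<theta>\<^sub>A \<theta>\<^sub>B = \<plusminus>\<theta>\<^bsub>A \<union> B\<^esub>\<close> for disjoint \<open>A\<close> and \<open>B\<close>.\<close>

definition reorder_sign :: "'v::linorder fset \<Rightarrow> 'v fset \<Rightarrow> 'a::comm_ring_1" where
  "reorder_sign A B = (- 1) ^ card {(a, b). a |\<in>| A \<and> b |\<in>| B \<and> b < a}"

lemma finite_inversions: "finite {(a, b). a |\<in>| A \<and> b |\<in>| B \<and> b < a}"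
  by (rule finite_subset[of _ "fset A \<times> fset B"]) auto

lemma reorder_sign_empty [simp]: "reorder_sign {||} B = 1" "reorder_sign A {||} = 1"
  by (simp_all add: reorder_sign_def)

lemma reorder_sign_union_left:
  assumes "A |\<inter>| B = {||}"
  shows "(reorder_sign (A |\<union>| B) C :: 'a::comm_ring_1) = reorder_sign A C * reorder_sign B C"
proof -
  have "{(a, b). a |\<in>| A |\<union>| B \<and> b |\<in>| C \<and> b < a}
      = {(a, b). a |\<in>| A \<and> b |\<in>| C \<and> b < a} \<union> {(a, b). a |\<in>| B \<and> b |\<in>| C \<and> b < a}"
    by auto
  moreover have "{(a, b). a |\<in>| A \<and> b |\<in>| C \<and> b < a} \<inter> {(a, b). a |\<in>| B \<and> b |\<in>| C \<and> b < a} = {}"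
    using assms by auto
  ultimately show ?thesis
    by (simp add: reorder_sign_def card_Un_disjoint finite_inversions power_add)
qed

lemma reorder_sign_union_right:
  assumes "B |\<inter>| C = {||}"
  shows "(reorder_sign A (B |\<union>| C) :: 'a::comm_ring_1) = reorder_sign A B * reorder_sign A C"
proof -
  have "{(a, b). a |\<in>| A \<and> b |\<in>| B |\<union>| C \<and> b < a}
      = {(a, b). a |\<in>| A \<and> b |\<in>| B \<and> b < a} \<union> {(a, b). a |\<in>| A \<and> b |\<in>| C \<and> b < a}"
    by auto
  moreover have "{(a, b). a |\<in>| A \<and> b |\<in>| B \<and> b < a} \<inter> {(a, b). a |\<in>| A \<and> b |\<in>| C \<and> b < a} = {}"
    using assms by auto
  ultimately show ?thesis
    by (simp add: reorder_sign_def card_Un_disjoint finite_inversions power_add)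
qed

lemma finite_fsubsets [simp]: "finite {A. A |\<subseteq>| C}"
  by (rule finite_subset[of _ "fset (fPow C)"]) auto

instantiation grassmann :: (type, ab_group_add) ab_group_add
begin

lift_definition zero_grassmann :: "('a, 'b) grassmann" is 0 .
lift_definition plus_grassmann :: "('a, 'b) grassmann \<Rightarrow> ('a, 'b) grassmann \<Rightarrow> ('a, 'b) grassmann"
  is "(+)" .
lift_definition minus_grassmann :: "('a, 'b) grassmann \<Rightarrow> ('a, 'b) grassmann \<Rightarrow> ('a, 'b) grassmann"
  is "(-)" .
lift_definition uminus_grassmann :: "('a, 'b) grassmann \<Rightarrow> ('a, 'b) grassmann"
  is uminus .

instance by standard (transfer, simp add: algebra_simps)+

end

definition gconst :: "'a::zero \<Rightarrow> ('v, 'a) grassmann" where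
  "gconst c = Grassmann (Poly_Mapping.single {||} c)"

definition ggen :: "'v \<Rightarrow> ('v, 'a::zero_neq_one) grassmann" where
  "ggen v = Grassmann (Poly_Mapping.single {|v|} 1)"

lemma gcoeff_zero [simp]: "gcoeff 0 A = 0"
  by transfer simp
lemma gcoeff_add [simp]: "gcoeff (f + g) A = gcoeff f A + gcoeff g A"
  by transfer (simp add: lookup_add)
lemma gcoeff_uminus [simp]: "gcoeff (- f) A = - gcoeff f A"
  by transfer simp
lemma gcoeff_gconst: "gcoeff (gconst c) A = (c when A = {||})"
  by (simp add: gconst_def Grassmann_inverse lookup_single eq_commute)
lemma gcoeff_ggen: "gcoeff (ggen v) A = (1 when A = {|v|})"
  by (simp add: ggen_def Grassmann_inverse lookup_single eq_commute)

instantiation grassmann :: (linorder, comm_ring_1) ring_1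
begin

definition one_grassmann :: "('a, 'b) grassmann" where
  "one_grassmann = gconst 1"

definition times_grassmann :: "('a, 'b) grassmann \<Rightarrow> ('a, 'b) grassmann \<Rightarrow> ('a, 'b) grassmann" where
  "f * g = Grassmann (Abs_poly_mapping (\<lambda>C. \<Sum>A | A |\<subseteq>| C.
     reorder_sign A (C |-| A) * gcoeff f A * gcoeff g (C |-| A)))"

lemma gcoeff_mult:
  fixes f g :: "('a, 'b) grassmann"
  shows "gcoeff (f * g) C = (\<Sum>A | A |\<subseteq>| C. reorder_sign A (C |-| A) * gcoeff f A * gcoeff g (C |-| A))"
proof -
  let ?h = "\<lambda>C. \<Sum>A | A |\<subseteq>| C. reorder_sign A (C |-| A) * gcoeff f A * gcoeff g (C |-| A)"
  have "{C. ?h C \<noteq> 0} \<subseteq> (\<lambda>(A, B). A |\<union>| B) ` (Poly_Mapping.keys (coeffs f)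
      \<times> Poly_Mapping.keys (coeffs g))"
  proof
    fix C assume "C \<in> {C. ?h C \<noteq> 0}"
    then obtain A where "A |\<subseteq>| C" "reorder_sign A (C |-| A) * gcoeff f A * gcoeff g (C |-| A) \<noteq> 0"
      by (metis (mono_tags, lifting) mem_Collect_eq sum.neutral)
    then have "A \<in> Poly_Mapping.keys (coeffs f)"
      "C |-| A \<in> Poly_Mapping.keys (coeffs g)" "C = A |\<union>| (C |-| A)"
      by (auto simp: in_keys_iff)
    then show "C \<in> (\<lambda>(A, B). A |\<union>| B) ` (Poly_Mapping.keys (coeffs f)
      \<times> Poly_Mapping.keys (coeffs g))"
      by (metis (no_types, lifting) SigmaI case_prod_conv image_eqI)
  qed
  then have "finite {C. ?h C \<noteq> 0}"
    by (rule finite_subset) simp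
  then show ?thesis
    by (simp add: times_grassmann_def Grassmann_inverse)
qed

instance
proof
  fix f g h :: "('a, 'b) grassmann"
  show "f * g * h = f * (g * h)"
  proof (rule grassmann_eqI)
    fix C
    let ?s = "reorder_sign :: 'a fset \<Rightarrow> 'a fset \<Rightarrow> 'b"
    have "gcoeff (f * g * h) C = (\<Sum>U\<in>{U. U |\<subseteq>| C}. \<Sum>A\<in>{A. A |\<subseteq>| U}.
        ?s U (C |-| U) * ?s A (U |-| A) * gcoeff f A * gcoeff g (U |-| A) * gcoeff h (C |-| U))"
      by (simp add: gcoeff_mult sum_distrib_left sum_distrib_right mult_ac)
    also have "\<dots> = (\<Sum>(U, A) \<in> (SIGMA U:{U. U |\<subseteq>| C}. {A. A |\<subseteq>| U}).
        ?s U (C |-| U) * ?s A (U |-| A) * gcoeff f A * gcoeff g (U |-| A) * gcoeff h (C |-| U))"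
      by (simp add: sum.Sigma)
    also have "\<dots> = (\<Sum>(A, B) \<in> (SIGMA A:{A. A |\<subseteq>| C}. {B. B |\<subseteq>| C |-| A}).
        ?s A (C |-| A) * ?s B (C |-| A |-| B) * gcoeff f A * gcoeff g B * gcoeff h (C |-| A |-| B))"
    proof (rule sum.reindex_bij_witness[where i = "\<lambda>(A, B). (A |\<union>| B, A)" and j = "\<lambda>(U, A). (A, U |-| A)"],
        goal_cases)
      case (5 p)
      obtain U A where p: "p = (U, A)" by force
      with 5 have le: "U |\<subseteq>| C" "A |\<subseteq>| U" by auto
      have e: "A |\<union>| (U |-| A) = U" "C |-| A |-| (U |-| A) = C |-| U"
        "(U |-| A) |\<union>| (C |-| U) = C |-| A"
        using le by (auto simp: fset_eq_iff)
      have "?s U (C |-| U) = ?s A (C |-| U) * ?s (U |-| A) (C |-| U)"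
        using reorder_sign_union_left[of A "U |-| A" "C |-| U"] e(1) by auto
      moreover have "?s A (C |-| A) = ?s A (U |-| A) * ?s A (C |-| U)"
        using reorder_sign_union_right[of "U |-| A" "C |-| U" A] e(3) le by force
      ultimately show ?case
        by (simp add: p e(2) mult_ac)
    qed (auto 0 3)
    also have "\<dots> = gcoeff (f * (g * h)) C"
      by (simp add: gcoeff_mult sum.Sigma[symmetric] sum_distrib_left sum_distrib_right mult_ac)
    finally show "gcoeff (f * g * h) C = gcoeff (f * (g * h)) C" .
  qed
  show "1 * f = f"
  proof (rule grassmann_eqI)
    fix C
    have "gcoeff (1 * f) C = (\<Sum>A | A |\<subseteq>| C. gcoeff f C when A = {||})"
      unfolding gcoeff_mult one_grassmann_def
      by (rule sum.cong) (auto simp: gcoeff_gconst when_def)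
    then show "gcoeff (1 * f) C = gcoeff f C"
      by (simp add: when_def sum.If_cases Collect_conv_if)
  qed
  show "f * 1 = f"
  proof (rule grassmann_eqI)
    fix C
    have "gcoeff (f * 1) C = (\<Sum>A | A |\<subseteq>| C. gcoeff f C when A = C)"
      unfolding gcoeff_mult one_grassmann_def
      by (rule sum.cong) (auto simp: gcoeff_gconst when_def)
    then show "gcoeff (f * 1) C = gcoeff f C"
      by (simp add: when_def sum.If_cases Collect_conv_if)
  qed
  show "(f + g) * h = f * h + g * h" "f * (g + h) = f * g + f * h"
    by (rule grassmann_eqI; simp add: gcoeff_mult algebra_simps sum.distrib)+
  show "(0 :: ('a, 'b) grassmann) \<noteq> 1"
  proof
    assume "(0 :: ('a, 'b) grassmann) = 1"
    then have "gcoeff (0 :: ('a, 'b) grassmann) {||} = gcoeff (1 :: ('a, 'b) grassmann) {||}"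
      by (rule arg_cong)
    then show False
      by (simp add: one_grassmann_def gcoeff_gconst)
  qed
qed

end

lemma gcoeff_ggen_mult_ggen:
  "gcoeff (ggen v * ggen w :: ('v::linorder, 'a::comm_ring_1) grassmann) C
     = ((if v < w then 1 else - 1) when v \<noteq> w \<and> C = {|v, w|})"
proof -
  have "gcoeff (ggen v * ggen w :: ('v, 'a) grassmann) C =
      (\<Sum>A | A |\<subseteq>| C. (reorder_sign {|v|} {|w|} when v |\<in>| C \<and> C |-| {|v|} = {|w|}) when A = {|v|})"
    unfolding gcoeff_mult by (rule sum.cong) (auto simp: gcoeff_ggen when_def)
  also have "\<dots> = (reorder_sign {|v|} {|w|} when v |\<in>| C \<and> C |-| {|v|} = {|w|})"
    by (auto simp: when_def sum.If_cases Collect_conv_if)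
  also have "v |\<in>| C \<and> C |-| {|v|} = {|w|} \<longleftrightarrow> v \<noteq> w \<and> C = {|v, w|}"
    by (auto simp: fset_eq_iff)
  also have "{(a, b). a |\<in>| {|v|} \<and> b |\<in>| {|w|} \<and> b < a} = (if w < v then {(v, w)} else {})"
    by auto
  then have "(reorder_sign {|v|} {|w|} :: 'a) = (if w < v then - 1 else 1)"
    by (simp add: reorder_sign_def)
  ultimately show ?thesis
    by (auto simp: when_def)
qed

lemma ggen_anticommute:
  "ggen v * ggen w = - (ggen w * ggen v :: ('v::linorder, 'a::comm_ring_1) grassmann)"
  by (rule grassmann_eqI) (auto simp: gcoeff_ggen_mult_ggen when_def)

lemma ggen_square_zero: "ggen v * ggen v = (0 :: ('v::linorder, 'a::comm_ring_1) grassmann)"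
  by (rule grassmann_eqI) (simp add: gcoeff_ggen_mult_ggen)

lemma gconst_central: "gconst c * f = f * (gconst c :: ('v::linorder, 'a::comm_ring_1) grassmann)"
proof (rule grassmann_eqI)
  fix C
  have "gcoeff (gconst c * f) C = (\<Sum>A | A |\<subseteq>| C. c * gcoeff f C when A = {||})"
    unfolding gcoeff_mult by (rule sum.cong) (auto simp: gcoeff_gconst when_def)
  moreover have "gcoeff (f * gconst c) C = (\<Sum>A | A |\<subseteq>| C. c * gcoeff f C when A = C)"
    unfolding gcoeff_mult by (rule sum.cong) (auto simp: gcoeff_gconst when_def)
  ultimately show "gcoeff (gconst c * f) C = gcoeff (f * gconst c) C"
    by (simp add: when_def sum.If_cases Collect_conv_if)
qed


section \<open>The ring of bosonic and fermionic variables\<close>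

text \<open>
  \<open>Idx a s\<close> is the index of the \<open>s\<close>-th variable of the \<open>a\<close>-th copy.  The linear order only serves
  to fix the standard basis of the Grassmann algebra; note that \<open>2 = 0\<close> in the type \<open>2\<close>, and that
  here component 1 precedes component 2.
\<close>

datatype idx = Idx (copy: nat) (comp: 2)

instantiation idx :: linorder
begin

definition less_idx :: "idx \<Rightarrow> idx \<Rightarrow> bool" where
  "v < w \<longleftrightarrow> copy v < copy w \<or> copy v = copy w \<and> comp v = 1 \<and> comp w = 2"

definition less_eq_idx :: "idx \<Rightarrow> idx \<Rightarrow> bool" where
  "v \<le> w \<longleftrightarrow> v < w \<or> v = (w :: idx)"

instance
proof
  fix v w :: idx
  have "comp v = 1 \<or> comp v = 2" "comp w = 1 \<or> comp w = 2"
    using exhaust_2 by auto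
  then show "v \<le> w \<or> w \<le> v"
    by (auto simp: less_idx_def less_eq_idx_def idx.expand)
qed (auto simp: less_idx_def less_eq_idx_def)

end

text \<open>Polynomials in the bosonic variables, and the Grassmann algebra over them.\<close>

type_synonym bpoly = "(idx \<Rightarrow>\<^sub>0 nat) \<Rightarrow>\<^sub>0 complex"
type_synonym superpoly = "(idx, bpoly) grassmann"

definition bvar :: "idx \<Rightarrow> bpoly" where
  "bvar v = Poly_Mapping.single (Poly_Mapping.single v 1) 1"

definition bconst :: "complex \<Rightarrow> bpoly" where
  "bconst c = Poly_Mapping.single 0 c"

definition sconst :: "complex \<Rightarrow> superpoly" where
  "sconst c = gconst (bconst c)"

text \<open>\<open>bos a s\<close> and \<open>fer b s\<close> are the variables \<open>x\<^sub>s\<close> and \<open>\<theta>\<^sub>s\<close> of the \<open>a\<close>-th bosonic and the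
  \<open>b\<close>-th fermionic copy.\<close>

definition bos :: "nat \<Rightarrow> 2 \<Rightarrow> superpoly" where
  "bos a s = gconst (bvar (Idx a s))"

definition fer :: "nat \<Rightarrow> 2 \<Rightarrow> superpoly" where
  "fer b s = ggen (Idx b s)"

definition const_term :: "superpoly \<Rightarrow> complex" where
  "const_term f = Poly_Mapping.lookup (gcoeff f {||}) 0"

text \<open>The type \<open>superpoly\<close> has infinitely many copies of both kinds of variables; \<open>S\<close> consists of the
  elements in which only \<open>k\<close> bosonic and \<open>j\<close> fermionic copies occur.\<close>

definition super_ring :: "nat \<Rightarrow> nat \<Rightarrow> superpoly ring" where
  "super_ring k j = ring_of_type_algebra \<lparr>carrier :=
     {f. \<forall>A \<in> Poly_Mapping.keys (coeffs f). (\<forall>v. v |\<in>| A \<longrightarrow> copy v \<in> {1..j}) \<and>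
           (\<forall>m \<in> Poly_Mapping.keys (gcoeff f A). \<forall>v \<in> Poly_Mapping.keys m. copy v \<in> {1..k})}\<rparr>"

definition super_vars :: "nat \<Rightarrow> nat \<Rightarrow> superpoly set" where
  "super_vars k j = {bos a s | a s. a \<in> {1..k}} \<union> {fer b s | b s. b \<in> {1..j}}"

definition monomials :: "nat \<Rightarrow> nat \<Rightarrow> superpoly set" where
  "monomials k j = {prod_list vs | vs. set vs \<subseteq> super_vars k j}"


section \<open>The dihedral group and its action\<close>

definition GL2 :: "(complex^2^2) monoid" where
  "GL2 = \<lparr>carrier = {A. invertible A}, mult = (**), one = mat 1\<rparr>"

definition rho :: "nat \<Rightarrow> complex^2^2" where
  "rho n = vector
     [vector [complex_of_real (cos (2 * pi / real n)), - complex_of_real (sin (2 * pi / real n))],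
      vector [complex_of_real (sin (2 * pi / real n)), complex_of_real (cos (2 * pi / real n))]]"

definition phi :: "complex^2^2" where
  "phi = vector [vector [1, 0], vector [0, - 1]]"

definition dihedral :: "nat \<Rightarrow> (complex^2^2) set" where
  "dihedral n = generate GL2 {rho n, phi}"

text \<open>The algebra automorphisms induced by \<open>v\<^sub>s \<mapsto> \<Sum>\<^sub>r g\<^sub>r\<^sub>s v\<^sub>r\<close>, on the bosonic polynomials and on all
  of \<open>S\<close>.\<close>

definition bact :: "complex^2^2 \<Rightarrow> bpoly \<Rightarrow> bpoly" where
  "bact g p = (\<Sum>m \<in> Poly_Mapping.keys p. bconst (Poly_Mapping.lookup p m) *
     (\<Prod>v \<in> Poly_Mapping.keys m.
       (\<Sum>r \<in> UNIV. bconst (g $ r $ comp v) * bvar (Idx (copy v) r)) ^ Poly_Mapping.lookup m v))"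

definition act :: "complex^2^2 \<Rightarrow> superpoly \<Rightarrow> superpoly" where
  "act g f = (\<Sum>A \<in> Poly_Mapping.keys (coeffs f). gconst (bact g (gcoeff f A)) *
     prod_list (map (\<lambda>v. \<Sum>r \<in> UNIV. sconst (g $ r $ comp v) * fer (copy v) r)
       (sorted_list_of_fset A)))"


section \<open>The coinvariant ring\<close>

definition coinv_ideal :: "nat \<Rightarrow> nat \<Rightarrow> nat \<Rightarrow> superpoly set" where
  "coinv_ideal n k j = Idl\<^bsub>super_ring k j\<^esub>
     {f \<in> carrier (super_ring k j). (\<forall>g \<in> dihedral n. act g f = f) \<and> const_term f = 0}"

definition coinv_ring :: "nat \<Rightarrow> nat \<Rightarrow> nat \<Rightarrow> superpoly set ring" where
  "coinv_ring n k j = super_ring k j Quot coinv_ideal n k j"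

definition coinv_class :: "nat \<Rightarrow> nat \<Rightarrow> nat \<Rightarrow> superpoly \<Rightarrow> superpoly set" where
  "coinv_class n k j f = coinv_ideal n k j +>\<^bsub>super_ring k j\<^esub> f"

text \<open>Linear algebra over \<open>\<complex>\<close> in the quotient ring is linear algebra over the subfield of the
  classes of constants.\<close>

definition coinv_scalars :: "nat \<Rightarrow> nat \<Rightarrow> nat \<Rightarrow> superpoly set set" where
  "coinv_scalars n k j = range (\<lambda>c. coinv_class n k j (sconst c))"

text \<open>The library's independent families are finite lists.  Independence forces the classes in the
  list to be distinct, so the classes of the elements of \<open>B\<close> are pairwise different.\<close>

definition coinv_monomial_basis :: "nat \<Rightarrow> nat \<Rightarrow> nat \<Rightarrow> superpoly set \<Rightarrow> bool" where
  "coinv_monomial_basis n k j B \<longleftrightarrow> B \<subseteq> monomials k j \<and>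
     (\<exists>bs. set bs = B \<and>
        ring.independent (coinv_ring n k j) (coinv_scalars n k j) (map (coinv_class n k j) bs) \<and>
        ring.Span (coinv_ring n k j) (coinv_scalars n k j) (map (coinv_class n k j) bs)
          = carrier (coinv_ring n k j))"

text \<open>The products of the powers of the first components over the copies \<open>a, \<dots>, b\<close>, in this order;
  empty if \<open>b < a\<close>.\<close>

definition bos_prod :: "nat \<Rightarrow> nat \<Rightarrow> (nat \<Rightarrow> nat) \<Rightarrow> superpoly" where
  "bos_prod a b \<alpha> = prod_list (map (\<lambda>i. bos i 1 ^ \<alpha> i) [a..<Suc b])"

definition fer_prod :: "nat \<Rightarrow> nat \<Rightarrow> (nat \<Rightarrow> nat) \<Rightarrow> superpoly" where
  "fer_prod a b \<beta> = prod_list (map (\<lambda>i. fer i 1 ^ \<beta> i) [a..<Suc b])"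

definition dihedral_basis :: "nat \<Rightarrow> nat \<Rightarrow> nat \<Rightarrow> superpoly set" where
  "dihedral_basis n k j =
     {bos_prod 1 k \<alpha> * fer_prod 1 j \<beta> | \<alpha> \<beta>. range \<beta> \<subseteq> {0, 1} \<and>
        (\<Sum>l=1..k. \<alpha> l) + (\<Sum>l=1..j. \<beta> l) \<le> n - 1}
     \<union> (\<Union>i\<in>{1..k}. {bos_prod i k \<alpha> * fer_prod 1 j \<beta> * bos i 2 | \<alpha> \<beta>. range \<beta> \<subseteq> {0, 1} \<and>
        (\<Sum>l=i..k. \<alpha> l) + (\<Sum>l=1..j. \<beta> l) \<le> n - 1})
     \<union> (\<Union>i\<in>{1..j}. {fer_prod (i + 1) j \<beta> * fer i 2 | \<beta>. range \<beta> \<subseteq> {0, 1} \<and>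
        (\<Sum>l=i+1..j. \<beta> l) \<le> n - 1})
     \<union> {bos h 1 * bos i 2 | h i. 1 \<le> h \<and> h < i \<and> i \<le> k}
     \<union> {bos h 1 * fer i 2 | h i. 1 \<le> h \<and> h \<le> k \<and> 1 \<le> i \<and> i \<le> j}
     \<union> {fer h 1 * fer i 2 | h i. 1 \<le> h \<and> h \<le> i \<and> i \<le> j}"

end

theory Submission
  imports Defs
begin

text \<open>
  Let \<open>z\<^sub>1\<^sup>a, z\<^sub>2\<^sup>a\<close> be the variables of the copy \<open>a\<close>, bosonic or fermionic.  Each pair is replaced in thought by the eigenvectors
  \<open>u = z\<^sub>1 + \<i> z\<^sub>2\<close> and \<open>v = z\<^sub>1 - \<i> z\<^sub>2\<close> of the rotation, which the reflection exchanges.  The ideal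
  is generated by the quadratic invariants \<open>u\<^sub>a v\<^sub>b + v\<^sub>a u\<^sub>b\<close> for copies \<open>a\<close> and \<open>b\<close>, up to a factor
  \<open>z\<^sub>1\<^sup>a z\<^sub>1\<^sup>b + z\<^sub>2\<^sup>a z\<^sub>2\<^sup>b\<close>, and by \<open>u \<cdots> u + v \<cdots> v\<close> in degree \<open>n\<close>.  Modulo the quadratic ones a product
  of degree at least three that contains both \<open>u\<close> and \<open>v\<close> vanishes, because it would be symmetric and
  antisymmetric at once.  What survives is one copy of the monomials in \<open>u\<close> and one in \<open>v\<close> up to degree
  \<open>n - 1\<close>, a single copy in degree \<open>n\<close>, nothing beyond, and in degree two the products of a \<open>u\<close> and a
  \<open>v\<close> up to antisymmetry.

  In the given variables this reads as follows.  In degree at least three a second component may be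
  moved to any other factor (\<open>move_second\<close>), and two second components become two first ones up to sign
  (\<open>quadric_cong\<close>).  Hence every monomial reduces to a product of first components, times at most one
  second component, which can be put on the least variable.  Products of \<open>n\<close> first components vanish,
  which comes from the invariant of degree \<open>n\<close> (\<open>firsts_n_in_I\<close>).  So the listed monomials span
  (\<open>spanning\<close>).

  For independence, substituting \<open>z\<^sub>2 \<mapsto> - \<i> z\<^sub>1\<close> kills \<open>v\<close>, and substituting \<open>z\<^sub>2 \<mapsto> \<i> z\<^sub>1\<close> kills
  \<open>u\<close>.  Both substitutions send the ideal to elements without terms of degree below \<open>n\<close>, with equal
  images in degree \<open>n\<close>; moreover the ideal has no terms \<open>z\<^sub>1\<^sup>a z\<^sub>2\<^sup>b\<close> in degree two
  (\<open>invariant_functional_kernel\<close>, \<open>functional_kernel_mult\<close>).  Coefficients of these images and of these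
  terms give for each listed monomial a functional that vanishes on the ideal and on all the other
  listed monomials (\<open>dual_functional\<close>).
\<close>

text \<open>The dollar sign is to denote entries of matrices only.\<close>

no_notation fps_nth (infixl \<open>$\<close> 75)

section \<open>Coefficients of a superpolynomial\<close>

abbreviation xvar :: "idx \<Rightarrow> superpoly" where "xvar v \<equiv> gconst (bvar v)"
abbreviation tvar :: "idx \<Rightarrow> superpoly" where "tvar v \<equiv> ggen v"

definition scoeff :: "superpoly \<Rightarrow> (idx \<Rightarrow>\<^sub>0 nat) \<Rightarrow> idx fset \<Rightarrow> complex" where
  "scoeff f m A = Poly_Mapping.lookup (gcoeff f A) m"

lemma superpoly_eqI: "(\<And>m A. scoeff f m A = scoeff g m A) \<Longrightarrow> f = g"
  by (intro grassmann_eqI poly_mapping_eqI) (simp add: scoeff_def)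

lemma gcoeff_minus [simp]: "gcoeff (f - g) A = gcoeff f A - gcoeff g A"
  by transfer (simp add: lookup_minus)

lemma scoeff_simps [simp]:
  "scoeff 0 m A = 0" "scoeff (f + g) m A = scoeff f m A + scoeff g m A" "scoeff (- f) m A = - scoeff f m A"
  "scoeff (f - g) m A = scoeff f m A - scoeff g m A"
  by (simp_all add: scoeff_def lookup_add lookup_minus)

lemma scoeff_sum: "scoeff (sum h I) m A = (\<Sum>i\<in>I. scoeff (h i) m A)"
  by (induction I rule: infinite_finite_induct) auto

lemma gcoeff_gconst_mult:
  "gcoeff (gconst p * f) C = p * gcoeff (f :: ('v::linorder, 'a::comm_ring_1) grassmann) C"
proof -
  have "gcoeff (gconst p * f) C = (\<Sum>A | A |\<subseteq>| C. p * gcoeff f C when A = {||})"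
    unfolding gcoeff_mult by (rule sum.cong) (auto simp: gcoeff_gconst when_def)
  then show ?thesis
    by (simp add: when_def sum.If_cases Collect_conv_if)
qed

lemma gcoeff_ggen_mult:
  "gcoeff (ggen v * f) C = (if v |\<in>| C then reorder_sign {|v|} (C |-| {|v|}) * gcoeff f (C |-| {|v|}) else 0)"
  for f :: "('v::linorder, 'a::comm_ring_1) grassmann"
proof -
  have "gcoeff (ggen v * f) C = (\<Sum>A | A |\<subseteq>| C.
      reorder_sign {|v|} (C |-| {|v|}) * gcoeff f (C |-| {|v|}) when A = {|v|})"
    unfolding gcoeff_mult by (rule sum.cong) (auto simp: gcoeff_ggen when_def)
  then show ?thesis
    by (simp add: when_def sum.If_cases Collect_conv_if)
qed

lemma bpoly_add_induct:
  assumes "\<And>m c. P (Poly_Mapping.single m c)" "\<And>p q. P p \<Longrightarrow> P q \<Longrightarrow> P (p + q)"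
  shows "P (p :: 'a \<Rightarrow>\<^sub>0 'b::comm_monoid_add)"
proof -
  have "P (\<Sum>k\<in>K. Poly_Mapping.single k (Poly_Mapping.lookup p k))" if "finite K" for K
    using that by induction (use assms(1)[of undefined 0] assms in auto)
  moreover have "p = (\<Sum>k\<in>Poly_Mapping.keys p. Poly_Mapping.single k (Poly_Mapping.lookup p k))"
    by (rule poly_mapping_eqI)
      (auto simp: lookup_sum lookup_single when_def not_in_keys_iff_lookup_eq_zero)
  ultimately show ?thesis
    by (metis finite_keys)
qed

lemma lookup_bvar_mult:
  "Poly_Mapping.lookup (bvar v * p) m
     = (if Poly_Mapping.lookup m v = 0 then 0 else Poly_Mapping.lookup p (m - Poly_Mapping.single v 1))"
proof (induction p rule: bpoly_add_induct)
  case (1 m' c)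
  have "Poly_Mapping.single v 1 + m' = m \<longleftrightarrow> Poly_Mapping.lookup m v \<noteq> 0 \<and> m' = m - Poly_Mapping.single v 1"
    by (auto simp: poly_mapping_eq_iff fun_eq_iff lookup_add lookup_minus lookup_single when_def)
  then show ?case
    by (auto simp: bvar_def mult_single lookup_single when_def)
qed (auto simp: distrib_left lookup_add)

lemma lookup_bconst_mult: "Poly_Mapping.lookup (bconst c * p) m = c * Poly_Mapping.lookup p m"
  by (induction p rule: bpoly_add_induct)
    (auto simp: bconst_def mult_single lookup_single when_def distrib_left lookup_add)

lemma lookup_reorder_sign_mult:
  "Poly_Mapping.lookup (reorder_sign A B * p) m = reorder_sign A B * Poly_Mapping.lookup (p :: bpoly) m"
  by (cases "even (card {(a, b). a |\<in>| A \<and> b |\<in>| B \<and> b < a})") (simp_all add: reorder_sign_def)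

lemma reorder_sign_square: "reorder_sign A B * reorder_sign A B = (1 :: 'a::comm_ring_1)"
  by (cases "even (card {(a, b). a |\<in>| A \<and> b |\<in>| B \<and> b < a})") (simp_all add: reorder_sign_def)

lemma scoeff_xvar_mult: "scoeff (xvar v * f) m A =
    (if Poly_Mapping.lookup m v = 0 then 0 else scoeff f (m - Poly_Mapping.single v 1) A)"
  by (simp add: scoeff_def gcoeff_gconst_mult lookup_bvar_mult)

lemma scoeff_sconst_mult [simp]: "scoeff (sconst c * f) m A = c * scoeff f m A"
  by (simp add: scoeff_def sconst_def gcoeff_gconst_mult lookup_bconst_mult)

lemma scoeff_tvar_mult: "scoeff (tvar v * f) m A =
    (if v |\<in>| A then reorder_sign {|v|} (A |-| {|v|}) * scoeff f m (A |-| {|v|}) else 0)"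
  by (simp add: scoeff_def gcoeff_ggen_mult lookup_reorder_sign_mult)

lemma scoeff_sconst: "scoeff (sconst c) m A = (c when m = 0 \<and> A = {||})"
  by (auto simp: scoeff_def sconst_def gcoeff_gconst bconst_def lookup_single when_def)

lemma sconst_simps [simp]:
  "sconst 0 = 0" "sconst 1 = 1" "sconst (a + b) = sconst a + sconst b" "sconst (- a) = - sconst a"
  "sconst (a - b) = sconst a - sconst b"
proof -
  show "sconst 1 = 1"
    by (simp add: sconst_def bconst_def one_grassmann_def)
qed (rule superpoly_eqI; simp add: scoeff_sconst when_def)+

lemma sconst_mult: "sconst (a * b) = sconst a * sconst b"
  by (rule superpoly_eqI) (simp add: scoeff_sconst when_def)

lemma sconst_central: "sconst c * f = f * sconst c"
  by (simp add: sconst_def gconst_central)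

lemma gconst_mult: "gconst (p * q) = gconst p * (gconst q :: ('v::linorder, 'a::comm_ring_1) grassmann)"
  by (rule grassmann_eqI) (simp add: gcoeff_gconst_mult gcoeff_gconst when_def)

lemma gconst_add: "gconst (p + q) = gconst p + (gconst q :: ('v::linorder, 'a::comm_ring_1) grassmann)"
  by (rule grassmann_eqI) (simp add: gcoeff_gconst when_def)

definition mdeg :: "(idx \<Rightarrow>\<^sub>0 nat) \<Rightarrow> nat" where
  "mdeg m = (\<Sum>v\<in>Poly_Mapping.keys m. Poly_Mapping.lookup m v)"

lemma mdeg_add: "mdeg (m + m') = mdeg m + mdeg m'"
  unfolding mdeg_def by (rule setsum_keys_plus_distrib) auto

lemma mdeg_single [simp]: "mdeg (Poly_Mapping.single v c) = c" "mdeg 0 = 0"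
  by (simp_all add: mdeg_def)

lemma single_plus_diff:
  "Poly_Mapping.lookup m v \<noteq> 0 \<Longrightarrow> Poly_Mapping.single v 1 + (m - Poly_Mapping.single v 1) = (m :: 'a \<Rightarrow>\<^sub>0 nat)"
  by (auto simp: poly_mapping_eq_iff fun_eq_iff lookup_add lookup_minus lookup_single when_def)

definition support_in :: "idx set \<Rightarrow> idx set \<Rightarrow> superpoly \<Rightarrow> bool" where
  "support_in V W f \<longleftrightarrow> (\<forall>m A. scoeff f m A \<noteq> 0 \<longrightarrow> Poly_Mapping.keys m \<subseteq> V \<and> fset A \<subseteq> W)"

definition smono :: "(idx \<Rightarrow>\<^sub>0 nat) \<Rightarrow> idx fset \<Rightarrow> complex \<Rightarrow> superpoly" where
  "smono m A c = Grassmann (Poly_Mapping.single A (Poly_Mapping.single m c))"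

lemma gcoeff_smono: "gcoeff (smono m A c) B = (Poly_Mapping.single m c when A = B)"
  by (simp add: smono_def Grassmann_inverse lookup_single)

lemma scoeff_smono: "scoeff (smono m A c) m' A' = (c when m = m' \<and> A = A')"
  by (auto simp: scoeff_def gcoeff_smono lookup_single when_def)

lemma superpoly_expand:
  "f = (\<Sum>A\<in>Poly_Mapping.keys (coeffs f). \<Sum>m\<in>Poly_Mapping.keys (gcoeff f A). smono m A (scoeff f m A))"
proof (rule superpoly_eqI)
  fix m A
  have "scoeff (\<Sum>A\<in>Poly_Mapping.keys (coeffs f). \<Sum>m\<in>Poly_Mapping.keys (gcoeff f A). smono m A (scoeff f m A)) m A
    = (\<Sum>B\<in>Poly_Mapping.keys (coeffs f). (\<Sum>m'\<in>Poly_Mapping.keys (gcoeff f B). scoeff f m' B when m' = m) when B = A)"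
    unfolding scoeff_sum scoeff_smono by (intro sum.cong) (auto simp: when_def intro!: sum.neutral)
  also have "\<dots> = scoeff f m A"
    by (auto simp: when_def scoeff_def not_in_keys_iff_lookup_eq_zero)
  finally show "scoeff f m A = scoeff (\<Sum>A\<in>Poly_Mapping.keys (coeffs f). \<Sum>m\<in>Poly_Mapping.keys (gcoeff f A). smono m A (scoeff f m A)) m A"
    by simp
qed

text \<open>Every monomial arises from a constant by left multiplication with its variables, the signs being
  absorbed by the constant.  Hence additive statements about products need to be checked for one
  variable at a time.\<close>

lemma superpoly_support_induct:
  assumes supp: "support_in V W f"
    and const: "\<And>c. P (sconst c)"
    and xvar: "\<And>v f. v \<in> V \<Longrightarrow> P f \<Longrightarrow> P (xvar v * f)"
    and tvar: "\<And>v f. v \<in> W \<Longrightarrow> P f \<Longrightarrow> P (tvar v * f)"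
    and add: "\<And>f g. P f \<Longrightarrow> P g \<Longrightarrow> P (f + g)"
  shows "P f"
proof -
  have bos: "P (smono m {||} c)" if "Poly_Mapping.keys m \<subseteq> V" for m c
    using that
  proof (induction "mdeg m" arbitrary: m)
    case 0
    then have "m = 0"
      by (intro poly_mapping_eqI) (auto simp: mdeg_def in_keys_iff)
    moreover have "smono 0 {||} c = sconst c"
      by (rule superpoly_eqI) (auto simp: scoeff_smono scoeff_sconst when_def)
    ultimately show ?case
      using const by simp
  next
    case (Suc d)
    then have "m \<noteq> 0"
      by auto
    then obtain v where v: "v \<in> Poly_Mapping.keys m"
      by fastforce
    define m' where "m' = m - Poly_Mapping.single v 1"
    have m: "m = Poly_Mapping.single v 1 + m'"
      using v single_plus_diff[of m v] by (simp add: m'_def in_keys_iff)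
    then have "Poly_Mapping.keys m' \<subseteq> Poly_Mapping.keys m"
      by (auto simp: in_keys_iff lookup_add)
    with Suc m v have "P (xvar v * smono m' {||} c)"
      by (intro xvar Suc(1)) (auto simp: mdeg_add)
    moreover have "smono m {||} c = xvar v * smono m' {||} c"
    proof (rule superpoly_eqI)
      fix m'' A
      have "m = m'' \<longleftrightarrow> Poly_Mapping.lookup m'' v \<noteq> 0 \<and> m' = m'' - Poly_Mapping.single v 1"
        using single_plus_diff[of m'' v] by (auto simp: m lookup_add)
      then show "scoeff (smono m {||} c) m'' A = scoeff (xvar v * smono m' {||} c) m'' A"
        by (auto simp: scoeff_smono scoeff_xvar_mult when_def)
    qed
    ultimately show ?case
      by simp
  qed
  have mono: "P (smono m A c)" if "Poly_Mapping.keys m \<subseteq> V" "fset A \<subseteq> W" for m A c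
    using that(2)
  proof (induction A arbitrary: c)
    case empty
    then show ?case
      using bos that by simp
  next
    case (insert v A)
    have "smono m (finsert v A) c = tvar v * smono m A (reorder_sign {|v|} A * c)"
    proof (rule superpoly_eqI)
      fix m' B
      show "scoeff (smono m (finsert v A) c) m' B = scoeff (tvar v * smono m A (reorder_sign {|v|} A * c)) m' B"
      proof (cases "finsert v A = B")
        case True
        then have "v |\<in>| B" "B |-| {|v|} = A"
          using insert.hyps by auto
        then show ?thesis
          by (simp add: True scoeff_smono scoeff_tvar_mult when_def mult.assoc[symmetric] reorder_sign_square)
      next
        case False
        then have "v |\<in>| B \<Longrightarrow> A \<noteq> B |-| {|v|}"
          by auto
        with False show ?thesis
          by (simp add: scoeff_smono scoeff_tvar_mult when_def)
      qed
    qed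
    then show ?case
      using insert by (auto intro: tvar)
  qed
  have sum: "P (sum h I)" if "finite I" "\<And>i. i \<in> I \<Longrightarrow> P (h i)" for h and I :: "'i set"
    using that by (induction I) (use add const[of 0] in auto)
  show ?thesis
    by (subst superpoly_expand)
      (use supp in \<open>auto intro!: sum mono simp: support_in_def scoeff_def in_keys_iff subset_iff\<close>)
qed

lemma superpoly_induct [case_names const xvar tvar add]:
  assumes "\<And>c. P (sconst c)" "\<And>v f. P f \<Longrightarrow> P (xvar v * f)" "\<And>v f. P f \<Longrightarrow> P (tvar v * f)"
    "\<And>f g. P f \<Longrightarrow> P g \<Longrightarrow> P (f + g)"
  shows "P f"
  by (rule superpoly_support_induct[where V = UNIV and W = UNIV]) (use assms in \<open>auto simp: support_in_def\<close>)

section \<open>Linear substitutions\<close>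

text \<open>Moving the new factor past each smaller one costs a sign, and if it occurs already it meets itself
  and the product vanishes.  Since this is the rule by which the generators of a Grassmann algebra
  multiply, it makes every linear substitution of the fermionic variables multiplicative.\<close>

lemma anticommuting_prod_insort:
  fixes L :: "'v::linorder \<Rightarrow> 'r::ring_1"
  assumes anti: "\<And>v w. L v * L w = - (L w * L v)" and sq: "\<And>v. L v * L v = 0"
    and "sorted xs" "distinct xs"
  shows "L v * prod_list (map L xs)
    = (if v \<in> set xs then 0 else (-1) ^ length (filter (\<lambda>w. w < v) xs) * prod_list (map L (insort v xs)))"
  using assms(3,4)
proof (induction xs)
  case (Cons x xs)
  consider "v < x" | "v = x" | "x < v" by force
  then show ?case
  proof cases
    case 1
    then have "filter (\<lambda>w. w < v) xs = []" "v \<notin> set xs"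
      using Cons.prems by (auto simp: filter_empty_conv)
    with 1 show ?thesis by auto
  next
    case 2
    then show ?thesis
      by (simp add: sq mult.assoc[symmetric])
  next
    case 3
    have "L v * prod_list (map L (x # xs)) = - L x * (L v * prod_list (map L xs))"
      by (metis anti list.simps(9) minus_mult_left mult.assoc prod_list.Cons)
    also have "\<dots> = (if v \<in> set xs then 0 else - ((-1) ^ length (filter (\<lambda>w. w < v) xs) *
        (L x * prod_list (map L (insort v xs)))))"
      using Cons by (simp add: mult.assoc[symmetric]
          power_commuting_commutes[of "-1 :: 'r" "L x", simplified])
    finally show ?thesis
      using 3 by (auto simp: not_le[symmetric])
  qed
qed simp

definition bos_image :: "complex^2^2 \<Rightarrow> idx \<Rightarrow> bpoly" where
  "bos_image g v = (\<Sum>r\<in>UNIV. bconst (g $ r $ comp v) * bvar (Idx (copy v) r))"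

definition fer_image :: "complex^2^2 \<Rightarrow> idx \<Rightarrow> superpoly" where
  "fer_image g v = (\<Sum>r\<in>UNIV. sconst (g $ r $ comp v) * fer (copy v) r)"

definition fer_image_prod :: "complex^2^2 \<Rightarrow> idx fset \<Rightarrow> superpoly" where
  "fer_image_prod g A = prod_list (map (fer_image g) (sorted_list_of_fset A))"

lemma bconst_simps [simp]: "bconst 0 = 0" "bconst (c + d) = bconst c + bconst d"
    "bconst (c * d) = bconst c * bconst d"
  by (simp_all add: bconst_def single_add mult_single)

lemma bact_alt: "bact g p = (\<Sum>m\<in>Poly_Mapping.keys p. bconst (Poly_Mapping.lookup p m) *
    (\<Prod>v\<in>Poly_Mapping.keys m. bos_image g v ^ Poly_Mapping.lookup m v))"
  by (simp add: bact_def bos_image_def)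

lemma bact_add: "bact g (p + q) = bact g p + bact g q"
  unfolding bact_alt by (rule setsum_keys_plus_distrib) (simp_all add: distrib_right)

lemma bact_single: "bact g (Poly_Mapping.single m c) =
    bconst c * (\<Prod>v\<in>Poly_Mapping.keys m. bos_image g v ^ Poly_Mapping.lookup m v)"
  by (simp add: bact_alt)

lemma prod_keys_single_plus:
  fixes L :: "'v \<Rightarrow> 'a::comm_monoid_mult"
  shows "(\<Prod>u\<in>Poly_Mapping.keys (Poly_Mapping.single v 1 + m). L u ^ Poly_Mapping.lookup (Poly_Mapping.single v 1 + m) u)
    = L v * (\<Prod>u\<in>Poly_Mapping.keys m. L u ^ Poly_Mapping.lookup m u)"
proof -
  let ?E = "\<lambda>m U. \<Prod>u\<in>U. L u ^ Poly_Mapping.lookup m u"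
  let ?U = "insert v (Poly_Mapping.keys m)" and ?m = "Poly_Mapping.single v 1 + m"
  have "?E ?m (Poly_Mapping.keys ?m) = ?E ?m ?U"
    by (rule prod.mono_neutral_left) (auto simp: in_keys_iff lookup_add lookup_single when_def split: if_splits)
  also have "\<dots> = ?E (Poly_Mapping.single v 1) ?U * ?E m ?U"
    by (simp only: lookup_add power_add prod.distrib)
  also have "?E m ?U = ?E m (Poly_Mapping.keys m)"
    by (rule prod.mono_neutral_right) (auto simp: in_keys_iff)
  also have "?E (Poly_Mapping.single v 1) ?U = ?E (Poly_Mapping.single v 1) {v}"
    by (rule prod.mono_neutral_right) (auto simp: lookup_single when_def)
  finally show ?thesis
    by simp
qed

lemma bact_bvar_mult: "bact g (bvar v * p) = bos_image g v * bact g p"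
proof (induction p rule: bpoly_add_induct)
  case (1 m c)
  show ?case
    by (simp only: bvar_def mult_single bact_single mult_1_left prod_keys_single_plus mult.left_commute)
qed (simp add: bact_add distrib_left)

lemma bact_bconst_mult: "bact g (bconst c * p) = bconst c * bact g p"
proof (induction p rule: bpoly_add_induct)
  case (1 m d)
  have "bconst c * Poly_Mapping.single m d = Poly_Mapping.single m (c * d)"
    by (simp add: bconst_def mult_single)
  then show ?case
    by (simp add: bact_single mult_ac)
qed (simp add: bact_add distrib_left)

lemma bact_bconst: "bact g (bconst c) = bconst c"
  by (simp add: bconst_def bact_single) 

lemma gmono_add_induct:
  assumes "\<And>A p. P (Grassmann (Poly_Mapping.single A p))" "\<And>f g. P f \<Longrightarrow> P g \<Longrightarrow> P (f + g)"
  shows "P (f :: ('v, 'a::ab_group_add) grassmann)"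
proof -
  have "P (Grassmann p)" for p
  proof (induction p rule: bpoly_add_induct)
    case (2 p q)
    then show ?case
      using assms(2)[of "Grassmann p" "Grassmann q"] by (simp add: plus_grassmann.abs_eq)
  qed (rule assms(1))
  then show ?thesis
    by (metis coeffs_inverse)
qed

lemma gcoeff_gmono: "gcoeff (Grassmann (Poly_Mapping.single A p)) B = (p when A = B)"
  by (simp add: Grassmann_inverse lookup_single)

lemma gconst_mult_gmono:
  "gconst q * Grassmann (Poly_Mapping.single A p)
    = (Grassmann (Poly_Mapping.single A (q * p)) :: ('v::linorder, 'a::comm_ring_1) grassmann)"
  by (rule grassmann_eqI) (simp add: gcoeff_gconst_mult gcoeff_gmono when_def)

lemma ggen_mult_gmono:
  "ggen v * Grassmann (Poly_Mapping.single A p)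
    = (if v |\<in>| A then 0 else Grassmann (Poly_Mapping.single (finsert v A) (reorder_sign {|v|} A * p))
        :: ('v::linorder, 'a::comm_ring_1) grassmann)"
proof (rule grassmann_eqI)
  fix C
  have "v |\<in>| C \<and> A = C |-| {|v|} \<longleftrightarrow> v |\<notin>| A \<and> C = finsert v A"
    by auto
  then show "gcoeff (ggen v * Grassmann (Poly_Mapping.single A p)) C = gcoeff (if v |\<in>| A then 0
      else Grassmann (Poly_Mapping.single (finsert v A) (reorder_sign {|v|} A * p))) C"
    by (auto simp: gcoeff_ggen_mult gcoeff_gmono when_def)
qed

lemma reorder_sign_single:
  "reorder_sign {|v|} A = (- 1) ^ length (filter (\<lambda>w. w < v) (sorted_list_of_fset A))"
proof -
  have "{(a, b). a |\<in>| {|v|} \<and> b |\<in>| A \<and> b < a} = Pair v ` set (filter (\<lambda>w. w < v) (sorted_list_of_fset A))"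
    by auto
  moreover have "distinct (filter (\<lambda>w. w < v) (sorted_list_of_fset A))"
    by (simp add: sorted_list_of_fset.rep_eq)
  moreover have inj_on_pair: "inj_on (Pair v) U" for U
    by (simp add: inj_on_def)
  ultimately show ?thesis
    unfolding reorder_sign_def by (simp only: card_image[OF inj_on_pair] distinct_card)
qed

lemma act_alt: "act g f = (\<Sum>A\<in>Poly_Mapping.keys (coeffs f). gconst (bact g (gcoeff f A)) * fer_image_prod g A)"
  by (simp add: act_def fer_image_def[abs_def] fer_image_prod_def)

lemma gconst_0 [simp]: "gconst 0 = 0"
  by (rule grassmann_eqI) (simp add: gcoeff_gconst)

lemma bact_0 [simp]: "bact g 0 = 0"
  by (simp add: bact_def)

lemma act_add: "act g (f + h) = act g f + act g h"
  unfolding act_alt plus_grassmann.rep_eq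
  by (rule setsum_keys_plus_distrib) (simp_all add: bact_add gconst_add distrib_right)

lemma act_0 [simp]: "act g 0 = 0"
  by (simp add: act_def zero_grassmann.rep_eq)

lemma act_gmono: "act g (Grassmann (Poly_Mapping.single A p)) = gconst (bact g p) * fer_image_prod g A"
  by (simp add: act_alt Grassmann_inverse)

lemma act_xvar_mult: "act g (xvar v * f) = gconst (bos_image g v) * act g f"
  by (induction f rule: gmono_add_induct)
    (simp_all add: distrib_left act_add gconst_mult_gmono act_gmono bact_bvar_mult gconst_mult mult.assoc)

lemma act_sconst_mult: "act g (sconst c * f) = sconst c * act g f"
  by (induction f rule: gmono_add_induct)
    (simp_all add: distrib_left act_add sconst_def gconst_mult_gmono act_gmono bact_bconst_mult gconst_mult mult.assoc)

lemma sconst_mult_mult: "sconst a * x * (sconst b * y) = sconst (a * b) * (x * y)"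
proof -
  have "sconst a * x * (sconst b * y) = sconst a * (x * sconst b) * y"
    by (simp only: mult.assoc)
  also have "\<dots> = sconst (a * b) * (x * y)"
    by (simp only: sconst_central[of b x, symmetric] sconst_mult mult.assoc)
  finally show ?thesis .
qed

lemma fer_image_anticommute: "fer_image g v * fer_image g w = - (fer_image g w * fer_image g v)"
proof -
  have "fer_image g v * fer_image g w = (\<Sum>r\<in>UNIV. \<Sum>s\<in>UNIV. sconst (g $ r $ comp v * g $ s $ comp w) *
      (fer (copy v) r * fer (copy w) s))"
    by (simp only: fer_image_def sum_product sconst_mult_mult)
  also have "\<dots> = - (\<Sum>r\<in>UNIV. \<Sum>s\<in>UNIV. sconst (g $ s $ comp w * g $ r $ comp v) *
      (fer (copy w) s * fer (copy v) r))"
    unfolding sum_negf[symmetric]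
    by (intro sum.cong refl)
      (simp only: fer_def ggen_anticommute[of "Idx (copy v) _"] mult.commute[of "g $ _ $ comp w"] mult_minus_right)
  also have "\<dots> = - (fer_image g w * fer_image g v)"
    by (subst sum.swap) (simp only: fer_image_def sum_product sconst_mult_mult)
  finally show ?thesis .
qed

lemma fer_image_square: "fer_image g v * fer_image g v = 0"
proof -
  have "fer_image g v * fer_image g v = (\<Sum>r\<in>UNIV. \<Sum>s\<in>UNIV. sconst (g $ r $ comp v * g $ s $ comp v) *
      (fer (copy v) r * fer (copy v) s))"
    by (simp only: fer_image_def sum_product sconst_mult_mult)
  also have "\<dots> = 0"
    using ggen_anticommute[of "Idx (copy v) 1" "Idx (copy v) 2", where ?'a = bpoly]
    by (simp add: sum_2 fer_def ggen_square_zero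
        mult.commute[of "g $ 2 $ comp v" "g $ 1 $ comp v"])
  finally show ?thesis .
qed

lemma fer_image_mult_fer_image_prod:
  "fer_image g v * fer_image_prod g A = (if v |\<in>| A then 0 else gconst (reorder_sign {|v|} A) * fer_image_prod g (finsert v A))"
proof -
  have *: "gconst ((- 1) ^ N) = ((- 1) ^ N :: superpoly)" for N
  proof (induction N)
    case (Suc N)
    have "gconst (- 1) = (- 1 :: superpoly)"
      by (rule grassmann_eqI) (simp add: one_grassmann_def gcoeff_gconst when_def)
    with Suc show ?case
      by (simp only: power_Suc gconst_mult)
  qed (simp add: one_grassmann_def)
  have "sorted_list_of_fset (finsert v A) = insort v (sorted_list_of_fset A)" if "v |\<notin>| A"
    using that by (simp add: sorted_list_of_fset.rep_eq)
  moreover have "sorted (sorted_list_of_fset A)" "distinct (sorted_list_of_fset A)"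
    by (simp_all add: sorted_list_of_fset.rep_eq)
  note anticommuting_prod_insort[of "fer_image g", OF fer_image_anticommute fer_image_square this]
  ultimately show ?thesis
    by (simp add: fer_image_prod_def reorder_sign_single *)
qed

lemma act_tvar_mult: "act g (tvar v * f) = fer_image g v * act g f"
proof (induction f rule: gmono_add_induct)
  case (1 A p)
  have e: "reorder_sign {|v|} A = bconst (reorder_sign {|v|} A)"
    by (rule poly_mapping_eqI) (use lookup_reorder_sign_mult[of "{|v|}" A 1] in
      \<open>simp add: bconst_def lookup_single lookup_one when_def\<close>)
  have "fer_image g v * act g (Grassmann (Poly_Mapping.single A p)) = gconst (bact g p) * (fer_image g v * fer_image_prod g A)"
    by (simp only: act_gmono mult.assoc[symmetric] gconst_central[of _ "fer_image g v"])
  also have "\<dots> = (if v |\<in>| A then 0 else gconst (bact g p * bconst (reorder_sign {|v|} A)) * fer_image_prod g (finsert v A))"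
    by (simp add: fer_image_mult_fer_image_prod e[symmetric] gconst_mult mult.assoc)
  also have "\<dots> = act g (tvar v * Grassmann (Poly_Mapping.single A p))"
    by (simp add: ggen_mult_gmono act_gmono mult.commute[of "bact g p"]) (subst e, simp add: bact_bconst_mult)
  finally show ?case ..
qed (simp add: distrib_left act_add)

lemma act_sconst [simp]: "act g (sconst c) = sconst c"
  by (subst sconst_def, subst gconst_def)
    (simp add: act_gmono bact_bconst fer_image_prod_def sorted_list_of_fset.rep_eq sconst_def)

text \<open>Substitution respects left multiplication by a variable, and these variables generate everything.\<close>

lemma act_mult: "act g (f * h) = act g f * act g h"
proof (induction f rule: superpoly_induct)
qed (simp_all add: act_sconst_mult act_xvar_mult act_tvar_mult act_add mult.assoc distrib_right)

lemma act_1 [simp]: "act g 1 = 1"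
  using act_sconst[of g 1] by simp

lemma act_bos: "act g (bos a s) = sconst (g $ 1 $ s) * bos a 1 + sconst (g $ 2 $ s) * bos a 2"
  using act_xvar_mult[of g "Idx a s" 1]
  by (simp add: bos_def bos_image_def sum_2 gconst_add gconst_mult sconst_def)

lemma act_fer: "act g (fer a s) = sconst (g $ 1 $ s) * fer a 1 + sconst (g $ 2 $ s) * fer a 2"
  using act_tvar_mult[of g "Idx a s" 1] by (simp add: fer_def fer_image_def sum_2)

lemma xvar_eq_bos: "xvar v = bos (copy v) (comp v)"
  by (simp add: bos_def)

lemma tvar_eq_fer: "tvar v = fer (copy v) (comp v)"
  by (simp add: fer_def)

text \<open>Both sides are multiplicative and additive, so the variables decide.  The matrices may be singular:
  the substitutions that kill an eigenvector of the rotation are composed with group elements below.\<close>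

lemma act_act: "act g (act h f) = act (g ** h) f"
proof -
  have mm: "(g ** h) $ r $ s = h $ 1 $ s * g $ r $ 1 + h $ 2 $ s * g $ r $ 2" for r s
    by (simp add: matrix_matrix_mult_def sum_2 mult.commute)
  have lin: "sconst a * (sconst b * x + sconst c * y) + sconst a' * (sconst b' * x + sconst c' * y)
      = sconst (a * b + a' * b') * x + sconst (a * c + a' * c') * y" for a b c a' b' c' x y
    by (simp add: distrib_left distrib_right sconst_mult mult.assoc)
  show ?thesis
    by (induction f rule: superpoly_induct)
      (simp_all only: act_sconst act_add act_mult xvar_eq_bos tvar_eq_fer act_bos act_fer mm lin)
qed

lemma scoeff_tvar_mult_single: "scoeff (tvar v * f) m {|w|} = (scoeff f m {||} when v = w)"
  by (auto simp: scoeff_tvar_mult when_def)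

lemma scoeff_mult_const: "scoeff (f * h) 0 {||} = scoeff f 0 {||} * scoeff h 0 {||}"
  by (induction f rule: superpoly_induct)
    (simp_all add: mult.assoc distrib_right scoeff_xvar_mult scoeff_tvar_mult scoeff_sconst)

lemma scoeff_var_const: "scoeff (bos a s) 0 {||} = 0" "scoeff (fer a s) 0 {||} = 0"
  using scoeff_xvar_mult[of "Idx a s" 1 0 "{||}"] scoeff_tvar_mult[of "Idx a s" 1 0 "{||}"]
  by (simp_all add: bos_def fer_def)

lemma act_const: "scoeff (act g f) 0 {||} = scoeff f 0 {||}"
  by (induction f rule: superpoly_induct)
    (simp_all add: act_add act_mult scoeff_mult_const, simp_all add: xvar_eq_bos tvar_eq_fer act_bos act_fer scoeff_var_const)

text \<open>A term of degree one is a constant times a variable, and constant terms do not change under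
  substitution; so the coefficients of degree one transform by the matrix itself.\<close>

lemma act_linear:
  "scoeff (act g f) (Poly_Mapping.single (Idx a r) 1) {||} =
     g $ r $ 1 * scoeff f (Poly_Mapping.single (Idx a 1) 1) {||} + g $ r $ 2 * scoeff f (Poly_Mapping.single (Idx a 2) 1) {||}"
  "scoeff (act g f) 0 {|Idx a r|} = g $ r $ 1 * scoeff f 0 {|Idx a 1|} + g $ r $ 2 * scoeff f 0 {|Idx a 2|}"
proof -
  have two: "r = 1 \<or> r = 2" for r :: 2
    by (rule exhaust_2)
  have "scoeff (act g f) (Poly_Mapping.single (Idx a r) 1) {||} =
     g $ r $ 1 * scoeff f (Poly_Mapping.single (Idx a 1) 1) {||} + g $ r $ 2 * scoeff f (Poly_Mapping.single (Idx a 2) 1) {||}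
   \<and> scoeff (act g f) 0 {|Idx a r|} = g $ r $ 1 * scoeff f 0 {|Idx a 1|} + g $ r $ 2 * scoeff f 0 {|Idx a 2|}"
  proof (induction f rule: superpoly_induct)
    case (const c)
    then show ?case
      by (auto simp: scoeff_sconst when_def poly_mapping_eq_iff fun_eq_iff lookup_single)
  next
    case (xvar v f)
    obtain b s where v: "v = Idx b s"
      by (cases v)
    show ?case
      using two[of r] two[of s]
      by (auto simp: v act_mult act_bos[unfolded bos_def] distrib_right mult.assoc scoeff_xvar_mult
          lookup_single when_def act_const)
  next
    case (tvar v f)
    obtain b s where v: "v = Idx b s"
      by (cases v)
    show ?case
      using two[of r] two[of s]
      by (auto simp: v act_mult act_fer[unfolded fer_def] distrib_right mult.assoc scoeff_tvar_mult scoeff_tvar_mult_single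
          lookup_single when_def act_const)
  next
    case (add f g)
    then show ?case
      by (simp add: act_add algebra_simps)
  qed
  then show "scoeff (act g f) (Poly_Mapping.single (Idx a r) 1) {||} =
     g $ r $ 1 * scoeff f (Poly_Mapping.single (Idx a 1) 1) {||} + g $ r $ 2 * scoeff f (Poly_Mapping.single (Idx a 2) 1) {||}"
    "scoeff (act g f) 0 {|Idx a r|} = g $ r $ 1 * scoeff f 0 {|Idx a 1|} + g $ r $ 2 * scoeff f 0 {|Idx a 2|}"
    by blast+
qed

section \<open>Order of vanishing\<close>

definition deg :: "(idx \<Rightarrow>\<^sub>0 nat) \<Rightarrow> idx fset \<Rightarrow> nat" where
  "deg m A = mdeg m + fcard A"

definition vanishes_below :: "nat \<Rightarrow> superpoly \<Rightarrow> bool" where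
  "vanishes_below d f \<longleftrightarrow> (\<forall>m A. deg m A < d \<longrightarrow> scoeff f m A = 0)"

lemma act_scalar: "scoeff (act (mat c) f) m A = c ^ deg m A * scoeff f m A"
proof (induction f arbitrary: m A rule: superpoly_induct)
  case (const d)
  then show ?case
    by (simp add: scoeff_sconst when_def deg_def fcard.rep_eq)
next
  case (xvar v f)
  have "act (mat c) (xvar v) = sconst c * xvar v"
    using exhaust_2[of "comp v"] by (auto simp: xvar_eq_bos act_bos mat_def)
  moreover have "deg m A = Suc (deg (m - Poly_Mapping.single v 1) A)" if "Poly_Mapping.lookup m v \<noteq> 0"
    using mdeg_add[of "Poly_Mapping.single v 1" "m - Poly_Mapping.single v 1"] single_plus_diff[OF that]
    by (simp add: deg_def)
  ultimately show ?case
    by (simp add: act_mult mult.assoc scoeff_xvar_mult xvar)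
next
  case (tvar v f)
  have "act (mat c) (tvar v) = sconst c * tvar v"
    using exhaust_2[of "comp v"] by (auto simp: tvar_eq_fer act_fer mat_def)
  moreover have "deg m A = Suc (deg m (A |-| {|v|}))" if "v |\<in>| A"
    using fcard_Suc_fminus1[OF that] by (simp only: deg_def add_Suc_right)
  ultimately show ?case
    by (simp add: act_mult mult.assoc scoeff_tvar_mult tvar)
qed (simp add: act_add distrib_left)

lemma scoeff_mult_nonzero:
  assumes "scoeff (f * h) m A \<noteq> 0"
  obtains m1 m2 A1 A2 where "m = m1 + m2" "A = A1 |\<union>| A2" "A1 |\<inter>| A2 = {||}"
    "scoeff f m1 A1 \<noteq> 0" "scoeff h m2 A2 \<noteq> 0"
proof -
  have "(\<Sum>B | B |\<subseteq>| A. Poly_Mapping.lookup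
      (reorder_sign B (A |-| B) * gcoeff f B * gcoeff h (A |-| B)) m) \<noteq> 0"
    using assms by (simp add: scoeff_def gcoeff_mult lookup_sum)
  then obtain B where B: "B \<in> {B. B |\<subseteq>| A}" and
    "Poly_Mapping.lookup (reorder_sign B (A |-| B) * gcoeff f B * gcoeff h (A |-| B)) m \<noteq> 0"
    by (rule sum.not_neutral_contains_not_neutral)
  then have "m \<in> Poly_Mapping.keys (gcoeff f B * gcoeff h (A |-| B))"
    by (auto simp: mult.assoc lookup_reorder_sign_mult in_keys_iff)
  then obtain m1 m2 where "m = m1 + m2" "m1 \<in> Poly_Mapping.keys (gcoeff f B)"
    "m2 \<in> Poly_Mapping.keys (gcoeff h (A |-| B))"
    using keys_mult by blast
  with B show thesis
    by (intro that[of m1 m2 B "A |-| B"]) (auto simp: scoeff_def in_keys_iff)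
qed

lemma deg_add: "A1 |\<inter>| A2 = {||} \<Longrightarrow> deg (m1 + m2) (A1 |\<union>| A2) = deg m1 A1 + deg m2 A2"
  by (simp add: deg_def mdeg_add fcard_funion_disjoint)

lemma vanishes_below_mult:
  assumes "vanishes_below a f" "vanishes_below b h"
  shows "vanishes_below (a + b) (f * h)"
  unfolding vanishes_below_def
proof (intro allI impI, rule ccontr)
  fix m A
  assume "deg m A < a + b" "scoeff (f * h) m A \<noteq> 0"
  then obtain m1 m2 A1 A2 where "deg (m1 + m2) (A1 |\<union>| A2) < a + b" "A1 |\<inter>| A2 = {||}"
    "scoeff f m1 A1 \<noteq> 0" "scoeff h m2 A2 \<noteq> 0"
    by (metis scoeff_mult_nonzero)
  with assms show False
    by (auto simp: deg_add vanishes_below_def) (metis linorder_not_less add_mono)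
qed

lemma vanishes_below_0 [simp]: "vanishes_below 0 f"
  by (simp add: vanishes_below_def)

lemma vanishes_below_mult_any:
  assumes "vanishes_below a f"
  shows "vanishes_below a (s * f)" "vanishes_below a (f * s)"
  using vanishes_below_mult[of 0 s a f] vanishes_below_mult[of a f 0 s] assms by simp_all

lemma vanishes_below_mono: "vanishes_below a f \<Longrightarrow> b \<le> a \<Longrightarrow> vanishes_below b f"
  by (auto simp: vanishes_below_def)

lemma vanishes_below_add: "vanishes_below a f \<Longrightarrow> vanishes_below a h \<Longrightarrow> vanishes_below a (f + h)"
  by (auto simp: vanishes_below_def)

lemma deg_eq_0: "deg m A = 0 \<longleftrightarrow> m = 0 \<and> A = {||}"
  by (auto simp: deg_def mdeg_def poly_mapping_eq_iff fun_eq_iff in_keys_iff)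

lemma vanishes_below_1: "vanishes_below 1 f \<longleftrightarrow> scoeff f 0 {||} = 0"
  by (auto simp: vanishes_below_def deg_eq_0)

section \<open>An upper bound for the ideal of the invariants\<close>

text \<open>The substitution \<open>z\<^sub>1 \<mapsto> z\<^sub>1\<close>, \<open>z\<^sub>2 \<mapsto> w z\<^sub>1\<close>.  For \<open>w = - \<i>\<close> it kills \<open>z\<^sub>1 - \<i> z\<^sub>2\<close>, for \<open>w = \<i>\<close> it
  kills \<open>z\<^sub>1 + \<i> z\<^sub>2\<close>.\<close>

definition collapse :: "complex \<Rightarrow> complex^2^2" where
  "collapse w = (\<chi> r s. if r = 1 then (if s = 1 then 1 else w) else 0)"

text \<open>The conditions under which all functionals that detect the basis vanish.  The second one says that in degree
  two there is no term with exactly one second component, these being the terms that the reflection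
  negates.\<close>

definition functional_kernel :: "nat \<Rightarrow> superpoly set" where
  "functional_kernel n = {f. vanishes_below 2 f \<and> vanishes_below 3 (act phi f - f) \<and>
     vanishes_below n (act (collapse \<i>) f) \<and> vanishes_below n (act (collapse (- \<i>)) f) \<and>
     vanishes_below (Suc n) (act (collapse \<i>) f - act (collapse (- \<i>)) f)}"

lemma functional_kernel_0: "0 \<in> functional_kernel n"
  by (simp add: functional_kernel_def vanishes_below_def)

lemma functional_kernel_add: "f \<in> functional_kernel n \<Longrightarrow> h \<in> functional_kernel n \<Longrightarrow> f + h \<in> functional_kernel n"
  by (auto simp: functional_kernel_def act_add vanishes_below_def)

lemma vanishes_below_act_diff: "vanishes_below 1 (act g f - act h f)" "vanishes_below 1 (act g f - f)"
  by (simp_all only: vanishes_below_1 scoeff_simps act_const diff_self)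

text \<open>All substitutions preserve constant terms, so the images of a factor \<open>s\<close> under two of them agree in
  degree zero.  In the lowest relevant degree only the constant term of \<open>s\<close> contributes to a product, and
  each condition on \<open>f\<close> carries over.\<close>

lemma functional_kernel_mult:
  assumes "f \<in> functional_kernel n"
  shows "s * f \<in> functional_kernel n" "f * s \<in> functional_kernel n"
proof -
  let ?a = "act (collapse \<i>)" and ?b = "act (collapse (- \<i>))"
  have f: "vanishes_below 2 f" "vanishes_below 3 (act phi f - f)" "vanishes_below n (?a f)"
    "vanishes_below n (?b f)" "vanishes_below (Suc n) (?a f - ?b f)"
    using assms by (simp_all add: functional_kernel_def)
  have "vanishes_below 2 (act phi f - f)"
    using f(2) by (rule vanishes_below_mono) simp
  from vanishes_below_add[OF this f(1)] have phi: "vanishes_below 2 (act phi f)"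
    by simp
  have order1: "vanishes_below b (u * h)" "vanishes_below b (h * u)"
    if "vanishes_below 1 u" "vanishes_below a h" "b = Suc a" for a b u h
    using vanishes_below_mult[OF that(1,2)] vanishes_below_mult[OF that(2,1)] that(3) by simp_all
  note one = vanishes_below_act_diff
  have dl: "x * y - u * v = (x - u) * y + u * (y - v)" for x y u v :: superpoly
    by (simp add: algebra_simps)
  have dr: "x * y - u * v = x * (y - v) + (x - u) * v" for x y u v :: superpoly
    by (simp add: algebra_simps)
  have "vanishes_below 2 (s * f)" "vanishes_below n (?a s * ?a f)" "vanishes_below n (?b s * ?b f)"
    "vanishes_below 2 (f * s)" "vanishes_below n (?a f * ?a s)" "vanishes_below n (?b f * ?b s)"
    by (intro vanishes_below_mult_any f)+
  moreover have "vanishes_below (Suc n) (?a s * ?a f - ?b s * ?b f)"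
    unfolding dl by (intro vanishes_below_add order1(1)[OF one(1) f(3)] vanishes_below_mult_any f refl)
  moreover have "vanishes_below (Suc n) (?a f * ?a s - ?b f * ?b s)"
    unfolding dr by (intro vanishes_below_add order1(2)[OF one(1) f(3)] vanishes_below_mult_any f refl)
  moreover have "vanishes_below 3 (act phi s * act phi f - s * f)"
    unfolding dl by (intro vanishes_below_add order1(1)[OF one(2) phi] vanishes_below_mult_any f) simp
  moreover have "vanishes_below 3 (act phi f * act phi s - f * s)"
    unfolding dr by (intro vanishes_below_add order1(2)[OF one(2) phi] vanishes_below_mult_any f) simp
  ultimately show "s * f \<in> functional_kernel n" "f * s \<in> functional_kernel n"
    by (simp_all add: functional_kernel_def act_mult)
qed

lemma matrix_entries:
  "rho n $ 1 $ 1 = of_real (cos (2 * pi / real n))" "rho n $ 1 $ 2 = - of_real (sin (2 * pi / real n))"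
  "rho n $ 2 $ 1 = of_real (sin (2 * pi / real n))" "rho n $ 2 $ 2 = of_real (cos (2 * pi / real n))"
  "phi $ 1 $ 1 = 1" "phi $ 1 $ 2 = 0" "phi $ 2 $ 1 = 0" "phi $ 2 $ 2 = - 1"
  "collapse w $ 1 $ 1 = 1" "collapse w $ 1 $ 2 = w" "collapse w $ 2 $ 1 = 0" "collapse w $ 2 $ 2 = 0"
  by (simp_all add: rho_def phi_def collapse_def vector_2)

lemma matrix_2_eqI:
  "A $ 1 $ 1 = B $ 1 $ 1 \<Longrightarrow> A $ 1 $ 2 = B $ 1 $ 2 \<Longrightarrow> A $ 2 $ 1 = B $ 2 $ 1 \<Longrightarrow> A $ 2 $ 2 = B $ 2 $ 2
    \<Longrightarrow> A = (B :: 'a^2^2)"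
  by (simp add: vec_eq_iff forall_2)

lemma matrix_mult_2: "((A :: 'a::semiring_1^2^2) ** B) $ r $ s = A $ r $ 1 * B $ 1 $ s + A $ r $ 2 * B $ 2 $ s"
  by (simp add: matrix_matrix_mult_def sum_2)

lemma collapse_phi: "collapse w ** phi = collapse (- w)"
  by (rule matrix_2_eqI) (simp_all add: matrix_mult_2 matrix_entries)

text \<open>\<open>(1, w)\<close> is a left eigenvector of the rotation.\<close>

lemma collapse_rho:
  assumes "w * w = - 1"
  shows "collapse w ** rho n = mat (of_real (cos (2 * pi / real n)) + w * of_real (sin (2 * pi / real n))) ** collapse w"
proof -
  have ww: "w * (w * x) = - x" for x
    by (simp add: assms mult.assoc[symmetric])
  show ?thesis
    by (intro matrix_2_eqI) (simp_all add: matrix_mult_2 matrix_entries mat_def algebra_simps ww)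
qed

lemma cos_sin_power_neq_1:
  assumes w: "w = \<i> \<or> w = - \<i>" and d: "0 < d" "d < n"
  shows "(of_real (cos (2 * pi / real n)) + w * of_real (sin (2 * pi / real n))) ^ d \<noteq> 1"
proof
  let ?t = "2 * pi / real n"
  assume *: "(of_real (cos ?t) + w * of_real (sin ?t)) ^ d = 1"
  have "of_real (cos ?t) + w * of_real (sin ?t) = (if w = \<i> then cis ?t else cis (- ?t))"
    using w by (auto simp: complex_eq_iff)
  then have "(of_real (cos ?t) + w * of_real (sin ?t)) ^ d = (if w = \<i> then cis (d * ?t) else cis (d * (- ?t)))"
    by (cases "w = \<i>") (simp_all only: Complex.DeMoivre if_True if_False simp_thms)
  with * have "Re (if w = \<i> then cis (d * ?t) else cis (d * (- ?t))) = 1"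
    by simp
  then have "cos (d * ?t) = 1"
    by (auto split: if_splits)
  then obtain k :: int where "d * ?t = k * (2 * pi)"
    using cos_one_2pi_int by auto
  then have "real d = of_int k * real n"
    using d by (simp add: field_simps)
  then have "int d = k * int n"
    by (metis of_int_eq_iff of_int_mult of_int_of_nat_eq)
  then have "n dvd d"
    by (metis dvd_triv_right int_dvd_int_iff)
  then show False
    using d by (simp add: nat_dvd_not_less)
qed

text \<open>By \<open>collapse_rho\<close>, composing a collapse with the rotation multiplies the part of degree \<open>d\<close> by
  \<open>\<zeta>\<^sup>d\<close> for a primitive \<open>n\<close>-th root of unity \<open>\<zeta>\<close>, so an invariant has no part in degrees strictly
  between zero and \<open>n\<close>.  The reflection exchanges the two collapses, so their values on an invariant agree.
  In degree one an invariant would be a fixed vector of the group, of which there are none.\<close>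

lemma invariant_functional_kernel:
  assumes "n \<ge> 2" and rho: "act (rho n) f = f" and phi: "act phi f = f" and const: "const_term f = 0"
  shows "f \<in> functional_kernel n"
proof -
  have c0: "scoeff f 0 {||} = 0"
    using const by (simp add: const_term_def scoeff_def)
  have proj: "vanishes_below n (act (collapse w) f)" if w: "w = \<i> \<or> w = - \<i>" for w
    unfolding vanishes_below_def
  proof (intro allI impI)
    fix m A assume less: "deg m A < n"
    let ?z = "of_real (cos (2 * pi / real n)) + w * of_real (sin (2 * pi / real n))"
    have "w * w = - 1"
      using w by auto
    then have "act (collapse w) f = act (mat ?z) (act (collapse w) f)"
      by (metis rho act_act collapse_rho)
    then have "scoeff (act (collapse w) f) m A = ?z ^ deg m A * scoeff (act (collapse w) f) m A"
      by (metis act_scalar)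
    moreover have "?z ^ deg m A \<noteq> 1" if "deg m A \<noteq> 0"
      using that less w by (intro cos_sin_power_neq_1) auto
    ultimately show "scoeff (act (collapse w) f) m A = 0"
      by (cases "deg m A = 0") (auto simp: deg_eq_0 act_const c0)
  qed
  have "act (collapse \<i>) f = act (collapse (- \<i>)) f"
    by (metis act_act collapse_phi phi)
  moreover have "vanishes_below 2 f"
    unfolding vanishes_below_def
  proof (intro allI impI)
    fix m A assume "deg m A < 2"
    \<comment> \<open>The reflection kills the second coordinate of a fixed vector, the rotation the first.\<close>
    have fixed: "x = 0 \<and> y = 0" if "x = phi $ 1 $ 1 * x + phi $ 1 $ 2 * y" "y = phi $ 2 $ 1 * x + phi $ 2 $ 2 * y"
      "x = rho n $ 1 $ 1 * x + rho n $ 1 $ 2 * y" for x y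
    proof -
      have "y = 0" "x = of_real (cos (2 * pi / real n)) * x"
        using that by (simp_all add: matrix_entries)
      moreover have "cos (2 * pi / real n) \<noteq> 1"
      proof
        assume "cos (2 * pi / real n) = 1"
        moreover from this have "sin (2 * pi / real n) = 0"
          using sin_cos_squared_add[of "2 * pi / real n"] by simp
        ultimately show False
          using cos_sin_power_neq_1[of \<i> 1 n] assms(1) by simp
      qed
      ultimately show ?thesis
        by auto
    qed
    consider "m = 0" "A = {||}" | a s where "m = Poly_Mapping.single (Idx a s) 1" "A = {||}" | a s where "m = 0" "A = {|Idx a s|}"
    proof -
      assume *: thesis if "m = 0" "A = {||}"
      assume x: thesis if "m = Poly_Mapping.single (Idx a s) 1" "A = {||}" for a s
      assume t: thesis if "m = 0" "A = {|Idx a s|}" for a s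
      show thesis
      proof (cases "m = 0")
        case True
        with \<open>deg m A < 2\<close> have "fcard A = 0 \<or> fcard A = 1"
          by (simp only: deg_def) linarith
        then show thesis
        proof
          assume "fcard A = 0"
          then show thesis
            using True * by simp
        next
          assume "fcard A = 1"
          then obtain v where "fset A = fset {|v|}"
            by (auto simp: fcard.rep_eq card_1_singleton_iff)
          then have "A = {|v|}"
            by (simp only: fset_inject)
          then show thesis
            using True t[of "copy v" "comp v"] by simp
        qed
      next
        case False
        then obtain v where v: "v \<in> Poly_Mapping.keys m"
          by fastforce
        define m' where "m' = m - Poly_Mapping.single v 1"
        have m: "m = Poly_Mapping.single v 1 + m'"
          using v single_plus_diff[of m v] by (simp add: m'_def in_keys_iff)
        have "deg m' A = 0"
          using \<open>deg m A < 2\<close> by (simp add: deg_def m mdeg_add)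
        then show thesis
          using x[of "copy v" "comp v"] m by (simp add: deg_eq_0)
      qed
    qed
    then show "scoeff f m A = 0"
    proof cases
      case 1
      then show ?thesis
        using c0 by simp
    next
      case (2 a s)
      have "scoeff f (Poly_Mapping.single (Idx a 1) 1) {||} = 0 \<and> scoeff f (Poly_Mapping.single (Idx a 2) 1) {||} = 0"
        by (rule fixed) (simp_all only: act_linear(1)[symmetric] rho phi)
      then show ?thesis
        using exhaust_2[of s] 2 by auto
    next
      case (3 a s)
      have "scoeff f 0 {|Idx a 1|} = 0 \<and> scoeff f 0 {|Idx a 2|} = 0"
        by (rule fixed) (simp_all only: act_linear(2)[symmetric] rho phi)
      then show ?thesis
        using exhaust_2[of s] 3 by auto
    qed
  qed
  ultimately show ?thesis
    using proj by (simp add: functional_kernel_def phi vanishes_below_def)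
qed

section \<open>Products of variables\<close>

lemma mult_sconst_left: "f * (sconst c * h) = sconst c * (f * h)"
  by (simp only: mult.assoc[symmetric] sconst_central[of c f])

text \<open>One numbering for all copies: the labels \<open>1, \<dots>, k\<close> denote the bosonic and \<open>k + 1, \<dots>, k + j\<close> the
  fermionic ones.  With respect to this order the listed monomials have one uniform description.\<close>

definition svar :: "nat \<Rightarrow> nat \<Rightarrow> 2 \<Rightarrow> superpoly" where
  "svar k c s = (if c \<le> k then bos c s else fer (c - k) s)"

text \<open>A product of variables, given by the list of their labels and components, is up to sign the
  monomial with exponents \<open>bos_exps\<close> and fermionic part \<open>fer_support\<close>, or zero if a fermionic variable
  is repeated.\<close>

definition var_prod :: "nat \<Rightarrow> (nat \<times> 2) list \<Rightarrow> superpoly" where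
  "var_prod k ps = prod_list (map (\<lambda>(c, s). svar k c s) ps)"

definition bos_exps :: "nat \<Rightarrow> (nat \<times> 2) list \<Rightarrow> idx \<Rightarrow>\<^sub>0 nat" where
  "bos_exps k ps = (\<Sum>(c, s)\<leftarrow>ps. if c \<le> k then Poly_Mapping.single (Idx c s) 1 else 0)"

definition fer_support :: "nat \<Rightarrow> (nat \<times> 2) list \<Rightarrow> idx fset" where
  "fer_support k ps = fset_of_list (map (\<lambda>(c, s). Idx (c - k) s) (filter (\<lambda>(c, s). k < c) ps))"

definition distinct_fers :: "nat \<Rightarrow> (nat \<times> 2) list \<Rightarrow> bool" where
  "distinct_fers k ps \<longleftrightarrow> distinct (filter (\<lambda>(c, s). k < c) ps)"

lemma var_prod_simps [simp]: "var_prod k [] = 1" "var_prod k (p # ps) = svar k (fst p) (snd p) * var_prod k ps"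
  "var_prod k (ps @ qs) = var_prod k ps * var_prod k qs"
  by (simp_all add: var_prod_def case_prod_beta)

lemma scoeff_1: "scoeff 1 m A = (1 when m = 0 \<and> A = {||})"
  using scoeff_sconst[of 1 m A] by simp

lemma scoeff_var_prod_nonzero:
  assumes "scoeff (var_prod k ps) m A \<noteq> 0"
  shows "m = bos_exps k ps \<and> A = fer_support k ps"
  using assms
proof (induction ps arbitrary: m A)
  case Nil
  then show ?case
    by (auto simp: scoeff_1 bos_exps_def fer_support_def when_def split: if_splits)
next
  case (Cons p ps)
  obtain c s where p: "p = (c, s)"
    by force
  show ?case
  proof (cases "c \<le> k")
    case True
    with Cons.prems have nz: "Poly_Mapping.lookup m (Idx c s) \<noteq> 0"
      "scoeff (var_prod k ps) (m - Poly_Mapping.single (Idx c s) 1) A \<noteq> 0"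
      by (auto simp: p svar_def bos_def scoeff_xvar_mult split: if_splits)
    from Cons.IH[OF nz(2)] single_plus_diff[OF nz(1)] show ?thesis
      using True by (auto simp: p bos_exps_def fer_support_def)
  next
    case False
    with Cons.prems have nz: "Idx (c - k) s |\<in>| A" "scoeff (var_prod k ps) m (A |-| {|Idx (c - k) s|}) \<noteq> 0"
      by (auto simp: p svar_def fer_def scoeff_tvar_mult split: if_splits)
    from Cons.IH[OF nz(2)] nz(1) have "m = bos_exps k ps" "A = finsert (Idx (c - k) s) (fer_support k ps)"
      by auto
    then show ?thesis
      using False by (simp add: p bos_exps_def fer_support_def)
  qed
qed

lemma reorder_sign_nonzero: "(reorder_sign A B :: complex) \<noteq> 0"
  by (simp add: reorder_sign_def)

lemma Idx_in_fer_support: "k < c \<Longrightarrow> Idx (c - k) s |\<in>| fer_support k ps \<longleftrightarrow> (c, s) \<in> set ps"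
  by (induction ps) (auto simp: fer_support_def)

lemma scoeff_var_prod_self:
  assumes "distinct_fers k ps"
  shows "scoeff (var_prod k ps) (bos_exps k ps) (fer_support k ps) \<noteq> 0"
  using assms
proof (induction ps)
  case Nil
  then show ?case
    by (simp add: scoeff_1 bos_exps_def fer_support_def)
next
  case (Cons p ps)
  obtain c s where p: "p = (c, s)"
    by force
  have IH: "scoeff (var_prod k ps) (bos_exps k ps) (fer_support k ps) \<noteq> 0"
    using Cons by (auto simp: distinct_fers_def p split: if_splits)
  show ?case
  proof (cases "c \<le> k")
    case True
    have "bos_exps k (p # ps) = Poly_Mapping.single (Idx c s) 1 + bos_exps k ps" "fer_support k (p # ps) = fer_support k ps"
      using True by (simp_all add: p bos_exps_def fer_support_def)
    then show ?thesis
      using IH True by (simp add: p svar_def bos_def scoeff_xvar_mult lookup_add)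
  next
    case False
    have "(c, s) \<notin> set ps"
      using Cons.prems False by (simp add: distinct_fers_def p)
    then have "Idx (c - k) s |\<notin>| fer_support k ps"
      using False by (simp add: Idx_in_fer_support)
    moreover have "bos_exps k (p # ps) = bos_exps k ps" "fer_support k (p # ps) = finsert (Idx (c - k) s) (fer_support k ps)"
      using False by (simp_all add: p bos_exps_def fer_support_def)
    ultimately show ?thesis
      using IH False by (simp add: p svar_def fer_def scoeff_tvar_mult reorder_sign_nonzero)
  qed
qed

lemma deg_bos_exps_fer_support:
  assumes "distinct_fers k ps"
  shows "deg (bos_exps k ps) (fer_support k ps) = length ps"
  using assms
proof (induction ps)
  case Nil
  then show ?case
    by (simp add: deg_eq_0 bos_exps_def fer_support_def)
next
  case (Cons p ps)
  obtain c s where p: "p = (c, s)"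
    by force
  have IH: "deg (bos_exps k ps) (fer_support k ps) = length ps"
    using Cons by (auto simp: distinct_fers_def p split: if_splits)
  show ?case
  proof (cases "c \<le> k")
    case True
    then show ?thesis
      using IH by (simp add: p bos_exps_def fer_support_def deg_def mdeg_add)
  next
    case False
    have "(c, s) \<notin> set ps"
      using Cons.prems False by (simp add: distinct_fers_def p)
    then have "Idx (c - k) s |\<notin>| fer_support k ps"
      using False by (simp add: Idx_in_fer_support)
    moreover have "bos_exps k (p # ps) = bos_exps k ps" "fer_support k (p # ps) = finsert (Idx (c - k) s) (fer_support k ps)"
      using False by (simp_all add: p bos_exps_def fer_support_def)
    ultimately show ?thesis
      using IH by (simp add: deg_def fcard_finsert_disjoint)
  qed
qed

lemma lookup_bos_exps: "c \<le> k \<Longrightarrow> Poly_Mapping.lookup (bos_exps k ps) (Idx c s) = count (mset ps) (c, s)"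
  by (induction ps) (auto simp: bos_exps_def lookup_add lookup_single when_def split: if_splits)

lemma mset_eq_if_bos_exps_fer_support_eq:
  assumes "bos_exps k ps = bos_exps k qs" "fer_support k ps = fer_support k qs" "distinct_fers k ps" "distinct_fers k qs"
  shows "mset ps = mset qs"
proof (rule multiset_eqI)
  fix p :: "nat \<times> 2"
  obtain c s where p: "p = (c, s)"
    by force
  show "count (mset ps) p = count (mset qs) p"
  proof (cases "c \<le> k")
    case True
    then show ?thesis
      using assms(1) by (metis lookup_bos_exps p)
  next
    case False
    have "count (mset rs) (c, s) = (if Idx (c - k) s |\<in>| fer_support k rs then 1 else 0)" if "distinct_fers k rs" for rs
    proof -
      have "count (mset rs) (c, s) = count (mset (filter (\<lambda>(c, s). k < c) rs)) (c, s)"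
        using False by simp
      also have "\<dots> = (if (c, s) \<in> set (filter (\<lambda>(c, s). k < c) rs) then 1 else 0)"
        using that unfolding distinct_fers_def by (auto simp: distinct_count_atmost_1)
      finally show ?thesis
        using False by (simp add: Idx_in_fer_support)
    qed
    then show ?thesis
      using assms by (simp add: p)
  qed
qed

lemma act_svar: "act g (svar k c s) = sconst (g $ 1 $ s) * svar k c 1 + sconst (g $ 2 $ s) * svar k c 2"
  by (simp add: svar_def act_bos act_fer)

section \<open>Dual functionals\<close>

definition firsts :: "nat \<Rightarrow> nat list \<Rightarrow> superpoly" where
  "firsts k cs = var_prod k (map (\<lambda>c. (c, 1)) cs)"

lemma firsts_simps [simp]: "firsts k [] = 1" "firsts k (c # cs) = svar k c 1 * firsts k cs"
  "firsts k (cs @ ds) = firsts k cs * firsts k ds"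
  by (simp_all add: firsts_def)

text \<open>The lists whose products of first components are the distinct nonzero monomials in them.\<close>

definition admissible :: "nat \<Rightarrow> nat \<Rightarrow> nat list \<Rightarrow> bool" where
  "admissible k j cs \<longleftrightarrow> sorted cs \<and> set cs \<subseteq> {1..k + j} \<and> distinct (filter (\<lambda>c. k < c) cs)"

text \<open>In the second set the label of the second component is least, and it differs from the other labels
  if it is fermionic.  For \<open>h = i\<close> the last set contains only fermionic labels.\<close>

definition coinv_basis :: "nat \<Rightarrow> nat \<Rightarrow> nat \<Rightarrow> superpoly set" where
  "coinv_basis n k j =
     {firsts k cs | cs. admissible k j cs \<and> length cs \<le> n - 1}
     \<union> {firsts k cs * svar k i 2 | cs i. admissible k j (i # cs) \<and> length cs \<le> n - 1}
     \<union> {firsts k [h] * svar k i 2 | h i. 1 \<le> h \<and> h \<le> i \<and> i \<le> k + j \<and> (h < i \<or> k < h)}"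

lemma act_collapse_firsts: "act (collapse w) (firsts k cs) = firsts k cs"
  by (induction cs) (simp_all add: act_mult act_svar matrix_entries)

lemma act_phi_firsts: "act phi (firsts k cs) = firsts k cs"
  by (induction cs) (simp_all add: act_mult act_svar matrix_entries)

lemma act_collapse_mixed: "act (collapse w) (firsts k cs * svar k i 2) = sconst w * firsts k (cs @ [i])"
  by (simp add: act_mult act_collapse_firsts act_svar matrix_entries mult_sconst_left)

lemma act_phi_mixed: "act phi (firsts k cs * svar k i 2) = - (firsts k cs * svar k i 2)"
  by (simp add: act_mult act_phi_firsts act_svar matrix_entries)

lemma distinct_fers_firsts: "distinct_fers k (map (\<lambda>c. (c, 1)) cs) \<longleftrightarrow> distinct (filter (\<lambda>c. k < c) cs)"
  by (induction cs) (auto simp: distinct_fers_def)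

definition fcoeff :: "nat \<Rightarrow> nat list \<Rightarrow> superpoly \<Rightarrow> complex" where
  "fcoeff k cs f = scoeff f (bos_exps k (map (\<lambda>c. (c, 1)) cs)) (fer_support k (map (\<lambda>c. (c, 1)) cs))"

lemma fcoeff_firsts_self: "distinct (filter (\<lambda>c. k < c) cs) \<Longrightarrow> fcoeff k cs (firsts k cs) \<noteq> 0"
  unfolding fcoeff_def firsts_def by (rule scoeff_var_prod_self) (simp add: distinct_fers_firsts)

lemma mset_eq_if_fcoeff:
  assumes "fcoeff k cs (firsts k ds) \<noteq> 0"
    "distinct (filter (\<lambda>c. k < c) cs)" "distinct (filter (\<lambda>c. k < c) ds)"
  shows "mset cs = mset ds"
proof -
  have "mset (map (\<lambda>c. (c, 1 :: 2)) cs) = mset (map (\<lambda>c. (c, 1)) ds)"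
    using scoeff_var_prod_nonzero[OF assms(1)[unfolded fcoeff_def firsts_def]] assms(2,3)
    by (intro mset_eq_if_bos_exps_fer_support_eq[of k]) (simp_all add: distinct_fers_firsts)
  then have "image_mset fst (mset (map (\<lambda>c. (c, 1 :: 2)) cs)) = image_mset fst (mset (map (\<lambda>c. (c, 1 :: 2)) ds))"
    by simp
  then show ?thesis
    by (simp add: multiset.map_comp o_def)
qed

lemma fcoeff_vanishes_below:
  "vanishes_below d f \<Longrightarrow> length cs < d \<Longrightarrow> distinct (filter (\<lambda>c. k < c) cs) \<Longrightarrow> fcoeff k cs f = 0"
  by (simp add: fcoeff_def vanishes_below_def deg_bos_exps_fer_support distinct_fers_firsts)

lemma fcoeff_simps: "fcoeff k cs (f + h) = fcoeff k cs f + fcoeff k cs h"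
  "fcoeff k cs (f - h) = fcoeff k cs f - fcoeff k cs h" "fcoeff k cs (sconst c * f) = c * fcoeff k cs f"
  by (simp_all add: fcoeff_def)

definition dual_to :: "nat \<Rightarrow> superpoly set \<Rightarrow> superpoly \<Rightarrow> (superpoly \<Rightarrow> complex) \<Rightarrow> bool" where
  "dual_to n B b l \<longleftrightarrow> (\<forall>f h. l (f + h) = l f + l h) \<and> (\<forall>c f. l (sconst c * f) = c * l f) \<and>
     (\<forall>f \<in> functional_kernel n. l f = 0) \<and> l b \<noteq> 0 \<and> (\<forall>b' \<in> B. b' \<noteq> b \<longrightarrow> l b' = 0)"

lemma admissible_unique: "mset cs = mset ds \<Longrightarrow> admissible k j cs \<Longrightarrow> admissible k j ds \<Longrightarrow> cs = ds"
  unfolding admissible_def by (metis properties_for_sort)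

lemma coinv_basis_cases:
  assumes "b \<in> coinv_basis n k j"
  obtains (first) cs where "b = firsts k cs" "admissible k j cs" "length cs \<le> n - 1"
  | (mixed) cs i where "b = firsts k cs * svar k i 2" "admissible k j (i # cs)" "length cs \<le> n - 1"
  | (quadratic) h i where "b = firsts k [h] * svar k i 2" "1 \<le> h" "h \<le> i" "i \<le> k + j" "h < i \<or> k < h"
  using assms unfolding coinv_basis_def by blast

lemma mixed_eq_var_prod: "firsts k cs * svar k i 2 = var_prod k (map (\<lambda>c. (c, 1)) cs @ [(i, 2)])"
  by (simp add: firsts_def)

lemma distinct_fers_mixed:
  "distinct_fers k (map (\<lambda>c. (c, 1)) cs @ [(i, 2)]) \<longleftrightarrow> distinct (filter (\<lambda>c. k < c) cs)"
  using distinct_fers_firsts[of k cs] by (auto simp: distinct_fers_def)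

text \<open>The reflection negates all products with exactly one second component, so comparing \<open>f\<close> with its
  reflection isolates them.  In degree two these products are linearly independent modulo the ideal,
  and each is detected by its own coefficient.\<close>

lemma dual_functional_quadratic:
  assumes b: "b = firsts k [h] * svar k i 2"
  shows "\<exists>l. dual_to n (coinv_basis n k j) b l"
proof -
  let ?ps = "map (\<lambda>c. (c, 1 :: 2)) [h] @ [(i, 2 :: 2)]"
  let ?c = "\<lambda>f. scoeff f (bos_exps k ?ps) (fer_support k ?ps)"
  let ?l = "\<lambda>f. ?c (act phi f - f)"
  have ps: "distinct_fers k ?ps"
    unfolding distinct_fers_mixed by simp
  have l_mixed: "?l (firsts k cs * svar k c 2) = - 2 * ?c (firsts k cs * svar k c 2)" for cs c
    by (simp only: act_phi_mixed scoeff_simps) simp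
  have other: "?l b' = 0" if b': "b' = firsts k cs * svar k c 2" "distinct (filter (\<lambda>c. k < c) cs)" "b' \<noteq> b" for b' cs c
  proof -
    have "?c (var_prod k (map (\<lambda>c. (c, 1)) cs @ [(c, 2)])) = 0"
    proof (rule ccontr)
      assume "?c (var_prod k (map (\<lambda>c. (c, 1)) cs @ [(c, 2)])) \<noteq> 0"
      from scoeff_var_prod_nonzero[OF this]
      have eq: "mset ?ps = mset (map (\<lambda>c. (c, 1 :: 2)) cs @ [(c, 2)])"
        using ps b'(2) by (intro mset_eq_if_bos_exps_fer_support_eq[of k]) (simp_all only: distinct_fers_mixed)
      from mset_eq_length[OF eq] obtain a where cs: "cs = [a]"
        by (auto simp: length_Suc_conv Suc_length_conv)
      with mset_eq_setD[OF eq] have "a = h" "c = i"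
        by (auto simp: doubleton_eq_iff)
      then show False
        using b' b cs by simp
    qed
    then show ?thesis
      by (simp only: b'(1) l_mixed mixed_eq_var_prod[symmetric]) simp
  qed
  have "?l b' = 0" if "b' \<in> coinv_basis n k j" "b' \<noteq> b" for b'
    using that(1)
  proof (cases rule: coinv_basis_cases)
    case (first cs)
    then show ?thesis
      by (simp add: act_phi_firsts)
  next
    case (mixed cs c)
    with that(2) show ?thesis
      by (intro other[of _ cs c]) (auto simp: admissible_def split: if_splits)
  next
    case (quadratic a c)
    with that(2) show ?thesis
      by (intro other[of _ "[a]" c]) auto
  qed
  moreover have "?l f = 0" if "f \<in> functional_kernel n" for f
    using that deg_bos_exps_fer_support[OF ps] by (simp add: functional_kernel_def vanishes_below_def)
  moreover have "?l b \<noteq> 0"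
    using scoeff_var_prod_self[OF ps] unfolding b l_mixed by (simp only: mixed_eq_var_prod) simp
  ultimately have "dual_to n (coinv_basis n k j) b ?l"
    by (simp add: dual_to_def act_add act_sconst_mult algebra_simps)
  then show ?thesis by (rule exI[where x = ?l])
qed

lemma svar_fer_square: "k < c \<Longrightarrow> svar k c s * svar k c s = 0"
  by (simp add: svar_def fer_def ggen_square_zero)

text \<open>A product of first components is fixed by both collapses, and a product with one second component is
  multiplied by \<open>\<i>\<close> and by \<open>- \<i>\<close>.  Hence the sum of the collapses sees only the former and the
  difference only the latter.  The difference confuses \<open>z\<^sub>1\<^sup>a z\<^sub>2\<^sup>b\<close> with \<open>z\<^sub>2\<^sup>a z\<^sub>1\<^sup>b\<close>, so
  degree two is left to \<open>dual_functional_quadratic\<close>.\<close>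

lemma dual_functional:
  assumes n: "n \<ge> 2" and b: "b \<in> coinv_basis n k j"
  shows "\<exists>l. dual_to n (coinv_basis n k j) b l"
  using b
proof (cases rule: coinv_basis_cases)
  case (first cs)
  \<comment> \<open>The sum of the two collapses kills the products with one second component.\<close>
  let ?l = "\<lambda>f. fcoeff k cs (act (collapse \<i>) f) + fcoeff k cs (act (collapse (- \<i>)) f)"
  have d: "distinct (filter (\<lambda>c. k < c) cs)"
    using first by (simp add: admissible_def)
  have "?l b' = 0" if "b' \<in> coinv_basis n k j" "b' \<noteq> b" for b'
    using that(1)
  proof (cases rule: coinv_basis_cases)
    case f: (first ds)
    have "fcoeff k cs (firsts k ds) = 0"
    proof (rule ccontr)
      assume "fcoeff k cs (firsts k ds) \<noteq> 0"
      then have "mset cs = mset ds"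
        using d f by (intro mset_eq_if_fcoeff) (auto simp: admissible_def)
      then show False
        using f first that(2) admissible_unique by blast
    qed
    then show ?thesis
      by (simp add: f act_collapse_firsts)
  next
    case mixed
    then show ?thesis
      by (simp only: act_collapse_mixed fcoeff_simps) simp
  next
    case quadratic
    then show ?thesis
      by (simp only: act_collapse_mixed fcoeff_simps) simp
  qed
  moreover have "?l f = 0" if "f \<in> functional_kernel n" for f
    using that first n fcoeff_vanishes_below[OF _ _ d, of n] by (simp add: functional_kernel_def)
  moreover have "?l b \<noteq> 0"
    using fcoeff_firsts_self[OF d] by (simp add: first act_collapse_firsts)
  ultimately have "dual_to n (coinv_basis n k j) b ?l"
    by (simp add: dual_to_def act_add act_sconst_mult fcoeff_simps algebra_simps)
  then show ?thesis by (rule exI[where x = ?l])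
next
  case (mixed cs i)
  note m = this
  show ?thesis
  proof (cases "length cs = 1")
    case True
    then obtain h where "cs = [h]"
      by (auto simp: length_Suc_conv)
    then show ?thesis
      using m(1) by (intro dual_functional_quadratic) simp
  next
    case False
    \<comment> \<open>The difference kills the products of first components; here degree \<open>n\<close> is allowed.\<close>
    let ?l = "\<lambda>f. fcoeff k (cs @ [i]) (act (collapse \<i>) f) - fcoeff k (cs @ [i]) (act (collapse (- \<i>)) f)"
    have d: "distinct (filter (\<lambda>c. k < c) (cs @ [i]))"
      using m by (auto simp: admissible_def)
    have l_mixed: "?l (firsts k ds * svar k c 2) = 2 * \<i> * fcoeff k (cs @ [i]) (firsts k (ds @ [c]))" for ds c
      by (simp only: act_collapse_mixed fcoeff_simps) simp
    have "?l b' = 0" if "b' \<in> coinv_basis n k j" "b' \<noteq> b" for b'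
      using that(1)
    proof (cases rule: coinv_basis_cases)
      case first
      then show ?thesis
        by (simp add: act_collapse_firsts)
    next
      case f: (mixed ds c)
      have "fcoeff k (cs @ [i]) (firsts k (ds @ [c])) = 0"
      proof (rule ccontr)
        assume "fcoeff k (cs @ [i]) (firsts k (ds @ [c])) \<noteq> 0"
        then have "mset (cs @ [i]) = mset (ds @ [c])"
          using d f by (intro mset_eq_if_fcoeff) (auto simp: admissible_def split: if_splits)
        then have "i # cs = c # ds"
          using f(2) m(2) by (intro admissible_unique) simp_all
        then show False
          using f m that(2) by simp
      qed
      then show ?thesis
        unfolding f(1) l_mixed by simp
    next
      case q: (quadratic h c)
      \<comment> \<open>The square of a fermionic variable vanishes; all other products here have another degree.\<close>
      have "fcoeff k (cs @ [i]) (firsts k ([h] @ [c])) = 0"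
      proof (cases "k < c \<and> h = c")
        case True
        then show ?thesis
          by (simp add: svar_fer_square fcoeff_def)
      next
        case nsq: False
        show ?thesis
        proof (rule ccontr)
          assume "fcoeff k (cs @ [i]) (firsts k ([h] @ [c])) \<noteq> 0"
          then have "mset (cs @ [i]) = mset ([h] @ [c])"
            using d nsq by (intro mset_eq_if_fcoeff) auto
          from mset_eq_length[OF this] False show False
            by simp
        qed
      qed
      then show ?thesis
        unfolding q(1) l_mixed by (simp only: mult_zero_right)
    qed
    moreover have "?l f = 0" if "f \<in> functional_kernel n" for f
    proof -
      have "length (cs @ [i]) < Suc n"
        using m n by simp
      moreover have "vanishes_below (Suc n) (act (collapse \<i>) f - act (collapse (- \<i>)) f)"
        using that by (simp add: functional_kernel_def)
      ultimately show ?thesis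
        using fcoeff_vanishes_below[OF _ _ d] by (simp only: fcoeff_simps(2)[symmetric])
    qed
    moreover have "?l b \<noteq> 0"
      using fcoeff_firsts_self[OF d] unfolding m(1) l_mixed by simp
    ultimately have "dual_to n (coinv_basis n k j) b ?l"
      by (simp add: dual_to_def act_add act_sconst_mult fcoeff_simps algebra_simps)
    then show ?thesis by (rule exI[where x = ?l])
  qed
next
  case (quadratic h i)
  then show ?thesis
    by (intro dual_functional_quadratic) simp
qed

section \<open>Reordering products\<close>

definition swap_sign :: "nat \<Rightarrow> nat \<Rightarrow> nat \<Rightarrow> complex" where
  "swap_sign k c d = (if k < c \<and> k < d then - 1 else 1)"

lemma swap_sign_square [simp]: "swap_sign k c d * swap_sign k c d = 1"
  by (simp add: swap_sign_def)

lemma swap_sign_square_left [simp]: "swap_sign k c d * (swap_sign k c d * x) = x"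
  by (simp add: swap_sign_def)

lemma svar_swap: "svar k c s * svar k d t = sconst (swap_sign k c d) * (svar k d t * svar k c s)"
proof (cases "k < c \<and> k < d")
  case True
  then show ?thesis
    by (simp add: svar_def fer_def swap_sign_def) (rule ggen_anticommute)
next
  case False
  then consider "c \<le> k" | "d \<le> k"
    by linarith
  then show ?thesis
  proof cases
    case 1
    then show ?thesis
      using False gconst_central[of _ "svar k d t"] by (simp add: svar_def[of k c] bos_def swap_sign_def)
  next
    case 2
    then show ?thesis
      using False gconst_central[of _ "svar k c s"] by (simp add: svar_def[of k d] bos_def swap_sign_def)
  qed
qed

lemma firsts_mult_svar: "\<exists>e\<in>{1, -1}. firsts k cs * svar k c s = sconst e * (svar k c s * firsts k cs)"
proof (induction cs)
  case Nil
  then show ?case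
    by (intro bexI[of _ 1]) simp_all
next
  case (Cons d cs)
  then obtain e where e: "e \<in> {1, -1}" "firsts k cs * svar k c s = sconst e * (svar k c s * firsts k cs)"
    by blast
  have "firsts k (d # cs) * svar k c s = svar k d 1 * (firsts k cs * svar k c s)"
    by (simp add: mult.assoc)
  also have "\<dots> = sconst e * ((svar k d 1 * svar k c s) * firsts k cs)"
    by (simp only: e(2) mult_sconst_left mult.assoc)
  also have "\<dots> = sconst (e * swap_sign k d c) * (svar k c s * firsts k (d # cs))"
    by (simp only: svar_swap[of k d 1] sconst_mult mult.assoc firsts_simps)
  finally show ?case
    using e(1) by (intro bexI[of _ "e * swap_sign k d c"]) (auto simp: swap_sign_def)
qed

lemma firsts_permute:
  assumes "mset cs = mset ds"
  shows "\<exists>e\<in>{1, -1}. firsts k cs = sconst e * firsts k ds"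
  using assms
proof (induction cs arbitrary: ds)
  case Nil
  then show ?case
    by (intro bexI[of _ 1]) simp_all
next
  case (Cons c cs)
  then have "c \<in> set ds"
    by (metis list.set_intros(1) set_mset_mset)
  then obtain xs ys where ds: "ds = xs @ c # ys"
    by (meson split_list)
  with Cons have "mset cs = mset (xs @ ys)"
    by simp
  from Cons.IH[OF this] obtain e where e: "e \<in> {1, -1}" "firsts k cs = sconst e * firsts k (xs @ ys)"
    by blast
  obtain e' where e': "e' \<in> {1, -1}" "firsts k xs * svar k c 1 = sconst e' * (svar k c 1 * firsts k xs)"
    using firsts_mult_svar by blast
  have "sconst (e * e') * firsts k ds = sconst (e * e') * ((firsts k xs * svar k c 1) * firsts k ys)"
    by (simp add: ds mult.assoc)
  also have "\<dots> = sconst (e * (e' * e')) * (svar k c 1 * firsts k (xs @ ys))"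
    by (simp only: e'(2) mult.assoc sconst_mult firsts_simps)
  also have "e' * e' = 1"
    using e'(1) by auto
  finally have "firsts k (c # cs) = sconst (e * e') * firsts k ds"
    by (simp add: e(2) mult_sconst_left)
  then show ?case
    using e(1) e'(1) by (intro bexI[of _ "e * e'"]) auto
qed

lemma firsts_sort: "\<exists>e. firsts k cs = sconst e * firsts k (sort cs)"
proof -
  have "mset cs = mset (sort cs)"
    by simp
  from firsts_permute[OF this] show ?thesis
    by blast
qed

text \<open>A repeated fermionic variable can be moved next to its copy.\<close>

lemma firsts_eq_0:
  assumes "\<not> distinct (filter (\<lambda>c. k < c) cs)"
  shows "firsts k cs = 0"
proof -
  obtain c where c_count: "count (mset (filter (\<lambda>c. k < c) cs)) c \<noteq> (if c \<in> set (filter (\<lambda>c. k < c) cs) then 1 else 0)"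
    using assms by (auto simp only: distinct_count_atmost_1)
  then have c: "k < c" and "count (mset cs) c \<noteq> 1" "c \<in> set cs"
    by (auto split: if_splits simp: count_eq_zero_iff)
  then have "2 \<le> count (mset cs) c"
    by (simp add: Suc_le_eq numeral_2_eq_2 neq_iff)
  then have "{#c, c#} \<subseteq># mset cs"
    by (intro mset_subset_eqI) (auto split: if_splits)
  then have "mset cs = {#c, c#} + (mset cs - {#c, c#})"
    by (simp only: subset_mset.add_diff_inverse)
  moreover obtain rest where "mset rest = mset cs - {#c, c#}"
    using ex_mset by blast
  ultimately have "mset cs = mset (c # c # rest)"
    by simp
  then obtain e where "firsts k cs = sconst e * firsts k (c # c # rest)"
    using firsts_permute by blast
  then show ?thesis
    using svar_fer_square[OF c] by (simp add: mult.assoc[symmetric])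
qed

section \<open>Reduction modulo the relations\<close>

lemma coinv_basisI:
  "admissible k j cs \<Longrightarrow> length cs \<le> n - 1 \<Longrightarrow> firsts k cs \<in> coinv_basis n k j"
  "admissible k j (i # cs) \<Longrightarrow> length cs \<le> n - 1 \<Longrightarrow> firsts k cs * svar k i 2 \<in> coinv_basis n k j"
  "1 \<le> h \<Longrightarrow> h \<le> i \<Longrightarrow> i \<le> k + j \<Longrightarrow> h < i \<or> k < h \<Longrightarrow> firsts k [h] * svar k i 2 \<in> coinv_basis n k j"
  unfolding coinv_basis_def by blast+

text \<open>Eigenvectors of the rotation for \<open>w = \<plusminus> \<i>\<close>.\<close>

definition eigenvar :: "nat \<Rightarrow> complex \<Rightarrow> nat \<Rightarrow> superpoly" where
  "eigenvar k w c = svar k c 1 + sconst w * svar k c 2"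

definition eigen_prod :: "nat \<Rightarrow> complex \<Rightarrow> nat list \<Rightarrow> superpoly" where
  "eigen_prod k w cs = prod_list (map (eigenvar k w) cs)"

lemma eigen_prod_simps [simp]: "eigen_prod k w [] = 1" "eigen_prod k w (c # cs) = eigenvar k w c * eigen_prod k w cs"
  "eigen_prod k w (cs @ ds) = eigen_prod k w cs * eigen_prod k w ds"
  by (simp_all add: eigen_prod_def)

text \<open>The reduction of monomials uses only two families of elements of the ideal \<open>I\<close>.  The subspace \<open>W\<close>
  stands for the sum of \<open>I\<close> and the span of the basis.\<close>

locale coinv_relations =
  fixes n k j :: nat and S I W :: "superpoly set"
  assumes n: "n \<ge> 2"
    and S_closed: "0 \<in> S" "\<And>f h. f \<in> S \<Longrightarrow> h \<in> S \<Longrightarrow> f + h \<in> S" "\<And>f h. f \<in> S \<Longrightarrow> h \<in> S \<Longrightarrow> f * h \<in> S"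
      "\<And>c. sconst c \<in> S" "\<And>c s. c \<in> {1..k + j} \<Longrightarrow> svar k c s \<in> S"
    and I_closed: "0 \<in> I" "\<And>f h. f \<in> I \<Longrightarrow> h \<in> I \<Longrightarrow> f + h \<in> I"
      "\<And>f s. f \<in> I \<Longrightarrow> s \<in> S \<Longrightarrow> s * f \<in> I" "\<And>f s. f \<in> I \<Longrightarrow> s \<in> S \<Longrightarrow> f * s \<in> I"
    and quadric: "\<And>a b. a \<in> {1..k + j} \<Longrightarrow> b \<in> {1..k + j} \<Longrightarrow>
      svar k a 1 * svar k b 1 + svar k a 2 * svar k b 2 \<in> I"
    and norm_n: "\<And>cs. set cs \<subseteq> {1..k + j} \<Longrightarrow> length cs = n \<Longrightarrow>
      eigen_prod k \<i> cs + eigen_prod k (- \<i>) cs \<in> I"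
    and W_closed: "\<And>f h. f \<in> W \<Longrightarrow> h \<in> W \<Longrightarrow> f + h \<in> W" "\<And>f c. f \<in> W \<Longrightarrow> sconst c * f \<in> W"
    and W_sup: "I \<subseteq> W" "coinv_basis n k j \<subseteq> W"
begin

abbreviation x :: "nat \<Rightarrow> 2 \<Rightarrow> superpoly" where "x \<equiv> svar k"

abbreviation V :: "nat set" where "V \<equiv> {1..k + j}"

definition cong :: "superpoly \<Rightarrow> superpoly \<Rightarrow> bool" (infix "\<doteq>" 50) where
  "f \<doteq> h \<longleftrightarrow> f - h \<in> I"

lemma I_scale: "f \<in> I \<Longrightarrow> sconst c * f \<in> I"
  by (simp add: I_closed S_closed)

lemma I_uminus: "f \<in> I \<Longrightarrow> - f \<in> I"
  using I_scale[of f "- 1"] by simp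

lemma cong_refl [simp, intro]: "f \<doteq> f"
  by (simp add: cong_def I_closed)

lemma cong_sym: "f \<doteq> h \<Longrightarrow> h \<doteq> f"
  unfolding cong_def using I_uminus[of "f - h"] by simp

lemma cong_trans [trans]: "f \<doteq> g \<Longrightarrow> g \<doteq> h \<Longrightarrow> f \<doteq> h"
  unfolding cong_def using I_closed(2)[of "f - g" "g - h"] by simp

lemma cong_add: "f \<doteq> f' \<Longrightarrow> h \<doteq> h' \<Longrightarrow> f + h \<doteq> f' + h'"
  unfolding cong_def using I_closed(2)[of "f - f'" "h - h'"] by (simp add: algebra_simps)

lemma cong_scale: "f \<doteq> h \<Longrightarrow> sconst c * f \<doteq> sconst c * h"
  unfolding cong_def using I_scale[of "f - h" c] by (simp add: algebra_simps)

lemma cong_uminus: "f \<doteq> h \<Longrightarrow> - f \<doteq> - h"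
  using cong_scale[of f h "- 1"] by simp

lemma cong_diff: "f \<doteq> f' \<Longrightarrow> h \<doteq> h' \<Longrightarrow> f - h \<doteq> f' - h'"
  using cong_add[of f f' "- h" "- h'"] cong_uminus[of h h'] by simp

lemma cong_left: "f \<doteq> h \<Longrightarrow> s \<in> S \<Longrightarrow> s * f \<doteq> s * h"
  unfolding cong_def using I_closed(3)[of "f - h" s] by (simp add: algebra_simps)

lemma cong_right: "f \<doteq> h \<Longrightarrow> s \<in> S \<Longrightarrow> f * s \<doteq> h * s"
  unfolding cong_def using I_closed(4)[of "f - h" s] by (simp add: algebra_simps)

lemma cong_W: "f \<doteq> h \<Longrightarrow> h \<in> W \<Longrightarrow> f \<in> W"
  using W_closed(1)[of "f - h" h] W_sup(1) by (auto simp: cong_def)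

lemma cong_I: "f \<doteq> h \<Longrightarrow> h \<in> I \<Longrightarrow> f \<in> I"
  using I_closed(2)[of "f - h" h] by (simp add: cong_def)

lemma S_firsts: "set cs \<subseteq> V \<Longrightarrow> firsts k cs \<in> S"
  by (induction cs) (use S_closed(4)[of 1] in \<open>auto intro!: S_closed(3,5)\<close>)

lemma quadric_cong: "a \<in> V \<Longrightarrow> b \<in> V \<Longrightarrow> x a 2 * x b 2 \<doteq> - (x a 1 * x b 1)"
  using quadric[of a b] by (simp add: cong_def add.commute)

lemma swap_middle: "x a s * x b t * x c r = sconst (swap_sign k a b) * (x b t * (x a s * x c r))"
  by (simp only: svar_swap[of k a s b t] mult.assoc)

text \<open>Both sides are congruent to minus the product in which all components are the one opposite to \<open>s\<close>:
  the quadratic relation turns one pair of equal components into the other one, and if the two factors of the pair are not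
  adjacent, then bringing them together and back cancels the sign.\<close>

lemma move_second:
  assumes "a \<in> V" "c \<in> V" "d \<in> V"
  shows "x a s * x c 1 * x d 2 \<doteq> x a s * x c 2 * x d 1"
proof -
  have S: "x e t \<in> S" if "e \<in> V" for e t
    using that by (rule S_closed)
  consider "s = 1" | "s = 2"
    using exhaust_2 by blast
  then show ?thesis
  proof cases
    case 1
    have "x a 1 * x c 1 * x d 2 \<doteq> - (x a 2 * x c 2) * x d 2"
      using cong_uminus[OF quadric_cong[of a c]] assms by (intro cong_right S) (simp_all add: cong_sym)
    moreover have "x a 1 * x c 2 * x d 1 \<doteq> - (x a 2 * x c 2) * x d 2"
    proof -
      have "x a 1 * x c 2 * x d 1 = sconst (swap_sign k a c) * (x c 2 * (x a 1 * x d 1))"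
        by (rule swap_middle)
      also have "\<dots> \<doteq> sconst (swap_sign k a c) * (x c 2 * - (x a 2 * x d 2))"
        using cong_uminus[OF quadric_cong[of a d]] assms by (intro cong_scale cong_left S) (simp_all add: cong_sym)
      also have "sconst (swap_sign k a c) * (x c 2 * - (x a 2 * x d 2)) = - (x a 2 * x c 2) * x d 2"
        by (simp add: swap_middle)
      finally show ?thesis .
    qed
    ultimately show ?thesis
      using 1 cong_sym cong_trans by blast
  next
    case 2
    have "x a 2 * x c 2 * x d 1 \<doteq> - (x a 1 * x c 1) * x d 1"
      using assms by (intro cong_right S quadric_cong)
    moreover have "x a 2 * x c 1 * x d 2 \<doteq> - (x a 1 * x c 1) * x d 1"
    proof -
      have "x a 2 * x c 1 * x d 2 = sconst (swap_sign k a c) * (x c 1 * (x a 2 * x d 2))"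
        by (rule swap_middle)
      also have "\<dots> \<doteq> sconst (swap_sign k a c) * (x c 1 * - (x a 1 * x d 1))"
        using assms by (intro cong_scale cong_left S quadric_cong)
      also have "sconst (swap_sign k a c) * (x c 1 * - (x a 1 * x d 1)) = - (x a 1 * x c 1) * x d 1"
        by (simp add: swap_middle)
      finally show ?thesis .
    qed
    ultimately show ?thesis
      using 2 cong_sym cong_trans by blast
  qed
qed

text \<open>Expand the product of the \<open>z\<^sub>1 + \<i> z\<^sub>2\<close> into terms with an even and with an odd number of second
  components.  A pair of second components carries the factor \<open>\<i>\<^sup>2 = - 1\<close> and is congruent to minus a pair of
  first ones, so for \<open>m\<close> factors each of the \<open>2 ^ (m - 1)\<close> even terms is congruent to the product of first components.  The two congruences for the
  odd part are what the induction needs to append another factor.\<close>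

lemma eigen_prod_even_odd:
  assumes "set cs \<subseteq> V" "cs \<noteq> []"
  shows "\<exists>E Q. eigen_prod k \<i> cs = E + sconst \<i> * Q \<and> eigen_prod k (- \<i>) cs = E - sconst \<i> * Q \<and>
    E \<in> S \<and> Q \<in> S \<and> E \<doteq> sconst (2 ^ (length cs - 1)) * firsts k cs \<and>
    (\<forall>c\<in>V. \<forall>d\<in>V. Q * x c 1 * x d 2 \<doteq> Q * x c 2 * x d 1) \<and>
    (\<forall>c\<in>V. Q * x c 2 \<doteq> - (sconst (2 ^ (length cs - 1)) * firsts k cs * x c 1))"
  using assms
proof (induction cs rule: rev_induct)
  case (snoc a cs)
  have a: "a \<in> V" and cs: "set cs \<subseteq> V"
    using snoc.prems by auto
  have S: "x e t \<in> S" if "e \<in> V" for e t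
    using that by (rule S_closed)
  show ?case
  proof (cases "cs = []")
    case True
    show ?thesis
      using a by (intro exI[of _ "x a 1"] exI[of _ "x a 2"])
        (auto simp: True eigenvar_def S intro!: move_second quadric_cong simp del: atLeastAtMost_iff)
  next
    case False
    let ?c = "sconst (2 ^ (length cs - 1))" and ?f = "firsts k cs"
    obtain E Q where EQ: "eigen_prod k \<i> cs = E + sconst \<i> * Q" "eigen_prod k (- \<i>) cs = E - sconst \<i> * Q"
      and ES: "E \<in> S" "Q \<in> S" and E: "E \<doteq> ?c * ?f"
      and Q1: "\<And>c d. c \<in> V \<Longrightarrow> d \<in> V \<Longrightarrow> Q * x c 1 * x d 2 \<doteq> Q * x c 2 * x d 1"
      and Q2: "\<And>c. c \<in> V \<Longrightarrow> Q * x c 2 \<doteq> - (?c * ?f * x c 1)"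
      using snoc.IH[OF cs False] by blast
    let ?E = "E * x a 1 - Q * x a 2" and ?Q = "E * x a 2 + Q * x a 1"
    have prod: "(E + sconst w * Q) * eigenvar k w a = (E * x a 1 + sconst (w * w) * (Q * x a 2)) + sconst w * ?Q" for w
      by (simp only: eigenvar_def distrib_left distrib_right sconst_mult_mult mult_sconst_left[of E])
        (simp only: mult.assoc add_ac)
    have double: "sconst (2 ^ (length (cs @ [a]) - 1)) * h = ?c * h + ?c * h" for h
    proof -
      have "(2 :: complex) ^ (length (cs @ [a]) - 1) = 2 ^ (length cs - 1) + 2 ^ (length cs - 1)"
        using False by (cases cs) auto
      then show ?thesis
        by (simp only: sconst_simps distrib_right)
    qed
    have 1: "eigen_prod k \<i> (cs @ [a]) = ?E + sconst \<i> * ?Q"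
      "eigen_prod k (- \<i>) (cs @ [a]) = ?E - sconst \<i> * ?Q"
      using prod[of \<i>] prod[of "- \<i>"] by (simp_all add: EQ)
    have 2: "?E \<in> S" "?Q \<in> S"
    proof -
      have "E * x a 1 + sconst (- 1) * (Q * x a 2) \<in> S"
        by (intro S_closed ES a)
      then show "?E \<in> S"
        by simp
      show "?Q \<in> S"
        by (intro S_closed ES a)
    qed
    have 3: "?E \<doteq> sconst (2 ^ (length (cs @ [a]) - 1)) * firsts k (cs @ [a])"
    proof -
      have "?E \<doteq> ?c * ?f * x a 1 - - (?c * ?f * x a 1)"
        by (intro cong_diff cong_right E Q2 S a)
      then show ?thesis
        by (simp only: double) (simp add: mult.assoc)
    qed
    have 4: "?Q * x c 1 * x d 2 \<doteq> ?Q * x c 2 * x d 1" if "c \<in> V" "d \<in> V" for c d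
    proof -
      have "E * (x a 2 * x c 1 * x d 2) + Q * (x a 1 * x c 1 * x d 2)
          \<doteq> E * (x a 2 * x c 2 * x d 1) + Q * (x a 1 * x c 2 * x d 1)"
        using that a by (intro cong_add cong_left move_second ES)
      then show ?thesis
        by (simp add: distrib_right mult.assoc)
    qed
    have 5: "?Q * x c 2 \<doteq> - (sconst (2 ^ (length (cs @ [a]) - 1)) * firsts k (cs @ [a]) * x c 1)"
      if "c \<in> V" for c
    proof -
      have "E * (x a 2 * x c 2) \<doteq> E * - (x a 1 * x c 1)"
        using that a by (intro cong_left quadric_cong ES)
      also have "E * - (x a 1 * x c 1) = - (E * (x a 1 * x c 1))"
        by simp
      also have "\<dots> \<doteq> - (?c * ?f * (x a 1 * x c 1))"
        using that a by (intro cong_uminus cong_right E S_closed)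
      finally have E': "E * (x a 2 * x c 2) \<doteq> - (?c * ?f * (x a 1 * x c 1))" .
      have "Q * x a 1 * x c 2 \<doteq> Q * x a 2 * x c 1"
        using that a by (rule Q1[rotated])
      also have "\<dots> \<doteq> - (?c * ?f * x a 1) * x c 1"
        using that a by (intro cong_right Q2 S)
      finally have "E * (x a 2 * x c 2) + Q * x a 1 * x c 2
          \<doteq> - (?c * ?f * (x a 1 * x c 1)) + - (?c * ?f * x a 1) * x c 1"
        by (intro cong_add E')
      then show ?thesis
        by (simp only: double) (simp add: distrib_right mult.assoc)
    qed
    show ?thesis
      using 1 2 3 4 5 by blast
  qed
qed simp

text \<open>The odd parts cancel in the invariant of degree \<open>n\<close>, so it is congruent to a nonzero multiple of the
  product of first components.\<close>

lemma firsts_n_in_I: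
  assumes "set cs \<subseteq> V" "length cs = n"
  shows "firsts k cs \<in> I"
proof -
  have ne: "cs \<noteq> []"
    using assms n by auto
  obtain E Q where EQ: "eigen_prod k \<i> cs = E + sconst \<i> * Q" "eigen_prod k (- \<i>) cs = E - sconst \<i> * Q"
    and E: "E \<doteq> sconst (2 ^ (length cs - 1)) * firsts k cs"
    using eigen_prod_even_odd[OF assms(1) ne] by blast
  have "E + E \<in> I"
    using norm_n[OF assms] by (simp add: EQ)
  then have "sconst (1 / 2) * (E + E) \<in> I"
    by (rule I_scale)
  moreover have "sconst (1 / 2) * (E + E) = E"
    by (simp add: distrib_left distrib_right[symmetric] flip: sconst_simps(3))
  ultimately have "sconst (2 ^ (length cs - 1)) * firsts k cs \<in> I"
    using E cong_I cong_sym by metis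
  then have "sconst (1 / 2 ^ (length cs - 1)) * (sconst (2 ^ (length cs - 1)) * firsts k cs) \<in> I"
    by (rule I_scale)
  then show ?thesis
    by (simp add: mult.assoc[symmetric] sconst_mult[symmetric])
qed

lemma firsts_long_in_I:
  assumes "set cs \<subseteq> V" "n \<le> length cs"
  shows "firsts k cs \<in> I"
proof -
  have "firsts k (take n cs) * firsts k (drop n cs) \<in> I"
    using assms set_take_subset[of n cs] set_drop_subset[of n cs]
    by (intro I_closed firsts_n_in_I S_firsts) auto
  then show ?thesis
    by (simp flip: firsts_simps(3))
qed

lemma W_0: "0 \<in> W"
  using W_sup(1) I_closed(1) by blast

lemma admissible_sort:
  assumes "set cs \<subseteq> V" "distinct (filter (\<lambda>c. k < c) cs)"
  shows "admissible k j (sort cs)"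
proof -
  have "mset (filter (\<lambda>c. k < c) (sort cs)) = mset (filter (\<lambda>c. k < c) cs)"
    by simp
  then have "distinct (filter (\<lambda>c. k < c) (sort cs))"
    using assms(2) mset_eq_imp_distinct_iff by blast
  then show ?thesis
    using assms(1) by (simp add: admissible_def)
qed

lemma firsts_in_W:
  assumes "set cs \<subseteq> V"
  shows "firsts k cs \<in> W"
proof (cases "n \<le> length cs")
  case True
  then show ?thesis
    using firsts_long_in_I assms W_sup(1) by blast
next
  case False
  show ?thesis
  proof (cases "distinct (filter (\<lambda>c. k < c) cs)")
    case True
    then have "firsts k (sort cs) \<in> coinv_basis n k j"
      using admissible_sort[OF assms] False by (intro coinv_basisI) simp_all
    moreover obtain e where "firsts k cs = sconst e * firsts k (sort cs)"
      using firsts_sort by blast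
    ultimately show ?thesis
      using W_sup(2) W_closed(2) by auto
  next
    case False
    then show ?thesis
      by (simp add: firsts_eq_0 W_0)
  qed
qed

lemma two_out:
  assumes "c \<in> set cs" "2 \<le> length cs"
  obtains b rest where "mset cs = mset (rest @ [b, c])"
proof -
  from assms(1) obtain ys zs where cs: "cs = ys @ c # zs"
    by (meson split_list)
  with assms(2) have "ys @ zs \<noteq> []"
    by auto
  then obtain rest b where "ys @ zs = rest @ [b]"
    by (metis rev_exhaust)
  then have "mset ys + mset zs = mset (rest @ [b])"
    by (metis mset_append)
  then show thesis
    by (intro that[of rest b]) (simp add: cs)
qed

text \<open>If the least label \<open>i\<close> is fermionic and occurs twice, the second component is moved to a third factor,
  which leaves the square of a fermionic variable.\<close>

lemma mixed_least_in_W: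
  assumes V: "set (i # cs) \<subseteq> V" and len: "2 \<le> length cs" and least: "\<forall>c \<in> set cs. i \<le> c"
  shows "firsts k cs * x i 2 \<in> W"
proof (cases "n \<le> length cs")
  case True
  then have "firsts k cs * x i 2 \<in> I"
    using V by (intro I_closed firsts_long_in_I S_closed) auto
  then show ?thesis
    using W_sup(1) by blast
next
  case short: False
  consider "distinct (filter (\<lambda>c. k < c) (i # cs))" | "\<not> distinct (filter (\<lambda>c. k < c) cs)" | "k < i" "i \<in> set cs"
    by (cases "k < i") auto
  then show ?thesis
  proof cases
    case 1
    have "sort (i # cs) = i # sort cs"
      using least by (simp add: insort_is_Cons)
    then have "admissible k j (i # sort cs)"
      using admissible_sort[OF V 1] by simp
    then have "firsts k (sort cs) * x i 2 \<in> coinv_basis n k j"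
      using short by (intro coinv_basisI) simp_all
    moreover obtain e where "firsts k cs = sconst e * firsts k (sort cs)"
      using firsts_sort by blast
    ultimately show ?thesis
      using W_sup(2) W_closed(2) by (auto simp: mult.assoc)
  next
    case 2
    then show ?thesis
      by (simp add: firsts_eq_0 W_0)
  next
    case 3
    obtain b rest where eq: "mset cs = mset (rest @ [b, i])"
      using two_out[OF 3(2) len] .
    then obtain e where e: "firsts k cs = sconst e * firsts k (rest @ [b, i])"
      using firsts_permute by blast
    have V': "i \<in> V" "b \<in> V" "set rest \<subseteq> V"
      using V mset_eq_setD[OF eq] by auto
    have "x b 1 * x i 1 * x i 2 = sconst (swap_sign k b i) * (x i 1 * x b 1 * x i 2)"
      by (subst swap_middle) (simp only: mult.assoc)
    also have "\<dots> \<doteq> sconst (swap_sign k b i) * (x i 1 * x b 2 * x i 1)"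
      by (intro cong_scale move_second V')
    also have "x i 1 * x b 2 * x i 1 = 0"
      using 3(1) by (simp add: swap_middle svar_fer_square)
    finally have "x b 1 * x i 1 * x i 2 \<doteq> 0"
      by simp
    then have "sconst e * (firsts k rest * (x b 1 * x i 1 * x i 2)) \<doteq> sconst e * (firsts k rest * 0)"
      by (intro cong_scale cong_left S_firsts V')
    moreover have "firsts k cs * x i 2 = sconst e * (firsts k rest * (x b 1 * x i 1 * x i 2))"
      by (simp only: e firsts_simps mult.assoc mult_1_left mult_1_right)
    ultimately have "firsts k cs * x i 2 \<doteq> 0"
      by simp
    then show ?thesis
      using W_0 by (rule cong_W)
  qed
qed

text \<open>In degree two all products with one second component belong to the basis.  In higher degree the second
  component is moved to the least label.\<close>

lemma mixed_in_W:
  assumes V: "set (i # cs) \<subseteq> V"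
  shows "firsts k cs * x i 2 \<in> W"
proof -
  have "1 \<le> n - 1"
    using n by simp
  consider "cs = []" | a where "cs = [a]" | "2 \<le> length cs"
  proof (cases cs)
    case (Cons a ds)
    with that show thesis
      by (cases ds) auto
  qed (use that in blast)
  then show ?thesis
  proof cases
    case 1
    then have "admissible k j [i]"
      using V by (simp add: admissible_def)
    then have "firsts k [] * x i 2 \<in> coinv_basis n k j"
      by (rule coinv_basisI) simp
    then show ?thesis
      using W_sup(2) 1 by auto
  next
    case (2 a)
    show ?thesis
    proof (cases "a < i \<or> a = i \<and> k < a")
      case True
      then have "firsts k [a] * x i 2 \<in> coinv_basis n k j"
        using V 2 True by (intro coinv_basisI(3)) auto
      then show ?thesis
        using W_sup(2) 2 by auto
    next
      case False
      then have "admissible k j [i, a]"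
        using V 2 by (auto simp: admissible_def)
      then have "firsts k [a] * x i 2 \<in> coinv_basis n k j"
        using \<open>1 \<le> n - 1\<close> by (intro coinv_basisI) simp_all
      then show ?thesis
        using W_sup(2) 2 by auto
    qed
  next
    case 3
    define m where "m = Min (set (i # cs))"
    have m: "m \<in> set (i # cs)" "\<forall>c \<in> set (i # cs). m \<le> c"
      unfolding m_def by (rule Min_in, simp, simp) (intro ballI Min_le, simp_all)
    show ?thesis
    proof (cases "m = i")
      case True
      then show ?thesis
        using m V 3 by (intro mixed_least_in_W) auto
    next
      case False
      with m have "m \<in> set cs"
        by simp
      with 3 obtain b rest where eq: "mset cs = mset (rest @ [b, m])"
        by (meson two_out)
      then obtain e where e: "firsts k cs = sconst e * firsts k (rest @ [b, m])"
        using firsts_permute by blast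
      have V': "i \<in> V" "b \<in> V" "m \<in> V" "set rest \<subseteq> V"
        using V mset_eq_setD[OF eq] by auto
      have "x b 1 * x m 1 * x i 2 \<doteq> x b 1 * x m 2 * x i 1"
        by (intro move_second V')
      also have "x b 1 * x m 2 * x i 1 = sconst (swap_sign k m i) * (x b 1 * x i 1 * x m 2)"
        by (simp only: mult.assoc svar_swap[of k m 2 i 1] mult_sconst_left)
      finally have "sconst e * (firsts k rest * (x b 1 * x m 1 * x i 2))
          \<doteq> sconst e * (firsts k rest * (sconst (swap_sign k m i) * (x b 1 * x i 1 * x m 2)))"
        by (intro cong_scale cong_left S_firsts V')
      moreover have "firsts k (rest @ [b, i]) * x m 2 \<in> W"
        using V' m(2) mset_eq_setD[OF eq] mset_eq_length[OF eq] 3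
        by (intro mixed_least_in_W) auto
      then have "sconst e * (sconst (swap_sign k m i) * (firsts k (rest @ [b, i]) * x m 2)) \<in> W"
        by (intro W_closed)
      moreover have "firsts k cs * x i 2 = sconst e * (firsts k rest * (x b 1 * x m 1 * x i 2))"
        by (simp only: e firsts_simps mult.assoc mult_1_left mult_1_right)
      moreover have "sconst (swap_sign k m i) * (firsts k (rest @ [b, i]) * x m 2)
          = firsts k rest * (sconst (swap_sign k m i) * (x b 1 * x i 1 * x m 2))"
        by (simp only: firsts_simps mult.assoc mult_1_left mult_1_right mult_sconst_left[of "firsts k rest"])
      ultimately show ?thesis
        using cong_W by metis
    qed
  qed
qed

text \<open>An intermediate subspace that is visibly closed under multiplication by variables, as the span of the
  basis itself is not.\<close>

inductive_set reduced :: "superpoly set" where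
  ideal: "f \<in> I \<Longrightarrow> f \<in> reduced"
| firsts: "set cs \<subseteq> V \<Longrightarrow> firsts k cs \<in> reduced"
| mixed: "set (i # cs) \<subseteq> V \<Longrightarrow> firsts k cs * x i 2 \<in> reduced"
| add: "f \<in> reduced \<Longrightarrow> h \<in> reduced \<Longrightarrow> f + h \<in> reduced"
| scale: "f \<in> reduced \<Longrightarrow> sconst c * f \<in> reduced"

lemma reduced_W: "f \<in> reduced \<Longrightarrow> f \<in> W"
  by (induction rule: reduced.induct) (use W_sup(1) firsts_in_W mixed_in_W W_closed in auto)

lemma reduced_var_mult:
  assumes "f \<in> reduced" "c \<in> V"
  shows "x c s * f \<in> reduced"
proof -
  have "s = 1 \<or> s = 2"
    by (rule exhaust_2)
  show ?thesis
    using assms(1)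
  proof induction
    case (ideal f)
    then show ?case
      using assms(2) by (intro reduced.ideal I_closed S_closed)
  next
    case (firsts cs)
    have "x c 1 * firsts k cs \<in> reduced"
      using reduced.firsts[of "c # cs"] firsts assms(2) by simp
    moreover obtain e where e: "e \<in> {1, -1}" "firsts k cs * x c 2 = sconst e * (x c 2 * firsts k cs)"
      using firsts_mult_svar by blast
    then have "x c 2 * firsts k cs = sconst e * (firsts k cs * x c 2)"
      by auto
    then have "x c 2 * firsts k cs \<in> reduced"
      using firsts assms(2) by (simp only:) (intro reduced.intros, simp)
    ultimately show ?case
      using \<open>s = 1 \<or> s = 2\<close> by auto
  next
    case (mixed i cs)
    have c1: "x c 1 * (firsts k cs * x i 2) \<in> reduced"
      using reduced.mixed[of i "c # cs"] mixed assms(2) by (simp add: mult.assoc)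
    obtain e where e: "e \<in> {1, -1}" "firsts k cs * x c 2 = sconst e * (x c 2 * firsts k cs)"
      using firsts_mult_svar by blast
    then have swap: "x c 2 * firsts k cs = sconst e * (firsts k cs * x c 2)"
      by auto
    have "x c 2 * (firsts k cs * x i 2) = x c 2 * firsts k cs * x i 2"
      by (simp only: mult.assoc)
    then have eq: "x c 2 * (firsts k cs * x i 2) = sconst e * (firsts k cs * (x c 2 * x i 2))"
      by (simp only: swap mult.assoc)
    have "sconst e * (firsts k cs * (x c 2 * x i 2)) \<doteq> sconst e * (firsts k cs * - (x c 1 * x i 1))"
      using mixed assms(2) by (intro cong_scale cong_left quadric_cong S_firsts) auto
    then have "sconst e * (firsts k cs * (x c 2 * x i 2)) - sconst e * (firsts k cs * - (x c 1 * x i 1)) \<in> reduced"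
      unfolding cong_def by (rule reduced.ideal)
    moreover have "firsts k (cs @ [c, i]) \<in> reduced"
      using mixed assms(2) by (intro reduced.firsts) auto
    then have "sconst (- e) * firsts k (cs @ [c, i]) \<in> reduced"
      by (rule reduced.scale)
    then have "sconst e * (firsts k cs * - (x c 1 * x i 1)) \<in> reduced"
      by (simp add: mult.assoc)
    ultimately have "x c 2 * (firsts k cs * x i 2) \<in> reduced"
      unfolding eq using reduced.add by fastforce
    with c1 show ?case
      using \<open>s = 1 \<or> s = 2\<close> by auto
  next
    case (add f h)
    then show ?case
      by (simp add: distrib_left reduced.add)
  next
    case (scale f d)
    then show ?case
      by (simp only: mult_sconst_left) (rule reduced.scale)
  qed
qed

lemma spanning:
  assumes "support_in {v. copy v \<in> {1..k}} {v. copy v \<in> {1..j}} f"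
  shows "f \<in> W"
proof (rule reduced_W, rule superpoly_support_induct[OF assms])
  show "sconst c \<in> reduced" for c
    using reduced.scale[OF reduced.firsts[of "[]"], of c] by simp
  show "xvar v * f \<in> reduced" if "v \<in> {v. copy v \<in> {1..k}}" "f \<in> reduced" for v f
    using reduced_var_mult[OF that(2), of "copy v" "comp v"] that(1) by (auto simp: svar_def xvar_eq_bos)
  show "tvar v * f \<in> reduced" if "v \<in> {v. copy v \<in> {1..j}}" "f \<in> reduced" for v f
    using reduced_var_mult[OF that(2), of "copy v + k" "comp v"] that(1) by (auto simp: svar_def tvar_eq_fer)
qed (rule reduced.add)

end

section \<open>Sorted products and products of powers\<close>

definition blocks :: "(nat \<Rightarrow> nat) \<Rightarrow> nat list \<Rightarrow> nat list" where
  "blocks \<gamma> xs = concat (map (\<lambda>c. replicate (\<gamma> c) c) xs)"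

lemma blocks_simps [simp]: "blocks \<gamma> [] = []" "blocks \<gamma> (c # xs) = replicate (\<gamma> c) c @ blocks \<gamma> xs"
  by (simp_all add: blocks_def)

lemma set_blocks: "set (blocks \<gamma> xs) = {c \<in> set xs. 0 < \<gamma> c}"
  by (simp add: blocks_def set_eq_iff)

lemma sorted_blocks: "sorted xs \<Longrightarrow> sorted (blocks \<gamma> xs)"
  by (induction xs) (auto simp: sorted_append set_blocks)

lemma length_blocks: "length (blocks \<gamma> xs) = sum_list (map \<gamma> xs)"
  by (induction xs) auto

lemma count_blocks: "distinct xs \<Longrightarrow> count (mset (blocks \<gamma> xs)) c = (if c \<in> set xs then \<gamma> c else 0)"
  by (induction xs) auto

lemma distinct_filter_blocks:
  "distinct xs \<Longrightarrow> \<forall>c>k. \<gamma> c \<le> 1 \<Longrightarrow> distinct (filter (\<lambda>c. k < c) (blocks \<gamma> xs))"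
proof (induction xs)
  case (Cons c xs)
  then have "\<gamma> c = 0 \<or> \<gamma> c = 1 \<or> \<not> k < c"
    by (metis less_one linorder_neqE_nat not_le)
  with Cons show ?case
    by (auto simp: set_blocks)
qed simp

lemma firsts_blocks: "firsts k (blocks \<gamma> xs) = prod_list (map (\<lambda>c. svar k c 1 ^ \<gamma> c) xs)"
proof (induction xs)
  case (Cons c xs)
  have "firsts k (replicate N c) = svar k c 1 ^ N" for N
    by (induction N) simp_all
  with Cons show ?case
    by simp
qed simp

text \<open>Exponents indexed by labels, bosonic and fermionic ones together; \<open>p\<close> is the least label that is used.\<close>

definition exponents :: "nat \<Rightarrow> nat \<Rightarrow> nat \<Rightarrow> nat \<Rightarrow> (nat \<Rightarrow> nat) set" where
  "exponents k j p m = {\<gamma>. (\<forall>c>k. \<gamma> c \<le> 1) \<and> sum \<gamma> {p..k + j} \<le> m}"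

definition power_prod :: "nat \<Rightarrow> nat \<Rightarrow> nat \<Rightarrow> (nat \<Rightarrow> nat) \<Rightarrow> superpoly" where
  "power_prod k j p \<gamma> = prod_list (map (\<lambda>c. svar k c 1 ^ \<gamma> c) [p..<Suc (k + j)])"

lemma firsts_eq_power_prods:
  assumes "1 \<le> p"
  shows "{firsts k cs | cs. admissible k j cs \<and> (\<forall>c\<in>set cs. p \<le> c) \<and> length cs \<le> m}
    = power_prod k j p ` exponents k j p m"
proof (intro equalityI subsetI)
  fix f assume "f \<in> power_prod k j p ` exponents k j p m"
  then obtain \<gamma> where \<gamma>: "f = power_prod k j p \<gamma>" "\<gamma> \<in> exponents k j p m"
    by blast
  let ?cs = "blocks \<gamma> [p..<Suc (k + j)]"
  have "length ?cs = sum \<gamma> {p..k + j}"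
    by (simp only: length_blocks interv_sum_list_conv_sum_set_nat set_upt atLeastLessThanSuc_atLeastAtMost)
  then have "admissible k j ?cs \<and> (\<forall>c\<in>set ?cs. p \<le> c) \<and> length ?cs \<le> m"
    using \<gamma>(2) assms unfolding admissible_def exponents_def
    by (auto simp: set_blocks sorted_blocks distinct_filter_blocks simp del: upt_Suc)
  then show "f \<in> {firsts k cs | cs. admissible k j cs \<and> (\<forall>c\<in>set cs. p \<le> c) \<and> length cs \<le> m}"
    unfolding \<gamma>(1) power_prod_def firsts_blocks[symmetric] by blast
next
  fix f assume "f \<in> {firsts k cs | cs. admissible k j cs \<and> (\<forall>c\<in>set cs. p \<le> c) \<and> length cs \<le> m}"
  then obtain cs where cs: "f = firsts k cs" "admissible k j cs" "\<forall>c\<in>set cs. p \<le> c" "length cs \<le> m"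
    by blast
  let ?\<gamma> = "count (mset cs)"
  have "mset (blocks ?\<gamma> [p..<Suc (k + j)]) = mset cs"
  proof (rule multiset_eqI)
    fix c
    have "?\<gamma> c = 0" if "c \<notin> set [p..<Suc (k + j)]"
      using that cs(2,3) by (auto simp: admissible_def count_eq_zero_iff subset_iff simp del: upt_Suc)
    then show "count (mset (blocks ?\<gamma> [p..<Suc (k + j)])) c = ?\<gamma> c"
      by (simp add: count_blocks del: upt_Suc)
  qed
  then have eq: "blocks ?\<gamma> [p..<Suc (k + j)] = cs"
    using cs(2) properties_for_sort sorted_blocks sorted_upt unfolding admissible_def by metis
  have "sum ?\<gamma> {p..k + j} = length cs"
    using arg_cong[OF eq, of length]
    by (simp only: length_blocks interv_sum_list_conv_sum_set_nat set_upt atLeastLessThanSuc_atLeastAtMost)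
  moreover have "?\<gamma> c \<le> 1" if "k < c" for c
  proof -
    have "?\<gamma> c = count (mset (filter (\<lambda>c. k < c) cs)) c"
      using that by simp
    also have "\<dots> \<le> 1"
      using cs(2) unfolding admissible_def by (auto simp: distinct_count_atmost_1)
    finally show ?thesis .
  qed
  ultimately have "?\<gamma> \<in> exponents k j p m"
    using cs(4) by (simp add: exponents_def)
  moreover have "f = power_prod k j p ?\<gamma>"
    by (simp only: cs(1) power_prod_def firsts_blocks[symmetric] eq)
  ultimately show "f \<in> power_prod k j p ` exponents k j p m"
    by blast
qed

lemma upt_shift: "map (\<lambda>b. b + k) [p..<q] = [p + k..<q + k]"
  by (induction q) auto

text \<open>The label \<open>b + k\<close> becomes the fermionic copy \<open>b\<close>.  There is no copy \<open>0\<close>, and \<open>\<beta> 0\<close> is set to \<open>0\<close> in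
  order to respect the bound on \<open>\<beta>\<close>.\<close>

lemma power_prods_eq_bos_fer:
  assumes "p \<le> Suc k"
  shows "power_prod k j p ` exponents k j p m = {bos_prod p k \<alpha> * fer_prod 1 j \<beta> | \<alpha> \<beta>.
    range \<beta> \<subseteq> {0, 1} \<and> (\<Sum>l=p..k. \<alpha> l) + (\<Sum>l=1..j. \<beta> l) \<le> m}"
proof -
  have upt: "[p..<Suc (k + j)] = [p..<Suc k] @ map (\<lambda>b. b + k) [1..<Suc j]"
  proof -
    have "[p..<Suc k + j] = [p..<Suc k] @ [Suc k..<Suc k + j]"
      using assms by (rule upt_add_eq_append)
    moreover have "[Suc k..<Suc k + j] = map (\<lambda>b. b + k) [1..<Suc j]"
      using upt_shift[of k 1 "Suc j"] by (simp add: add.commute del: upt_Suc)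
    ultimately show ?thesis
      by simp
  qed
  have prod: "power_prod k j p \<gamma> = bos_prod p k \<alpha> * fer_prod 1 j \<beta>"
    if "\<And>c. c \<le> k \<Longrightarrow> \<gamma> c = \<alpha> c" "\<And>b. 1 \<le> b \<Longrightarrow> \<gamma> (b + k) = \<beta> b" for \<gamma> \<alpha> \<beta>
  proof -
    have "map (\<lambda>c. svar k c 1 ^ \<gamma> c) [p..<Suc k] = map (\<lambda>i. bos i 1 ^ \<alpha> i) [p..<Suc k]"
      "map ((\<lambda>c. svar k c 1 ^ \<gamma> c) \<circ> (\<lambda>b. b + k)) [1..<Suc j] = map (\<lambda>i. fer i 1 ^ \<beta> i) [1..<Suc j]"
      using that by (auto simp: svar_def simp del: upt_Suc)
    then show ?thesis
      by (simp only: power_prod_def upt map_append map_map prod_list.append bos_prod_def fer_prod_def)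
  qed
  have sum: "sum \<gamma> {p..k + j} = sum \<alpha> {p..k} + sum \<beta> {1..j}"
    if "\<And>c. c \<le> k \<Longrightarrow> \<gamma> c = \<alpha> c" "\<And>b. 1 \<le> b \<Longrightarrow> \<gamma> (b + k) = \<beta> b" for \<gamma> \<alpha> \<beta> :: "nat \<Rightarrow> nat"
  proof -
    have "sum \<gamma> {p..k + j} = sum \<gamma> {p..k} + sum \<gamma> {Suc k..k + j}"
      using assms by (subst sum.union_disjoint[symmetric]) (auto intro!: sum.cong)
    also have "sum \<gamma> {Suc k..k + j} = (\<Sum>b=1..j. \<gamma> (b + k))"
      using sum.shift_bounds_cl_nat_ivl[of \<gamma> 1 k j] by (simp add: add.commute)
    finally show ?thesis
      using that by simp
  qed
  show ?thesis
  proof (intro equalityI subsetI)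
    fix f assume "f \<in> power_prod k j p ` exponents k j p m"
    then obtain \<gamma> where \<gamma>: "f = power_prod k j p \<gamma>" "\<gamma> \<in> exponents k j p m"
      by blast
    let ?\<beta> = "\<lambda>b. if b = 0 then 0 else \<gamma> (b + k)"
    have "range ?\<beta> \<subseteq> {0, 1}"
      using \<gamma>(2) by (auto simp: exponents_def image_subset_iff)
        (metis One_nat_def Suc_leI le_antisym less_add_same_cancel2 neq0_conv)
    moreover have "(\<Sum>l=p..k. \<gamma> l) + (\<Sum>l=1..j. ?\<beta> l) \<le> m"
      using \<gamma>(2) sum[of \<gamma> \<gamma> ?\<beta>] by (simp add: exponents_def)
    ultimately show "f \<in> {bos_prod p k \<alpha> * fer_prod 1 j \<beta> | \<alpha> \<beta>.
        range \<beta> \<subseteq> {0, 1} \<and> (\<Sum>l=p..k. \<alpha> l) + (\<Sum>l=1..j. \<beta> l) \<le> m}"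
      unfolding \<gamma>(1) using prod[of \<gamma> \<gamma> ?\<beta>] by fastforce
  next
    fix f assume "f \<in> {bos_prod p k \<alpha> * fer_prod 1 j \<beta> | \<alpha> \<beta>.
        range \<beta> \<subseteq> {0, 1} \<and> (\<Sum>l=p..k. \<alpha> l) + (\<Sum>l=1..j. \<beta> l) \<le> m}"
    then obtain \<alpha> \<beta> where f: "f = bos_prod p k \<alpha> * fer_prod 1 j \<beta>" and \<beta>: "range \<beta> \<subseteq> {0, 1}"
      and le: "(\<Sum>l=p..k. \<alpha> l) + (\<Sum>l=1..j. \<beta> l) \<le> m"
      by blast
    let ?\<gamma> = "\<lambda>c. if c \<le> k then \<alpha> c else \<beta> (c - k)"
    have "\<beta> b \<le> 1" for b
      using \<beta> by (metis empty_iff insert_iff le_numeral_extra(4) less_eq_nat.simps(1) rangeI subsetD)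
    then have "?\<gamma> \<in> exponents k j p m"
      using le sum[of ?\<gamma> \<alpha> \<beta>] by (simp add: exponents_def)
    moreover have "f = power_prod k j p ?\<gamma>"
      using prod[of ?\<gamma> \<alpha> \<beta>] f by simp
    ultimately show "f \<in> power_prod k j p ` exponents k j p m"
      by blast
  qed
qed

lemma power_prods_eq_fer:
  "power_prod k j (k + p) ` exponents k j (k + p) m = {fer_prod p j \<beta> | \<beta>.
    range \<beta> \<subseteq> {0, 1} \<and> (\<Sum>l=p..j. \<beta> l) \<le> m}" if "1 \<le> p"
proof -
  have upt: "[k + p..<Suc (k + j)] = map (\<lambda>b. b + k) [p..<Suc j]"
    using upt_shift[of k p "Suc j"] by (simp add: add.commute del: upt_Suc)
  have prod: "power_prod k j (k + p) \<gamma> = fer_prod p j \<beta>" if "\<And>b. p \<le> b \<Longrightarrow> \<gamma> (b + k) = \<beta> b" for \<gamma> \<beta>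
  proof -
    have "map ((\<lambda>c. svar k c 1 ^ \<gamma> c) \<circ> (\<lambda>b. b + k)) [p..<Suc j] = map (\<lambda>i. fer i 1 ^ \<beta> i) [p..<Suc j]"
      using that \<open>1 \<le> p\<close> by (auto simp: svar_def simp del: upt_Suc)
    then show ?thesis
      by (simp only: power_prod_def upt map_map fer_prod_def)
  qed
  have sum: "sum \<gamma> {k + p..k + j} = sum \<beta> {p..j}" if "\<And>b. p \<le> b \<Longrightarrow> \<gamma> (b + k) = \<beta> b" for \<gamma> \<beta> :: "nat \<Rightarrow> nat"
    using sum.shift_bounds_cl_nat_ivl[of \<gamma> p k j] that by (simp add: add.commute)
  show ?thesis
  proof (intro equalityI subsetI)
    fix f assume "f \<in> power_prod k j (k + p) ` exponents k j (k + p) m"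
    then obtain \<gamma> where \<gamma>: "f = power_prod k j (k + p) \<gamma>" "\<gamma> \<in> exponents k j (k + p) m"
      by blast
    let ?\<beta> = "\<lambda>b. if b = 0 then 0 else \<gamma> (b + k)"
    have "range ?\<beta> \<subseteq> {0, 1}"
      using \<gamma>(2) by (auto simp: exponents_def image_subset_iff)
        (metis One_nat_def Suc_leI le_antisym less_add_same_cancel2 neq0_conv)
    moreover have "(\<Sum>l=p..j. ?\<beta> l) \<le> m"
      using \<gamma>(2) sum[of \<gamma> ?\<beta>] \<open>1 \<le> p\<close> by (simp add: exponents_def)
    ultimately show "f \<in> {fer_prod p j \<beta> | \<beta>. range \<beta> \<subseteq> {0, 1} \<and> (\<Sum>l=p..j. \<beta> l) \<le> m}"
      unfolding \<gamma>(1) using prod[of \<gamma> ?\<beta>] \<open>1 \<le> p\<close> by fastforce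
  next
    fix f assume "f \<in> {fer_prod p j \<beta> | \<beta>. range \<beta> \<subseteq> {0, 1} \<and> (\<Sum>l=p..j. \<beta> l) \<le> m}"
    then obtain \<beta> where f: "f = fer_prod p j \<beta>" and \<beta>: "range \<beta> \<subseteq> {0, 1}" and le: "(\<Sum>l=p..j. \<beta> l) \<le> m"
      by blast
    let ?\<gamma> = "\<lambda>c. if c \<le> k then 0 else \<beta> (c - k)"
    have "\<beta> b \<le> 1" for b
      using \<beta> by (metis empty_iff insert_iff le_numeral_extra(4) less_eq_nat.simps(1) rangeI subsetD)
    then have "?\<gamma> \<in> exponents k j (k + p) m"
      using le sum[of ?\<gamma> \<beta>] \<open>1 \<le> p\<close> by (simp add: exponents_def)
    moreover have "f = power_prod k j (k + p) ?\<gamma>"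
      using prod[of ?\<gamma> \<beta>] f \<open>1 \<le> p\<close> by simp
    ultimately show "f \<in> power_prod k j (k + p) ` exponents k j (k + p) m"
      by blast
  qed
qed

lemma admissible_Cons:
  "admissible k j (i # cs) \<longleftrightarrow> i \<in> {1..k + j} \<and> admissible k j cs \<and>
     (\<forall>c\<in>set cs. (if i \<le> k then i else Suc i) \<le> c)"
proof (cases "i \<le> k")
  case True
  then show ?thesis
    by (auto simp: admissible_def)
next
  case False
  have least: "(\<forall>c\<in>set cs. i \<le> c) \<and> i \<notin> set cs \<longleftrightarrow> (\<forall>c\<in>set cs. Suc i \<le> c)"
  proof -
    have "Suc i \<le> c \<longleftrightarrow> i \<le> c \<and> i \<noteq> c" for c
      by linarith
    then show ?thesis
      by (simp only:) blast
  qed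
  have sorted: "sorted (i # cs) \<longleftrightarrow> (\<forall>c\<in>set cs. i \<le> c) \<and> sorted cs"
    by simp
  have distinct: "distinct (filter (\<lambda>c. k < c) (i # cs)) \<longleftrightarrow> i \<notin> set cs \<and> distinct (filter (\<lambda>c. k < c) cs)"
    using False by simp
  have range: "set (i # cs) \<subseteq> {1..k + j} \<longleftrightarrow> i \<in> {1..k + j} \<and> set cs \<subseteq> {1..k + j}"
    by simp
  show ?thesis
    by (simp only: admissible_def sorted distinct range if_not_P[OF False] least[symmetric]) blast
qed

lemma image_setcompr:
  "h ` {g x | x. P x} = {h (g x) | x. P x}" "h ` {g' x y | x y. Q x y} = {h (g' x y) | x y. Q x y}"
  by blast+

lemma dihedral_basis_eq: "dihedral_basis n k j = coinv_basis n k j"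
proof -
  let ?F = "\<lambda>p. {firsts k cs | cs. admissible k j cs \<and> (\<forall>c\<in>set cs. p \<le> c) \<and> length cs \<le> n - 1}"
  have first: "{firsts k cs | cs. admissible k j cs \<and> length cs \<le> n - 1} =
      {bos_prod 1 k \<alpha> * fer_prod 1 j \<beta> | \<alpha> \<beta>. range \<beta> \<subseteq> {0, 1} \<and>
        (\<Sum>l=1..k. \<alpha> l) + (\<Sum>l=1..j. \<beta> l) \<le> n - 1}"
  proof -
    have "{firsts k cs | cs. admissible k j cs \<and> length cs \<le> n - 1} = ?F 1"
      unfolding admissible_def by fastforce
    then show ?thesis
      by (simp only: firsts_eq_power_prods[OF order_refl] power_prods_eq_bos_fer[of 1 k] le_add1 plus_1_eq_Suc[symmetric])
  qed
  have bos: "{firsts k cs * svar k i 2 | cs. admissible k j (i # cs) \<and> length cs \<le> n - 1} =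
      {bos_prod i k \<alpha> * fer_prod 1 j \<beta> * bos i 2 | \<alpha> \<beta>. range \<beta> \<subseteq> {0, 1} \<and>
        (\<Sum>l=i..k. \<alpha> l) + (\<Sum>l=1..j. \<beta> l) \<le> n - 1}" if "i \<in> {1..k}" for i
  proof -
    have "{firsts k cs * svar k i 2 | cs. admissible k j (i # cs) \<and> length cs \<le> n - 1}
        = (\<lambda>f. f * bos i 2) ` ?F i"
      using that by (auto simp: admissible_Cons svar_def)
    also have "?F i = {bos_prod i k \<alpha> * fer_prod 1 j \<beta> | \<alpha> \<beta>.
        range \<beta> \<subseteq> {0, 1} \<and> (\<Sum>l=i..k. \<alpha> l) + (\<Sum>l=1..j. \<beta> l) \<le> n - 1}"
      using that by (subst firsts_eq_power_prods) (auto simp: power_prods_eq_bos_fer)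
    finally show ?thesis
      by (simp only: image_setcompr)
  qed
  have fer: "{firsts k cs * svar k (k + i) 2 | cs. admissible k j ((k + i) # cs) \<and> length cs \<le> n - 1} =
      {fer_prod (i + 1) j \<beta> * fer i 2 | \<beta>. range \<beta> \<subseteq> {0, 1} \<and>
        (\<Sum>l=i+1..j. \<beta> l) \<le> n - 1}" if "i \<in> {1..j}" for i
  proof -
    have "{firsts k cs * svar k (k + i) 2 | cs. admissible k j ((k + i) # cs) \<and> length cs \<le> n - 1}
        = (\<lambda>f. f * fer i 2) ` ?F (k + (i + 1))"
      using that by (auto simp: admissible_Cons svar_def)
    also have "?F (k + (i + 1)) = {fer_prod (i + 1) j \<beta> | \<beta>.
        range \<beta> \<subseteq> {0, 1} \<and> (\<Sum>l=i+1..j. \<beta> l) \<le> n - 1}"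
      by (subst firsts_eq_power_prods, simp, rule power_prods_eq_fer, simp)
    finally show ?thesis
      by (simp only: image_setcompr)
  qed
  have "{firsts k cs * svar k i 2 | cs i. admissible k j (i # cs) \<and> length cs \<le> n - 1} =
      (\<Union>i\<in>{1..k + j}. {firsts k cs * svar k i 2 | cs. admissible k j (i # cs) \<and> length cs \<le> n - 1})"
  proof -
    have "i \<in> {1..k + j}" if "admissible k j (i # cs)" for i cs
      using that by (simp only: admissible_Cons)
    then show ?thesis
      by blast
  qed
  also have "{1..k + j} = {1..k} \<union> (\<lambda>i. k + i) ` {1..j}"
  proof -
    have "(\<lambda>i. k + i) ` {1..j} = {Suc k..k + j}"
      using image_add_atLeastAtMost[of k 1 j] by (simp add: add.commute)
    then show ?thesis
      by auto
  qed
  finally have mixed: "{firsts k cs * svar k i 2 | cs i. admissible k j (i # cs) \<and> length cs \<le> n - 1} =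
      (\<Union>i\<in>{1..k}. {bos_prod i k \<alpha> * fer_prod 1 j \<beta> * bos i 2 | \<alpha> \<beta>. range \<beta> \<subseteq> {0, 1} \<and>
        (\<Sum>l=i..k. \<alpha> l) + (\<Sum>l=1..j. \<beta> l) \<le> n - 1})
     \<union> (\<Union>i\<in>{1..j}. {fer_prod (i + 1) j \<beta> * fer i 2 | \<beta>. range \<beta> \<subseteq> {0, 1} \<and>
        (\<Sum>l=i+1..j. \<beta> l) \<le> n - 1})"
    by (simp only: UN_Un image_image SUP_image o_def)
      (intro arg_cong2[where f = "(\<union>)"] SUP_cong refl bos fer)
  have quadratic: "{firsts k [h] * svar k i 2 | h i. 1 \<le> h \<and> h \<le> i \<and> i \<le> k + j \<and> (h < i \<or> k < h)} =
      {bos h 1 * bos i 2 | h i. 1 \<le> h \<and> h < i \<and> i \<le> k}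
     \<union> {bos h 1 * fer i 2 | h i. 1 \<le> h \<and> h \<le> k \<and> 1 \<le> i \<and> i \<le> j}
     \<union> {fer h 1 * fer i 2 | h i. 1 \<le> h \<and> h \<le> i \<and> i \<le> j}" (is "?L = ?A \<union> ?B \<union> ?C")
  proof (intro equalityI subsetI)
    fix f assume "f \<in> ?L"
    then obtain h i where f: "f = svar k h 1 * svar k i 2" "1 \<le> h" "h \<le> i" "i \<le> k + j" "h < i \<or> k < h"
      by auto
    consider "i \<le> k" | "h \<le> k" "k < i" | "k < h"
      by linarith
    then show "f \<in> ?A \<union> ?B \<union> ?C"
    proof cases
      case 1
      then have "f \<in> ?A"
        using f by (intro CollectI exI[of _ h] exI[of _ i]) (auto simp: svar_def)
      then show ?thesis
        by blast
    next
      case 2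
      then have "f \<in> ?B"
        using f by (intro CollectI exI[of _ h] exI[of _ "i - k"]) (auto simp: svar_def)
      then show ?thesis
        by blast
    next
      case 3
      then have "f \<in> ?C"
        using f by (intro CollectI exI[of _ "h - k"] exI[of _ "i - k"]) (auto simp: svar_def)
      then show ?thesis
        by blast
    qed
  next
    have L: "svar k h 1 * svar k i 2 \<in> ?L" if "1 \<le> h" "h \<le> i" "i \<le> k + j" "h < i \<or> k < h" for h i
      using that by (intro CollectI exI[of _ h] exI[of _ i]) auto
    fix f assume "f \<in> ?A \<union> ?B \<union> ?C"
    then consider "f \<in> ?A" | "f \<in> ?B" | "f \<in> ?C"
      by blast
    then show "f \<in> ?L"
    proof cases
      case 1
      then obtain h i where "f = bos h 1 * bos i 2" "1 \<le> h" "h < i" "i \<le> k"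
        by blast
      then show ?thesis
        using L[of h i] by (simp add: svar_def)
    next
      case 2
      then obtain h i where "f = bos h 1 * fer i 2" "1 \<le> h" "h \<le> k" "1 \<le> i" "i \<le> j"
        by blast
      then show ?thesis
        using L[of h "k + i"] by (simp add: svar_def)
    next
      case 3
      then obtain h i where "f = fer h 1 * fer i 2" "1 \<le> h" "h \<le> i" "i \<le> j"
        by blast
      then show ?thesis
        using L[of "k + h" "k + i"] by (simp add: svar_def)
    qed
  qed
  show ?thesis
    unfolding dihedral_basis_def coinv_basis_def first mixed quadratic by (simp only: Un_assoc)
qed

lemma finite_coinv_basis: "finite (coinv_basis n k j)"
proof -
  let ?L = "{cs. set cs \<subseteq> {1..k + j} \<and> length cs \<le> n}"
  have "finite ?L"
    by (rule finite_lists_length_le) simp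
  moreover have "coinv_basis n k j \<subseteq> firsts k ` ?L \<union> (\<lambda>(cs, i). firsts k cs * svar k i 2) ` (?L \<times> {1..k + j})
      \<union> (\<lambda>(h, i). firsts k [h] * svar k i 2) ` ({1..k + j} \<times> {1..k + j})"
  proof
    fix b assume "b \<in> coinv_basis n k j"
    then show "b \<in> firsts k ` ?L \<union> (\<lambda>(cs, i). firsts k cs * svar k i 2) ` (?L \<times> {1..k + j})
      \<union> (\<lambda>(h, i). firsts k [h] * svar k i 2) ` ({1..k + j} \<times> {1..k + j})"
    proof (cases rule: coinv_basis_cases)
      case (first cs)
      then show ?thesis
        by (auto simp: admissible_def)
    next
      case (mixed cs i)
      then have "(cs, i) \<in> ?L \<times> {1..k + j}"
        by (auto simp: admissible_def)
      then have "b \<in> (\<lambda>(cs, i). firsts k cs * svar k i 2) ` (?L \<times> {1..k + j})"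
        unfolding mixed(1) by (rule rev_image_eqI) simp
      then show ?thesis
        by blast
    next
      case (quadratic h i)
      then have "(h, i) \<in> {1..k + j} \<times> {1..k + j}"
        by auto
      then have "b \<in> (\<lambda>(h, i). firsts k [h] * svar k i 2) ` ({1..k + j} \<times> {1..k + j})"
        unfolding quadratic(1) by (rule rev_image_eqI) simp
      then show ?thesis
        by blast
    qed
  qed
  ultimately show ?thesis
    by (meson finite_SigmaI finite_UnI finite_atLeastAtMost finite_imageI finite_subset)
qed

lemma svar_in_super_vars: "c \<in> {1..k + j} \<Longrightarrow> svar k c s \<in> super_vars k j"
  by (cases "c \<le> k") (force simp: svar_def super_vars_def)+

lemma coinv_basis_monomials: "coinv_basis n k j \<subseteq> monomials k j"
proof
  fix b assume "b \<in> coinv_basis n k j"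
  have F: "firsts k cs = prod_list (map (\<lambda>c. svar k c 1) cs)" for cs
    by (induction cs) simp_all
  have M: "firsts k cs * svar k i 2 \<in> monomials k j" if "set (i # cs) \<subseteq> {1..k + j}" for cs i
  proof -
    have "firsts k cs * svar k i 2 = prod_list (map (\<lambda>c. svar k c 1) cs @ [svar k i 2])"
      by (simp add: F)
    moreover have "set (map (\<lambda>c. svar k c 1) cs @ [svar k i 2]) \<subseteq> super_vars k j"
      using that svar_in_super_vars by auto
    ultimately show ?thesis
      unfolding monomials_def by blast
  qed
  show "b \<in> monomials k j"
    using \<open>b \<in> coinv_basis n k j\<close>
  proof (cases rule: coinv_basis_cases)
    case (first cs)
    have "set (map (\<lambda>c. svar k c 1) cs) \<subseteq> super_vars k j"
      using first svar_in_super_vars by (auto simp: admissible_def)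
    then show ?thesis
      unfolding first(1) F monomials_def by blast
  next
    case (mixed cs i)
    then show ?thesis
      by (auto simp: admissible_def intro!: M)
  next
    case (quadratic h i)
    then show ?thesis
      unfolding quadratic(1) by (intro M) auto
  qed
qed

section \<open>The coinvariant ideal\<close>

lemma super_ring_simps [simp]:
  "x \<otimes>\<^bsub>super_ring k j\<^esub> y = x * y" "x \<oplus>\<^bsub>super_ring k j\<^esub> y = x + y"
  "\<one>\<^bsub>super_ring k j\<^esub> = 1" "\<zero>\<^bsub>super_ring k j\<^esub> = 0"
  by (simp_all add: super_ring_def ring_of_type_algebra_def)

lemma carrier_super_ring:
  "carrier (super_ring k j) = {f. support_in {v. copy v \<in> {1..k}} {v. copy v \<in> {1..j}} f}"
proof -
  have *: "A \<in> Poly_Mapping.keys (coeffs f) \<longleftrightarrow> (\<exists>m. scoeff f m A \<noteq> 0)" for A f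
    unfolding in_keys_iff scoeff_def by (metis lookup_zero poly_mapping_eqI)
  have **: "m \<in> Poly_Mapping.keys (gcoeff f A) \<longleftrightarrow> scoeff f m A \<noteq> 0" for m A f
    by (simp add: in_keys_iff scoeff_def)
  have "f \<in> carrier (super_ring k j) \<longleftrightarrow> (\<forall>A. (\<exists>m. scoeff f m A \<noteq> 0) \<longrightarrow> (\<forall>v. v |\<in>| A \<longrightarrow> copy v \<in> {1..j}) \<and>
      (\<forall>m. scoeff f m A \<noteq> 0 \<longrightarrow> (\<forall>v\<in>Poly_Mapping.keys m. copy v \<in> {1..k})))" for f
    by (simp add: super_ring_def ring_of_type_algebra_def Ball_def * **)
  then show ?thesis
    unfolding support_in_def by (simp only: set_eq_iff mem_Collect_eq subset_iff) blast
qed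

lemma support_in_sconst: "support_in V U (sconst c)"
  by (simp add: support_in_def scoeff_sconst when_def)

lemma support_in_uminus: "support_in V U f \<Longrightarrow> support_in V U (- f)"
  by (simp add: support_in_def)

lemma support_in_add:
  assumes "support_in V U f" "support_in V U h"
  shows "support_in V U (f + h)"
  unfolding support_in_def
proof (intro allI impI)
  fix m A assume "scoeff (f + h) m A \<noteq> 0"
  then have "scoeff f m A \<noteq> 0 \<or> scoeff h m A \<noteq> 0"
    by auto
  then show "Poly_Mapping.keys m \<subseteq> V \<and> fset A \<subseteq> U"
    using assms unfolding support_in_def by blast
qed

lemma support_in_mult:
  assumes "support_in V U f" "support_in V U h"
  shows "support_in V U (f * h)"
  unfolding support_in_def
proof (intro allI impI)
  fix m A assume "scoeff (f * h) m A \<noteq> 0"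
  then obtain m1 m2 A1 A2 where "m = m1 + m2" "A = A1 |\<union>| A2" "scoeff f m1 A1 \<noteq> 0" "scoeff h m2 A2 \<noteq> 0"
    by (rule scoeff_mult_nonzero)
  moreover from this assms have "Poly_Mapping.keys m1 \<union> Poly_Mapping.keys m2 \<subseteq> V" "fset A1 \<union> fset A2 \<subseteq> U"
    unfolding support_in_def by (simp_all only: Un_least)
  ultimately show "Poly_Mapping.keys m \<subseteq> V \<and> fset A \<subseteq> U"
    using keys_add[of m1 m2] by (simp only: union_fset) (meson order_trans)
qed

lemma svar_in_super_ring:
  assumes "c \<in> {1..k + j}"
  shows "svar k c s \<in> carrier (super_ring k j)"
proof (cases "c \<le> k")
  case True
  have "scoeff (svar k c s) m A = (1 when m = Poly_Mapping.single (Idx c s) 1 \<and> A = {||})" for m A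
    using True by (auto simp: svar_def bos_def scoeff_def gcoeff_gconst bvar_def lookup_single when_def)
  then show ?thesis
    using True assms by (simp add: carrier_super_ring support_in_def when_def)
next
  case False
  have "scoeff (svar k c s) m A = (1 when m = 0 \<and> A = {|Idx (c - k) s|})" for m A
    using False by (auto simp: svar_def fer_def scoeff_def gcoeff_ggen when_def lookup_one)
  then show ?thesis
    using False assms by (auto simp: carrier_super_ring support_in_def when_def)
qed

lemma ring_super_ring: "ring (super_ring k j)"
proof (rule ringI)
  let ?R = "super_ring k j"
  define s where "s = support_in {v. copy v \<in> {1..k}} {v. copy v \<in> {1..j}}"
  have R: "carrier ?R = {f. s f}"
    by (simp only: carrier_super_ring s_def)
  have closed: "s 0" "s 1" "s f \<Longrightarrow> s h \<Longrightarrow> s (f + h)" "s f \<Longrightarrow> s h \<Longrightarrow> s (f * h)" for f h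
    using support_in_sconst[of _ _ 0] support_in_sconst[of _ _ 1] support_in_add support_in_mult
    by (auto simp only: s_def sconst_simps)
  have inv: "\<exists>h. s h \<and> f + h = 0" if "s f" for f
    using that support_in_uminus[of _ _ f] by (intro exI[of _ "- f"]) (simp only: s_def right_minus simp_thms)
  show "abelian_group ?R"
    by (rule abelian_groupI) (simp_all add: R closed inv add_ac)
  show "monoid ?R"
    by (rule monoidI) (simp_all add: R closed mult.assoc)
qed (simp_all add: distrib_left distrib_right)

lemma a_inv_super_ring:
  assumes "f \<in> carrier (super_ring k j)"
  shows "\<ominus>\<^bsub>super_ring k j\<^esub> f = - f"
proof -
  interpret ring "super_ring k j"
    by (rule ring_super_ring)
  show ?thesis
    using assms support_in_uminus by (intro minus_equality) (auto simp: carrier_super_ring)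
qed

lemma ideal_functional_kernel: "ideal (functional_kernel n \<inter> carrier (super_ring k j)) (super_ring k j)"
proof -
  interpret R: ring "super_ring k j"
    by (rule ring_super_ring)
  have uminus: "- f \<in> functional_kernel n" if "f \<in> functional_kernel n" for f
    using functional_kernel_mult(1)[OF that, of "- 1"] by simp
  show ?thesis
  proof (rule idealI[OF ring_super_ring])
    show "subgroup (functional_kernel n \<inter> carrier (super_ring k j)) (add_monoid (super_ring k j))"
    proof (rule R.add.subgroupI)
      show "functional_kernel n \<inter> carrier (super_ring k j) \<noteq> {}"
        using functional_kernel_0 R.zero_closed by auto
      fix f assume f: "f \<in> functional_kernel n \<inter> carrier (super_ring k j)"
      then show "\<ominus>\<^bsub>super_ring k j\<^esub> f \<in> functional_kernel n \<inter> carrier (super_ring k j)"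
        using R.a_inv_closed[of f] uminus by (simp add: a_inv_super_ring)
      fix h assume "h \<in> functional_kernel n \<inter> carrier (super_ring k j)"
      with f show "f \<oplus>\<^bsub>super_ring k j\<^esub> h \<in> functional_kernel n \<inter> carrier (super_ring k j)"
        using R.a_closed[of f h] functional_kernel_add by simp
    qed simp
  next
    fix f h assume f: "f \<in> functional_kernel n \<inter> carrier (super_ring k j)" and h: "h \<in> carrier (super_ring k j)"
    show "h \<otimes>\<^bsub>super_ring k j\<^esub> f \<in> functional_kernel n \<inter> carrier (super_ring k j)"
      "f \<otimes>\<^bsub>super_ring k j\<^esub> h \<in> functional_kernel n \<inter> carrier (super_ring k j)"
      using f R.m_closed[OF h, of f] R.m_closed[OF _ h, of f] functional_kernel_mult by auto
  qed
qed

lemma group_GL2: "group GL2"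
proof (rule groupI)
  fix A assume "A \<in> carrier GL2"
  then obtain B where "A ** B = mat 1" "B ** A = mat 1"
    by (auto simp: GL2_def invertible_def)
  then show "\<exists>B\<in>carrier GL2. B \<otimes>\<^bsub>GL2\<^esub> A = \<one>\<^bsub>GL2\<^esub>"
    by (auto simp: GL2_def invertible_def)
next
  show "\<one>\<^bsub>GL2\<^esub> \<in> carrier GL2"
    using matrix_mul_lid[of "mat 1 :: complex^2^2"] by (auto simp: GL2_def invertible_def)
qed (auto simp: GL2_def matrix_mul_assoc intro: invertible_mult)

lemma cos_sin_unit:
  "of_real (cos t) * of_real (cos t) + of_real (sin t) * of_real (sin t) = (1 :: complex)"
  "of_real (sin t) * of_real (sin t) + of_real (cos t) * of_real (cos t) = (1 :: complex)"
  by (simp_all add: sin_cos_squared_add3 add.commute flip: of_real_mult of_real_add)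

lemma rho_phi_invertible: "invertible (rho n)" "invertible phi"
proof -
  define B :: "complex^2^2" where "B = transpose (rho n)"
  have "rho n ** B = mat 1" "B ** rho n = mat 1"
    by (intro matrix_2_eqI; simp add: B_def matrix_mult_2 transpose_def matrix_entries mat_def cos_sin_unit)+
  then show "invertible (rho n)"
    unfolding invertible_def by blast
  have "phi ** phi = mat 1"
    by (intro matrix_2_eqI) (simp_all add: matrix_mult_2 matrix_entries mat_def)
  then show "invertible phi"
    unfolding invertible_def by blast
qed

lemma act_mat_1: "act (mat 1) f = f"
  by (rule superpoly_eqI) (simp add: act_scalar)

text \<open>The matrices that fix \<open>f\<close> and are invertible form a group.\<close>

lemma act_dihedral:
  assumes "act (rho n) f = f" "act phi f = f" "g \<in> dihedral n"
  shows "act g f = f"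
proof -
  interpret group GL2
    by (rule group_GL2)
  have carr: "h \<in> carrier GL2" "act h f = f" if "h \<in> {rho n, phi}" for h
    using that assms rho_phi_invertible by (auto simp: GL2_def)
  show ?thesis
    using assms(3) unfolding dihedral_def
  proof induction
    case one
    then show ?case
      by (simp add: GL2_def act_mat_1)
  next
    case (incl h)
    then show ?case
      using carr by blast
  next
    case (inv h)
    have "inv\<^bsub>GL2\<^esub> h ** h = mat 1"
      using l_inv[OF carr(1)[OF inv]] by (simp add: GL2_def)
    then show ?case
      using carr(2)[OF inv] act_act[of "inv\<^bsub>GL2\<^esub> h" h f] act_mat_1 by simp
  next
    case (eng g h)
    then show ?case
      by (simp add: GL2_def act_act[symmetric])
  qed
qed

lemma ideal_coinv_ideal: "ideal (coinv_ideal n k j) (super_ring k j)"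
  unfolding coinv_ideal_def by (rule ring.genideal_ideal[OF ring_super_ring]) blast

lemma coinv_ideal_functional_kernel:
  assumes "n \<ge> 2"
  shows "coinv_ideal n k j \<subseteq> functional_kernel n"
proof -
  have gens: "rho n \<in> dihedral n" "phi \<in> dihedral n"
    unfolding dihedral_def by (auto intro: generate.incl)
  have "{f \<in> carrier (super_ring k j). (\<forall>g \<in> dihedral n. act g f = f) \<and> const_term f = 0}
      \<subseteq> functional_kernel n \<inter> carrier (super_ring k j)"
  proof (intro subsetI IntI)
    fix f assume f: "f \<in> {f \<in> carrier (super_ring k j). (\<forall>g \<in> dihedral n. act g f = f) \<and> const_term f = 0}"
    then show "f \<in> carrier (super_ring k j)"
      by simp
    show "f \<in> functional_kernel n"
      using f gens by (intro invariant_functional_kernel[OF assms]) simp_all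
  qed
  from ring.genideal_minimal[OF ring_super_ring ideal_functional_kernel this] show ?thesis
    unfolding coinv_ideal_def by blast
qed

lemma invariant_in_coinv_ideal:
  assumes "f \<in> carrier (super_ring k j)" "act (rho n) f = f" "act phi f = f" "scoeff f 0 {||} = 0"
  shows "f \<in> coinv_ideal n k j"
proof -
  let ?G = "{f \<in> carrier (super_ring k j). (\<forall>g \<in> dihedral n. act g f = f) \<and> const_term f = 0}"
  have "f \<in> ?G"
    using assms(1,4) act_dihedral[OF assms(2,3)] by (simp add: const_term_def scoeff_def)
  moreover have "?G \<subseteq> carrier (super_ring k j)"
    by (rule subsetI) simp
  from ring.genideal_self[OF ring_super_ring this] have "?G \<subseteq> coinv_ideal n k j"
    by (simp only: coinv_ideal_def)
  ultimately show ?thesis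
    by (rule rev_subsetD)
qed

definition rho_eigenvalue :: "nat \<Rightarrow> complex \<Rightarrow> complex" where
  "rho_eigenvalue n w = of_real (cos (2 * pi / real n)) - w * of_real (sin (2 * pi / real n))"

lemma rho_eigenvalue_power:
  assumes "n \<ge> 2" "w = \<i> \<or> w = - \<i>"
  shows "rho_eigenvalue n w ^ n = 1"
proof -
  have "rho_eigenvalue n w = cis (2 * pi / n) \<or> rho_eigenvalue n w = cis (- (2 * pi / n))"
    using assms(2) by (auto simp: rho_eigenvalue_def complex_eq_iff)
  moreover have "cis (2 * pi / n) ^ n = 1" "cis (- (2 * pi / n)) ^ n = 1"
    using assms(1) by (simp_all add: Complex.DeMoivre complex_eq_iff)
  ultimately show ?thesis
    by auto
qed

lemma rho_eigenvalue_mult: "rho_eigenvalue n \<i> * rho_eigenvalue n (- \<i>) = 1"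
  by (simp add: rho_eigenvalue_def algebra_simps cos_sin_unit)

lemma act_rho_eigenvar:
  assumes "w * w = - 1"
  shows "act (rho n) (eigenvar k w c) = sconst (rho_eigenvalue n w) * eigenvar k w c"
proof -
  let ?c = "of_real (cos (2 * pi / real n)) :: complex" and ?s = "of_real (sin (2 * pi / real n)) :: complex"
  have ww: "w * (w * z) = - z" for z
    by (simp add: assms mult.assoc[symmetric])
  have "act (rho n) (eigenvar k w c) =
      sconst (?c - w * ?s) * svar k c 1 + sconst (?s + w * ?c) * svar k c 2"
    by (simp add: eigenvar_def act_add act_sconst_mult act_svar matrix_entries sconst_mult algebra_simps)
  also have "?s + w * ?c = (?c - w * ?s) * w"
    by (simp add: algebra_simps ww)
  finally show ?thesis
    by (simp add: eigenvar_def rho_eigenvalue_def distrib_left sconst_mult mult.assoc)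
qed

lemma act_phi_eigenvar: "act phi (eigenvar k w c) = eigenvar k (- w) c"
  by (simp add: eigenvar_def act_add act_sconst_mult act_svar matrix_entries)

lemma act_rho_eigen_prod:
  assumes "w * w = - 1"
  shows "act (rho n) (eigen_prod k w cs) = sconst (rho_eigenvalue n w ^ length cs) * eigen_prod k w cs"
proof (induction cs)
  case (Cons c cs)
  then show ?case
    by (simp only: eigen_prod_simps act_mult act_rho_eigenvar[OF assms] sconst_mult_mult length_Cons power_Suc)
qed simp

lemma act_phi_eigen_prod: "act phi (eigen_prod k w cs) = eigen_prod k (- w) cs"
  by (induction cs) (simp_all add: act_mult act_phi_eigenvar)

lemma scoeff_eigenvar_const: "scoeff (eigenvar k w c) 0 {||} = 0"
  by (simp add: eigenvar_def svar_def scoeff_var_const)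

lemma quadric_eq_eigenvar:
  "eigenvar k \<i> a * eigenvar k (- \<i>) b + eigenvar k (- \<i>) a * eigenvar k \<i> b
    = sconst 2 * (svar k a 1 * svar k b 1 + svar k a 2 * svar k b 2)"
proof -
  have prod: "(f + sconst w * f') * (h + sconst v * h')
      = f * h + sconst v * (f * h') + sconst w * (f' * h) + sconst (w * v) * (f' * h')" for f f' h h' w v
    by (simp only: distrib_left distrib_right sconst_mult_mult mult_sconst_left[of f])
      (simp only: mult.assoc add_ac)
  have two: "sconst 2 * f = f + f" for f
    using sconst_simps(3)[of 1 1] by (simp add: mult_2)
  show ?thesis
    by (simp only: eigenvar_def prod two) simp
qed

definition combination :: "(superpoly \<Rightarrow> complex) \<Rightarrow> superpoly set \<Rightarrow> superpoly" where
  "combination c B = (\<Sum>b\<in>B. sconst (c b) * b)"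

lemma combination_simps:
  "combination (\<lambda>b. c b + d b) B = combination c B + combination d B"
  "combination (\<lambda>b. a * c b) B = sconst a * combination c B"
  by (simp_all add: combination_def distrib_right sum.distrib sconst_mult sum_distrib_left mult.assoc)

lemma combination_single: "finite B \<Longrightarrow> b \<in> B \<Longrightarrow> combination (\<lambda>b'. if b' = b then 1 else 0) B = b"
  by (simp add: combination_def if_distrib[of sconst] if_distrib[of "\<lambda>f. f * _"] cong: if_cong)

text \<open>The relations on which the reduction rests are invariants: \<open>u\<^sub>a v\<^sub>b + v\<^sub>a u\<^sub>b\<close>, because the eigenvalues of
  \<open>u\<close> and \<open>v\<close> are inverse to each other, and \<open>u \<cdots> u + v \<cdots> v\<close> in degree \<open>n\<close>, because they are \<open>n\<close>-th
  roots of unity.\<close>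

lemma coinv_ideal_spanning:
  assumes n: "n \<ge> 2" and f: "f \<in> carrier (super_ring k j)"
  shows "\<exists>c. f - combination c (coinv_basis n k j) \<in> coinv_ideal n k j"
proof -
  let ?S = "carrier (super_ring k j)" and ?I = "coinv_ideal n k j" and ?B = "coinv_basis n k j"
  let ?W = "{f. \<exists>c. f - combination c ?B \<in> ?I}"
  interpret R: ring "super_ring k j"
    by (rule ring_super_ring)
  interpret I: ideal ?I "super_ring k j"
    by (rule ideal_coinv_ideal)
  have S: "0 \<in> ?S" "f + h \<in> ?S" "f * h \<in> ?S" if "f \<in> ?S" "h \<in> ?S" for f h
    using R.zero_closed R.a_closed[OF that] R.m_closed[OF that] by simp_all
  have S_sconst: "sconst c \<in> ?S" for c
    by (simp only: carrier_super_ring mem_Collect_eq support_in_sconst)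
  have I: "0 \<in> ?I" "\<And>f h. f \<in> ?I \<Longrightarrow> h \<in> ?I \<Longrightarrow> f + h \<in> ?I"
    "\<And>f s. f \<in> ?I \<Longrightarrow> s \<in> ?S \<Longrightarrow> s * f \<in> ?I" "\<And>f s. f \<in> ?I \<Longrightarrow> s \<in> ?S \<Longrightarrow> f * s \<in> ?I"
    using I.zero_closed I.a_closed I.I_l_closed I.I_r_closed by simp_all
  have S_light: "eigenvar k w c \<in> ?S" if "c \<in> {1..k + j}" for w c
    unfolding eigenvar_def by (intro S svar_in_super_ring S_sconst that)
  have ii: "\<i> * \<i> = - 1" "- \<i> * - \<i> = - 1"
    by simp_all
  have "coinv_relations n k j ?S ?I ?W"
  proof
    show "svar k c s \<in> ?S" if "c \<in> {1..k + j}" for c s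
      using that by (rule svar_in_super_ring)
  next
    fix a b assume ab: "a \<in> {1..k + j}" "b \<in> {1..k + j}"
    let ?N = "eigenvar k \<i> a * eigenvar k (- \<i>) b + eigenvar k (- \<i>) a * eigenvar k \<i> b"
    have "?N \<in> ?I"
    proof (rule invariant_in_coinv_ideal)
      show "?N \<in> ?S"
        by (intro S S_light ab)
      show "act (rho n) ?N = ?N"
        using rho_eigenvalue_mult[of n] rho_eigenvalue_mult[of n, unfolded mult.commute[of "rho_eigenvalue n \<i>"]]
        by (simp only: act_add act_mult act_rho_eigenvar ii sconst_mult_mult sconst_simps mult_1_left)
      show "act phi ?N = ?N"
        by (simp add: act_add act_mult act_phi_eigenvar add.commute)
      show "scoeff ?N 0 {||} = 0"
        by (simp add: scoeff_mult_const scoeff_eigenvar_const)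
    qed
    then have "sconst (1 / 2) * (sconst 2 * (svar k a 1 * svar k b 1 + svar k a 2 * svar k b 2)) \<in> ?I"
      unfolding quadric_eq_eigenvar by (rule I(3)[OF _ S_sconst])
    then show "svar k a 1 * svar k b 1 + svar k a 2 * svar k b 2 \<in> ?I"
      by (simp only: mult.assoc[symmetric] sconst_mult[symmetric]) simp
  next
    fix cs assume cs: "set cs \<subseteq> {1..k + j}" "length cs = n"
    let ?N = "eigen_prod k \<i> cs + eigen_prod k (- \<i>) cs"
    have "eigen_prod k w ds \<in> ?S" if "set ds \<subseteq> {1..k + j}" for w ds
      using that by (induction ds) (use S_sconst[of 1] in \<open>auto intro!: S(3) S_light\<close>)
    moreover have "scoeff (eigen_prod k w cs) 0 {||} = 0" for w
      using cs n by (cases cs) (simp_all add: scoeff_mult_const scoeff_eigenvar_const)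
    ultimately show "?N \<in> ?I"
      using cs by (intro invariant_in_coinv_ideal S)
        (simp_all add: act_add act_rho_eigen_prod rho_eigenvalue_power[OF n] act_phi_eigen_prod add.commute)
  next
    fix f h assume "f \<in> ?W" "h \<in> ?W"
    then obtain c d where "(f - combination c ?B) + (h - combination d ?B) \<in> ?I"
      using I(2) by blast
    then have "(f + h) - combination (\<lambda>b. c b + d b) ?B \<in> ?I"
      by (simp add: combination_simps algebra_simps)
    then show "f + h \<in> ?W"
      by blast
  next
    fix f a assume "f \<in> ?W"
    then obtain c where "sconst a * (f - combination c ?B) \<in> ?I"
      using I(3) S_sconst by blast
    then have "sconst a * f - combination (\<lambda>b. a * c b) ?B \<in> ?I"
      by (simp add: combination_simps algebra_simps)
    then show "sconst a * f \<in> ?W"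
      by blast
  next
    show "?I \<subseteq> ?W"
    proof
      fix f assume "f \<in> ?I"
      then have "f - combination (\<lambda>b. 0) ?B \<in> ?I"
        by (simp add: combination_def)
      then show "f \<in> ?W"
        by blast
    qed
    show "?B \<subseteq> ?W"
    proof
      fix b assume "b \<in> ?B"
      then have "b - combination (\<lambda>b'. if b' = b then 1 else 0) ?B \<in> ?I"
        using I(1) by (simp add: combination_single finite_coinv_basis)
      then show "b \<in> ?W"
        by blast
    qed
  qed (use n S S_sconst[of 0] S_sconst I in auto)
  then have "f \<in> ?W"
    by (rule coinv_relations.spanning) (use f in \<open>simp only: carrier_super_ring mem_Collect_eq\<close>)
  then show ?thesis
    by blast
qed

section \<open>The quotient ring\<close>

theorem theorem5p2:
  fixes n k j :: nat
  assumes "n \<ge> 2"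
  shows "coinv_monomial_basis n k j (dihedral_basis n k j)"
proof -
  let ?R = "super_ring k j" and ?I = "coinv_ideal n k j" and ?Q = "coinv_ring n k j"
  let ?cl = "coinv_class n k j" and ?K = "coinv_scalars n k j" and ?B = "coinv_basis n k j"
  interpret R: ring ?R
    by (rule ring_super_ring)
  interpret I: ideal ?I ?R
    by (rule ideal_coinv_ideal)
  interpret Q: ring ?Q
    unfolding coinv_ring_def by (rule I.quotient_is_ring)
  have hom: "?cl \<in> ring_hom ?R ?Q"
    unfolding coinv_ring_def coinv_class_def using I.rcos_ring_hom by (simp add: ring_hom_def)
  have cl_carrier: "carrier ?Q = ?cl ` carrier ?R"
    unfolding coinv_ring_def coinv_class_def FactRing_def A_RCOSETS_def' by auto
  have S_sconst: "sconst c \<in> carrier ?R" for c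
    by (simp only: carrier_super_ring mem_Collect_eq support_in_sconst)
  have B_carrier: "?B \<subseteq> carrier ?R"
  proof
    fix b assume "b \<in> ?B"
    have F: "firsts k cs \<in> carrier ?R" if "set cs \<subseteq> {1..k + j}" for cs
      using that
    proof (induction cs)
      case (Cons c cs)
      then show ?case
        using R.m_closed[OF svar_in_super_ring[of c k j 1], of "firsts k cs"] by simp
    qed (use R.one_closed in simp)
    have M: "firsts k cs * svar k i 2 \<in> carrier ?R" if "set cs \<subseteq> {1..k + j}" "i \<in> {1..k + j}" for cs i
      using R.m_closed[OF F[OF that(1)] svar_in_super_ring[OF that(2)]] by simp
    show "b \<in> carrier ?R"
      using \<open>b \<in> ?B\<close> by (cases rule: coinv_basis_cases) (auto simp: admissible_def simp del: firsts_simps intro!: F M)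
  qed
  have comb_carrier: "combination c U \<in> carrier ?R" if "U \<subseteq> ?B" for c U
  proof -
    have "finite U"
      using that finite_coinv_basis finite_subset by blast
    then show ?thesis
      using that
    proof induction
      case (insert b U)
      then show ?case
        using R.a_closed[of "sconst (c b) * b" "combination c U"] R.m_closed[OF S_sconst, of b] B_carrier
        by (auto simp: combination_def)
    qed (use R.zero_closed in \<open>simp add: combination_def\<close>)
  qed
  have cl_eq: "?cl f = ?cl h \<longleftrightarrow> f - h \<in> ?I" if "f \<in> carrier ?R" "h \<in> carrier ?R" for f h
    using R.quotient_eq_iff_same_a_r_cos[OF ideal_coinv_ideal that] that
    by (simp add: coinv_class_def a_minus_def a_inv_super_ring)
  have Span: "Q.Span ?K (map ?cl bs) = {?cl (combination c (set bs)) | c. True}"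
    if "distinct bs" "set bs \<subseteq> ?B" for bs
    using that
  proof (induction bs)
    case Nil
    have "?cl 0 = \<zero>\<^bsub>?Q\<^esub>"
      using ring_hom_zero[OF hom R.ring_axioms Q.ring_axioms] by simp
    then show ?case
      by (simp add: combination_def)
  next
    case (Cons b bs)
    have b: "b \<in> carrier ?R" "b \<notin> set bs" and U: "set bs \<subseteq> ?B"
      using Cons.prems B_carrier by auto
    have step: "?cl (sconst a) \<otimes>\<^bsub>?Q\<^esub> ?cl b \<oplus>\<^bsub>?Q\<^esub> ?cl (combination c (set bs))
        = ?cl (sconst a * b + combination c (set bs))" for a c
      using ring_hom_mult[OF hom S_sconst b(1)] ring_hom_add[OF hom R.m_closed[OF S_sconst b(1)] comb_carrier[OF U]]
      by simp
    have comb: "combination c (set (b # bs)) = sconst (c b) * b + combination c (set bs)" for c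
      using b(2) by (simp add: combination_def)
    have upd: "combination (c(b := a)) (set bs) = combination c (set bs)" for c a
      unfolding combination_def using b(2) by (intro sum.cong) auto
    have "Q.Span ?K (map ?cl (b # bs)) = {?cl (sconst a * b + combination c (set bs)) | a c. True}"
    proof -
      have "Q.Span ?K (map ?cl (b # bs)) = Q.line_extension ?K (?cl b) (Q.Span ?K (map ?cl bs))"
        by simp
      also have "\<dots> = {?cl (sconst a) \<otimes>\<^bsub>?Q\<^esub> ?cl b \<oplus>\<^bsub>?Q\<^esub> ?cl (combination c (set bs)) | a c. True}"
        using Cons.IH Cons.prems
        by (auto simp: Q.line_extension_def r_coset_def set_add_def' coinv_scalars_def)
      finally show ?thesis
        by (simp only: step)
    qed
    also have "\<dots> = {?cl (combination c (set (b # bs))) | c. True}"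
    proof (intro equalityI subsetI)
      fix q assume "q \<in> {?cl (sconst a * b + combination c (set bs)) | a c. True}"
      then obtain a c where "q = ?cl (sconst a * b + combination c (set bs))"
        by blast
      then have "q = ?cl (combination (c(b := a)) (set (b # bs)))"
        by (simp only: comb upd fun_upd_same)
      then show "q \<in> {?cl (combination c (set (b # bs))) | c. True}"
        by blast
    next
      fix q assume "q \<in> {?cl (combination c (set (b # bs))) | c. True}"
      then obtain c where "q = ?cl (combination c (set (b # bs)))"
        by blast
      then have "q = ?cl (sconst (c b) * b + combination c (set bs))"
        by (simp only: comb)
      then show "q \<in> {?cl (sconst a * b + combination c (set bs)) | a c. True}"
        by blast
    qed
    finally show ?case .
  qed
  have independent: "Q.independent ?K (map ?cl bs)" if "distinct bs" "set bs \<subseteq> ?B" for bs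
    using that
  proof (induction bs)
    case (Cons b bs)
    then have b: "b \<in> ?B" "b \<notin> set bs" and U: "set bs \<subseteq> ?B" "distinct bs"
      by auto
    have "?cl b \<notin> Q.Span ?K (map ?cl bs)"
    proof
      assume "?cl b \<in> Q.Span ?K (map ?cl bs)"
      then obtain c where "?cl b = ?cl (combination c (set bs))"
        unfolding Span[OF U(2,1)] by blast
      then have "b - combination c (set bs) \<in> functional_kernel n"
        using cl_eq[of b "combination c (set bs)"] comb_carrier[OF U(1)] b B_carrier
          coinv_ideal_functional_kernel[OF assms] by blast
      moreover obtain l where l: "dual_to n ?B b l"
        using dual_functional[OF assms b(1)] by blast
      then have add: "l (f + h) = l f + l h" and scale: "l (sconst a * f) = a * l f" for f h a
        by (simp_all add: dual_to_def)
      have l0: "l 0 = 0"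
        using scale[of 0 0] by simp
      have "l (combination c U) = (\<Sum>b'\<in>U. c b' * l b')" for U
        unfolding combination_def by (induction U rule: infinite_finite_induct) (simp_all add: l0 add scale)
      moreover have "(\<Sum>b'\<in>set bs. c b' * l b') = 0"
        using l b U by (intro sum.neutral) (auto simp: dual_to_def)
      moreover have "l (b - h) = l b - l h" for h
        using add[of "b - h" h] by simp
      ultimately have "l b = 0"
        using l by (auto simp: dual_to_def)
      then show False
        using l by (simp add: dual_to_def)
    qed
    moreover have "?cl b \<in> carrier ?Q"
      using b B_carrier cl_carrier by blast
    ultimately show ?case
      using Cons U by (auto intro: Q.li_Cons)
  qed simp
  obtain bs where bs: "set bs = ?B" "distinct bs"
    using finite_distinct_list[OF finite_coinv_basis] by blast
  have "Q.Span ?K (map ?cl bs) = carrier ?Q"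
  proof -
    have "?cl f \<in> {?cl (combination c ?B) | c. True}" if f: "f \<in> carrier ?R" for f
    proof -
      obtain c where "f - combination c ?B \<in> ?I"
        using coinv_ideal_spanning[OF assms f] by blast
      then have "?cl f = ?cl (combination c ?B)"
        using cl_eq[OF f comb_carrier[OF order_refl]] by blast
      then show ?thesis
        by blast
    qed
    moreover have "{?cl (combination c ?B) | c. True} \<subseteq> ?cl ` carrier ?R"
      using comb_carrier[OF order_refl] by blast
    ultimately have "{?cl (combination c ?B) | c. True} = ?cl ` carrier ?R"
      by blast
    then show ?thesis
      using Span[OF bs(2)] bs(1) cl_carrier by simp
  qed
  moreover have "Q.independent ?K (map ?cl bs)"
    using bs by (intro independent) simp_all
  ultimately have "\<exists>bs. set bs = ?B \<and> Q.independent ?K (map ?cl bs) \<and> Q.Span ?K (map ?cl bs) = carrier ?Q"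
    using bs(1) by blast
  then show ?thesis
    unfolding coinv_monomial_basis_def dihedral_basis_eq using coinv_basis_monomials by blast
qed

end
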